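(* Let $a(z)$, $a_0(z)$ and $a_1(z)$ be rational functions with $a_1(z)\not\equiv 0$ or $a_0(z)\not\equiv 0$, and let $w(z)$ be a transcendental entire solution with $\sigma_2(w)<1$ of the equation $$w(z+1)-w(z-1)+a(z)\frac{w'(z)}{w(z)}=a_1(z)w(z)+a_0(z).$$ (i) If $a(z)\equiv 0$, then $\sigma(w)\ge 1$. (ii) If $a(z)\not\equiv 0$, then $w(z)=H(z)e^{dz}$, where $H(z)\not\equiv 0$ is a polynomial and $d\ne 0$ is some complex number. In particular: if $a_1(z)$ is a polynomial with $a_1(z)\not\equiv 2i$ and $a_1(z)\not\equiv -2i$, then $w(z)=Ce^{dz}$ with $C\in\mathbb{C}\setminus\{0\}$; and if $a_1(z)\equiv \pm 2i$, then $w(z)=(C_1z+C_0)e^{(2k\pm\frac12)\pi i z}$ (with the corresponding choice of sign), where $k$ is an integer and $C_1,C_0\in\mathbb{C}$ with $|C_1|+|C_0|\ne 0$.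
   Context: All rational functions of $z$ are over $\mathbb{C}$ and may be identically zero unless stated otherwise. For a meromorphic function $w$ in the complex plane with Nevanlinna characteristic $T(r,w)$, the order is $\sigma(w)=\limsup_{r\to\infty}\frac{\log T(r,w)}{\log r}$ and the hyper-order is $\sigma_2(w)=\limsup_{r\to\infty}\frac{\log\log T(r,w)}{\log r}$. A solution of the equation is a function satisfying it identically as an identity of meromorphic functions. *)

theory Defs
  imports "HOL-Complex_Analysis.Complex_Analysis"
    "HOL-Computational_Algebra.Computational_Algebra"
begin

(* Coprimality makes the function determined by the element of the field of rational functions
   it represents (value 0 exactly at the zeros and poles, removable singularities removed), so
   that identity of rational functions is equality at every point. *)
definition rational_function :: "(complex \<Rightarrow> complex) \<Rightarrow> bool" where
  "rational_function f \<longleftrightarrow>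
     (\<exists>p q :: complex poly. q \<noteq> 0 \<and> coprime p q \<and> (\<forall>z. f z = poly p z / poly q z))"

definition transcendental_entire :: "(complex \<Rightarrow> complex) \<Rightarrow> bool" where
  "transcendental_entire f \<longleftrightarrow> f holomorphic_on UNIV \<and> \<not> rational_function f"

definition log_plus :: "real \<Rightarrow> real" where
  "log_plus x = max 0 (ln x)"

definition proximity_fun :: "(complex \<Rightarrow> complex) \<Rightarrow> real \<Rightarrow> real" where
  "proximity_fun f r =
     1 / (2 * pi) * integral {0..2 * pi} (\<lambda>t. log_plus (cmod (f (of_real r * cis t))))"

(* Poles in the closed disc, counted with multiplicity: zorder is negative at a pole. *)
definition pole_count :: "(complex \<Rightarrow> complex) \<Rightarrow> real \<Rightarrow> nat" where
  "pole_count f r = (\<Sum>z | cmod z \<le> r \<and> is_pole f z. nat (- zorder f z))"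

definition pole_counting_fun :: "(complex \<Rightarrow> complex) \<Rightarrow> real \<Rightarrow> real" where
  "pole_counting_fun f r =
     integral {0..r} (\<lambda>t. (real (pole_count f t) - real (pole_count f 0)) / t)
       + real (pole_count f 0) * ln r"

definition nevanlinna_char :: "(complex \<Rightarrow> complex) \<Rightarrow> real \<Rightarrow> real" where
  "nevanlinna_char f r = proximity_fun f r + pole_counting_fun f r"

definition growth_order :: "(complex \<Rightarrow> complex) \<Rightarrow> ereal" where
  "growth_order f = Limsup at_top (\<lambda>r. ereal (ln (nevanlinna_char f r) / ln r))"

definition hyper_order :: "(complex \<Rightarrow> complex) \<Rightarrow> ereal" where
  "hyper_order f = Limsup at_top (\<lambda>r. ereal (ln (ln (nevanlinna_char f r)) / ln r))"

(* The equation is an identity of meromorphic functions: it is required off a sparse set, which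
   excludes the poles of the coefficients and of w'/w, where division by zero yields 0. *)
definition solves_equation ::
  "(complex \<Rightarrow> complex) \<Rightarrow> (complex \<Rightarrow> complex) \<Rightarrow> (complex \<Rightarrow> complex) \<Rightarrow> (complex \<Rightarrow> complex) \<Rightarrow> bool"
where
  "solves_equation a a0 a1 w \<longleftrightarrow>
     (\<forall>\<^sub>\<approx>z\<in>UNIV. w (z + 1) - w (z - 1) + a z * (deriv w z / w z) = a1 z * w z + a0 z)"

end

theory Submission imports Defs begin

text \<open>
  Part (i). Let \<open>w\<close> have order less than one and let \<open>L\<close> be fixed. There are arbitrarily large \<open>r\<close> with
  \<open>M(r + L) \<le> 2 M(r)\<close>, for \<open>M\<close> the maximum modulus of \<open>w\<close> or of \<open>w'\<close>, since otherwise \<open>M\<close> grows exponentially.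
  At a maximum point on such a circle Cauchy's estimates make \<open>w(z + 1) - w(z - 1)\<close> small compared with \<open>w\<close>,
  which excludes \<open>a1\<close> bounded away from zero at infinity, and comparable with \<open>w'\<close>. In the remaining case
  \<open>a1 = O(1/z)\<close> one gets \<open>r M(r, w') \<le> C M(r, w)\<close> up to polynomial terms, which is impossible for transcendental \<open>w\<close>.

  Part (ii). Zeros of \<open>w\<close> are zeros of the numerator of \<open>a\<close>, so \<open>w = H e\<^sup>g\<close> with a polynomial \<open>H\<close>, and the equation becomes
  \<open>R = e\<^sup>g F\<close> with \<open>R\<close> linear in \<open>g'\<close> and \<open>F\<close> linear in \<open>exp (g(z \<plusminus> 1) - g z)\<close>. Let \<open>P(r)\<close> be the mean of
  \<open>\<bar>Re g\<bar>\<close> over the circle of radius \<open>r\<close>. Hyper-order less than one gives \<open>P(r + L) \<le> 2 P(r)\<close> for arbitrarily large \<open>r\<close>,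
  and by the Schwarz integral formula the means of \<open>g(z \<plusminus> 1) - g z\<close> are then \<open>O(P(r) / L)\<close>. If \<open>R\<close> did not vanish
  identically, Jensen's inequality for \<open>R\<close> would bound \<open>P(r)\<close> by a small multiple of itself plus \<open>O(log P(r))\<close>.
  Hence \<open>R = F = 0\<close>; so \<open>g'\<close> is rational, \<open>g\<close> is a polynomial, and comparing exponentials along a ray
  in \<open>F = 0\<close> forces \<open>g\<close> to be linear. What is left is an identity between polynomials.
\<close>

section \<open>Means over circles\<close>

text \<open>Values in an arbitrary Banach space let the real means of Jensen and Nevanlinna and the
  complex means of Cauchy's formula share one set of rules.\<close>

definition circle_mean :: "real \<Rightarrow> (complex \<Rightarrow> 'a::banach) \<Rightarrow> 'a" where
  "circle_mean r f = (1 / (2 * pi)) *\<^sub>R integral {0..2 * pi} (\<lambda>t. f (of_real r * cis t))"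

section \<open>Linearity, monotonicity and norm bounds of circle means\<close>

lemma continuous_on_circle_param:
  assumes "continuous_on (sphere 0 r) f" "0 \<le> r"
  shows "continuous_on {0..2*pi} (\<lambda>t. f (of_real r * cis t))"
proof (rule continuous_on_compose2[OF assms(1)])
  show "continuous_on {0..2*pi} (\<lambda>t. of_real r * cis t)" by (intro continuous_intros)
qed (use assms(2) in \<open>auto simp: norm_mult\<close>)

lemma integrable_circle_param:
  fixes f :: "complex \<Rightarrow> 'a::banach"
  assumes "continuous_on (sphere 0 r) f" "0 \<le> r"
  shows "(\<lambda>t. f (of_real r * cis t)) integrable_on {0..2*pi}"
  using continuous_on_circle_param[OF assms] integrable_continuous_interval by blast

lemma circle_mean_add:
  fixes f g :: "complex \<Rightarrow> 'a::banach"
  assumes "continuous_on (sphere 0 r) f" "continuous_on (sphere 0 r) g" "0 \<le> r"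
  shows "circle_mean r (\<lambda>z. f z + g z) = circle_mean r f + circle_mean r g"
  using assms unfolding circle_mean_def
  by (subst Henstock_Kurzweil_Integration.integral_add) (auto intro: integrable_circle_param simp: scaleR_add_right)

lemma circle_mean_diff:
  fixes f g :: "complex \<Rightarrow> 'a::banach"
  assumes "continuous_on (sphere 0 r) f" "continuous_on (sphere 0 r) g" "0 \<le> r"
  shows "circle_mean r (\<lambda>z. f z - g z) = circle_mean r f - circle_mean r g"
  using assms unfolding circle_mean_def
  by (subst Henstock_Kurzweil_Integration.integral_diff) (auto intro: integrable_circle_param simp: scaleR_diff_right)

lemma circle_mean_const [simp]: "circle_mean r (\<lambda>z. c) = c"
  unfolding circle_mean_def by simp

lemma circle_mean_cmult: 
  fixes c :: real shows "circle_mean r (\<lambda>z. c * f z) = c * circle_mean r f"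
  unfolding circle_mean_def by simp

lemma circle_mean_mono:
  fixes f g :: "complex \<Rightarrow> real"
  assumes "continuous_on (sphere 0 r) f" "continuous_on (sphere 0 r) g" "0 \<le> r"
    and "\<And>z. cmod z = r \<Longrightarrow> f z \<le> g z"
  shows "circle_mean r f \<le> circle_mean r g"
  unfolding circle_mean_def real_scaleR_def
  by (intro mult_left_mono integral_le integrable_circle_param assms) (use assms(3) in \<open>auto simp: norm_mult\<close>)

lemma circle_mean_cong:
  assumes "0 \<le> r" "\<And>z. cmod z = r \<Longrightarrow> f z = g z"
  shows "circle_mean r f = circle_mean r g"
  unfolding circle_mean_def using assms by (simp add: norm_mult)

lemma circle_mean_nonneg:
  fixes f :: "complex \<Rightarrow> real"
  assumes "continuous_on (sphere 0 r) f" "0 \<le> r" "\<And>z. cmod z = r \<Longrightarrow> 0 \<le> f z"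
  shows "0 \<le> circle_mean r f"
  using circle_mean_mono[of r "\<lambda>_. 0" f] assms by simp

lemma norm_circle_mean_le:
  fixes f :: "complex \<Rightarrow> 'a::banach"
  assumes "continuous_on (sphere 0 r) f" "continuous_on (sphere 0 r) g" "0 \<le> r"
    and "\<And>z. cmod z = r \<Longrightarrow> norm (f z) \<le> g z"
  shows "norm (circle_mean r f) \<le> circle_mean r g"
  unfolding circle_mean_def norm_scaleR real_scaleR_def
  using assms by (auto intro!: divide_right_mono integral_norm_bound_integral integrable_circle_param simp: norm_mult)

lemma circle_mean_Re:
  assumes "continuous_on (sphere 0 r) f" "0 \<le> r"
  shows "circle_mean r (\<lambda>z. Re (f z)) = Re (circle_mean r f)"
  unfolding circle_mean_def
  using integral_linear[OF integrable_circle_param[OF assms] bounded_linear_Re]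
  by (simp add: o_def)

lemma circle_mean_cnj:
  assumes "continuous_on (sphere 0 r) f" "0 \<le> r"
  shows "circle_mean r (\<lambda>z. cnj (f z)) = cnj (circle_mean r f)"
  unfolding circle_mean_def
  using integral_linear[OF integrable_circle_param[OF assms] bounded_linear_cnj]
  by (simp add: o_def scaleR_conv_of_real)

lemma circle_mean_of_real:
  fixes f :: "complex \<Rightarrow> real"
  assumes "continuous_on (sphere 0 r) f" "0 \<le> r"
  shows "circle_mean r (\<lambda>z. complex_of_real (f z)) = of_real (circle_mean r f)"
  unfolding circle_mean_def
  using integral_linear[OF integrable_circle_param[OF assms] bounded_linear_of_real[where 'a=complex]]
  by (simp add: o_def scaleR_conv_of_real)

section \<open>Cauchy, Schwarz and Poisson formulas as means\<close>

lemma circle_mean_Cauchy: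
  assumes "f holomorphic_on cball 0 R" "cmod z < R"
  shows "circle_mean R (\<lambda>\<zeta>. f \<zeta> * \<zeta> / (\<zeta> - z)) = f z"
proof -
  have "contour_integral (circlepath 0 R) (\<lambda>u. f u / (u - z)) = 2 * of_real pi * \<i> * f z"
    using Cauchy_integral_circlepath_simple[OF assms(1), of z] assms(2) contour_integral_unique by auto
  \<comment> \<open>On the circle the line element is \<open>\<i> * \<zeta>\<close> times
    \<open>dt\<close>; this is where the extra factor \<open>\<zeta>\<close> in the integrand comes
    from.\<close>
  moreover have "contour_integral (circlepath 0 R) (\<lambda>u. f u / (u - z)) =
     integral {0..2*pi} (\<lambda>t. \<i> * (f (R * cis t) * (R * cis t) / (R * cis t - z)))"
    by (simp add: circlepath_def contour_integral_part_circlepath_eq mult_ac)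
  moreover have "integral {0..2*pi} (\<lambda>t. \<i> * (f (R * cis t) * (R * cis t) / (R * cis t - z))) =
     \<i> * integral {0..2*pi} (\<lambda>t. f (R * cis t) * (R * cis t) / (R * cis t - z))"
    by (rule integral_mult_right)
  ultimately have "\<i> * integral {0..2*pi} (\<lambda>t. f (R * cis t) * (R * cis t) / (R * cis t - z)) = 2 * of_real pi * \<i> * f z"
    by simp
  then show ?thesis unfolding circle_mean_def
    by (simp add: scaleR_conv_of_real field_simps)
qed

lemma circle_mean_center:
  assumes "f holomorphic_on cball 0 R" "0 < R"
  shows "circle_mean R f = f 0"
proof -
  have "circle_mean R f = circle_mean R (\<lambda>\<zeta>. f \<zeta> * \<zeta> / (\<zeta> - 0))"
    using assms by (intro circle_mean_cong) auto
  then show ?thesis using circle_mean_Cauchy[OF assms(1), of 0] assms(2) by simp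
qed

text \<open>Twice the real part is \<open>g + cnj g\<close>. The first summand is Cauchy's formula;
  the second is, on the circle, the conjugate of a function holomorphic in the disc, whose mean is
  its value at the centre.\<close>

lemma circle_mean_Schwarz:
  assumes hol: "g holomorphic_on cball 0 R" and z: "cmod z < R"
  shows "circle_mean R (\<lambda>\<zeta>. of_real (2 * Re (g \<zeta>)) * \<zeta> / (\<zeta> - z)) = g z + cnj (g 0)"
proof -
  have R: "R > 0" using z norm_ge_zero[of z] by linarith
  have cont: "continuous_on (sphere 0 R) g"
    using hol holomorphic_on_imp_continuous_on continuous_on_subset sphere_cball by blast
  have nz: "\<zeta> - z \<noteq> 0" if "cmod \<zeta> = R" for \<zeta> using that z by auto
  have nz': "of_real (R\<^sup>2) - cnj z * \<zeta> \<noteq> 0" if "cmod \<zeta> \<le> R" for \<zeta>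
  proof
    assume "of_real (R\<^sup>2) - cnj z * \<zeta> = 0"
    then have "cmod (of_real (R\<^sup>2)) = cmod (cnj z * \<zeta>)" by (metis eq_iff_diff_eq_0)
    then have "R * R = cmod z * cmod \<zeta>" by (simp add: norm_mult power2_eq_square)
    moreover have "cmod z * cmod \<zeta> \<le> cmod z * R" using that by (intro mult_left_mono) auto
    moreover have "cmod z * R < R * R" using z R by (intro mult_strict_right_mono)
    ultimately show False by linarith
  qed
  \<comment> \<open>Obtained from \<open>cnj (g \<zeta>) * \<zeta> / (\<zeta> - z)\<close> by
    conjugating and using \<open>of_real (R\<^sup>2) = \<zeta> * cnj \<zeta>\<close>. Any pole of
    the new kernel lies outside the closed disc because \<open>cmod z < R\<close>.\<close>
  define h where "h = (\<lambda>\<zeta>. g \<zeta> * of_real (R\<^sup>2) / (of_real (R\<^sup>2) - cnj z * \<zeta>))"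
  have hh: "h holomorphic_on cball 0 R" unfolding h_def
    by (intro holomorphic_intros hol) (use nz' in auto)
  have ch: "continuous_on (sphere 0 R) h"
    using hh holomorphic_on_imp_continuous_on continuous_on_subset sphere_cball by blast
  have eq: "of_real (2 * Re (g \<zeta>)) * \<zeta> / (\<zeta> - z) = g \<zeta> * \<zeta> / (\<zeta> - z) + cnj (h \<zeta>)" if "cmod \<zeta> = R" for \<zeta>
  proof -
    have "of_real (R\<^sup>2) = \<zeta> * cnj \<zeta>" using that complex_norm_square[of \<zeta>] by simp
    moreover have "\<zeta> \<noteq> 0" using that R by auto
    ultimately have "cnj (h \<zeta>) = cnj (g \<zeta>) * \<zeta> / (\<zeta> - z)"
      unfolding h_def using nz[OF that] by (simp add: divide_simps) (simp add: algebra_simps)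
    then show ?thesis using complex_add_cnj[of "g \<zeta>"] by (simp add: add_divide_distrib [symmetric] distrib_right [symmetric])
  qed
  have "circle_mean R (\<lambda>\<zeta>. of_real (2 * Re (g \<zeta>)) * \<zeta> / (\<zeta> - z))
      = circle_mean R (\<lambda>\<zeta>. g \<zeta> * \<zeta> / (\<zeta> - z) + cnj (h \<zeta>))"
    using R eq by (intro circle_mean_cong) auto
  also have "\<dots> = g z + cnj (circle_mean R h)"
    using R nz by (subst circle_mean_add) (auto intro!: continuous_intros cont ch simp: circle_mean_Cauchy[OF hol z] circle_mean_cnj[OF ch])
  also have "circle_mean R h = g 0" using circle_mean_center[OF hh R] R by (simp add: h_def)
  finally show ?thesis .
qed

text \<open>This is the normalisation of the Poisson kernel: on the circle the integrand equals a
  Cauchy integrand whose pole is the reflection of \<open>\<zeta>\<close>.\<close>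

lemma circle_mean_inverse_square:
  assumes "0 < r" "r < cmod \<zeta>"
  shows "circle_mean r (\<lambda>z. 1 / (cmod (\<zeta> - z))\<^sup>2) = 1 / ((cmod \<zeta>)\<^sup>2 - r\<^sup>2)"
proof -
  have z0: "\<zeta> \<noteq> 0" using assms by auto
  \<comment> \<open>The reflection of \<open>\<zeta>\<close> in the circle of radius
    \<open>r\<close>; it lies inside because \<open>\<zeta>\<close> lies outside.\<close>
  define w where "w = of_real (r\<^sup>2) / cnj \<zeta>"
  have w: "cmod w < r"
  proof -
    have "cmod w = r * (r / cmod \<zeta>)" by (simp add: w_def norm_divide norm_power power2_eq_square norm_mult)
    also have "\<dots> < r * 1" using assms z0 by (intro mult_strict_left_mono) (auto simp: divide_simps)
    finally show ?thesis by simp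
  qed
  have nz: "\<zeta> - z \<noteq> 0" if "cmod z \<le> r" for z using that assms by auto
  have hol: "(\<lambda>z. 1 / (cnj \<zeta> * (\<zeta> - z))) holomorphic_on cball 0 r"
    by (intro holomorphic_intros) (use nz z0 in auto)
  have eq: "complex_of_real (1 / (cmod (\<zeta> - z))\<^sup>2) = 1 / (cnj \<zeta> * (\<zeta> - z)) * z / (z - w)" if "cmod z = r" for z
  proof -
    have "z \<noteq> 0" using that assms by auto
    have rr: "of_real (r\<^sup>2) = z * cnj z" using that complex_norm_square[of z] by simp
    have "cnj \<zeta> * (z - w) = z * cnj (\<zeta> - z)" using z0 unfolding w_def rr by (simp add: field_simps)
    moreover have "complex_of_real (1 / (cmod (\<zeta> - z))\<^sup>2) = 1 / ((\<zeta> - z) * cnj (\<zeta> - z))"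
      by (simp only: of_real_divide of_real_1 complex_norm_square)
    moreover have "z - w \<noteq> 0" using w that by auto
    moreover have "cnj (\<zeta> - z) \<noteq> 0" using nz[of z] that by auto
    moreover have "1 / (cnj \<zeta> * (\<zeta> - z)) * z / (z - w) = z / ((\<zeta> - z) * (cnj \<zeta> * (z - w)))" by simp
    ultimately show ?thesis using \<open>z \<noteq> 0\<close> by simp
  qed
  have cont: "continuous_on (sphere 0 r) (\<lambda>z. 1 / (cmod (\<zeta> - z))\<^sup>2)"
    using nz by (intro continuous_intros) auto
  have "of_real (circle_mean r (\<lambda>z. 1 / (cmod (\<zeta> - z))\<^sup>2))
      = circle_mean r (\<lambda>z. complex_of_real (1 / (cmod (\<zeta> - z))\<^sup>2))"
    using circle_mean_of_real[OF cont] assms by simp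
  also have "\<dots> = circle_mean r (\<lambda>z. 1 / (cnj \<zeta> * (\<zeta> - z)) * z / (z - w))"
    using assms eq by (intro circle_mean_cong) auto
  also have "\<dots> = 1 / (cnj \<zeta> * (\<zeta> - w))" using circle_mean_Cauchy[OF hol w] .
  also have "cnj \<zeta> * (\<zeta> - w) = of_real ((cmod \<zeta>)\<^sup>2 - r\<^sup>2)"
    using z0 by (simp add: w_def complex_norm_square right_diff_distrib del: of_real_power)
  finally show ?thesis by (metis of_real_1 of_real_divide of_real_eq_iff)
qed

section \<open>Iterated means and estimates of differences by the real part\<close>

lemma continuous_on_circle_mean:
  fixes F :: "complex \<Rightarrow> complex \<Rightarrow> 'a::banach"
  assumes "continuous_on (S \<times> sphere 0 R) (\<lambda>(z, \<zeta>). F z \<zeta>)" "0 \<le> R"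
  shows "continuous_on S (\<lambda>z. circle_mean R (F z))"
proof -
  have "continuous_on (S \<times> cbox 0 (2*pi)) (\<lambda>x. (\<lambda>(z, \<zeta>). F z \<zeta>) (fst x, of_real R * cis (snd x)))"
    by (rule continuous_on_compose2[OF assms(1)], intro continuous_intros) (use assms(2) in \<open>auto simp: norm_mult\<close>)
  then have "continuous_on (S \<times> cbox 0 (2*pi)) (\<lambda>(z, t). F z (of_real R * cis t))"
    by (simp add: case_prod_beta)
  then have "continuous_on S (\<lambda>z. integral (cbox 0 (2*pi)) (\<lambda>t. F z (of_real R * cis t)))"
    by (rule integral_continuous_on_param)
  then show ?thesis unfolding circle_mean_def by (auto intro!: continuous_intros)
qed

lemma circle_mean_swap:
  fixes F :: "complex \<Rightarrow> complex \<Rightarrow> 'a::banach"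
  assumes "continuous_on (sphere 0 r \<times> sphere 0 R) (\<lambda>(z, \<zeta>). F z \<zeta>)" "0 \<le> R" "0 \<le> r"
  shows "circle_mean r (\<lambda>z. circle_mean R (\<lambda>\<zeta>. F z \<zeta>)) = circle_mean R (\<lambda>\<zeta>. circle_mean r (\<lambda>z. F z \<zeta>))"
proof -
  have "continuous_on (cbox (0, 0) (2*pi, 2*pi)) (\<lambda>x. (\<lambda>(z, \<zeta>). F z \<zeta>) (of_real r * cis (fst x), of_real R * cis (snd x)))"
    by (rule continuous_on_compose2[OF assms(1)], intro continuous_intros) (use assms(2,3) in \<open>auto simp: norm_mult\<close>)
  then have "continuous_on (cbox (0, 0) (2*pi, 2*pi)) (\<lambda>(s, t). F (of_real r * cis s) (of_real R * cis t))"
    by (simp add: case_prod_beta)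
  from integral_swap_continuous[OF this] show ?thesis unfolding circle_mean_def by simp
qed

text \<open>Subtracting the Schwarz formula at two points cancels the constant
  \<open>cnj (g 0)\<close>, and the difference of the kernels gains a second denominator.\<close>

lemma circle_mean_Schwarz_diff:
  assumes hol: "g holomorphic_on cball 0 R" and z: "cmod z < R" and u: "cmod u < R"
  shows "cmod (g z - g u) \<le> circle_mean R (\<lambda>\<zeta>. 2 * \<bar>Re (g \<zeta>)\<bar> * R * cmod (z - u) / (cmod (\<zeta> - z) * cmod (\<zeta> - u)))"
proof -
  have R: "R > 0" using z norm_ge_zero[of z] by linarith
  have cont: "continuous_on (sphere 0 R) g"
    using hol holomorphic_on_imp_continuous_on continuous_on_subset sphere_cball by blast
  have nz: "\<zeta> - z \<noteq> 0" "\<zeta> - u \<noteq> 0" if "cmod \<zeta> = R" for \<zeta> using that z u by auto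
  let ?k = "\<lambda>z \<zeta>. of_real (2 * Re (g \<zeta>)) * \<zeta> / (\<zeta> - z)"
  have "g z - g u = circle_mean R (?k z) - circle_mean R (?k u)"
    using circle_mean_Schwarz[OF hol z] circle_mean_Schwarz[OF hol u] by simp
  also have "\<dots> = circle_mean R (\<lambda>\<zeta>. ?k z \<zeta> - ?k u \<zeta>)"
    by (subst circle_mean_diff) (use R nz in \<open>auto intro!: continuous_intros cont\<close>)
  also have "\<dots> = circle_mean R (\<lambda>\<zeta>. of_real (2 * Re (g \<zeta>)) * \<zeta> * (z - u) / ((\<zeta> - z) * (\<zeta> - u)))"
  proof (rule circle_mean_cong)
    fix \<zeta> assume "cmod \<zeta> = R"
    then show "?k z \<zeta> - ?k u \<zeta> = of_real (2 * Re (g \<zeta>)) * \<zeta> * (z - u) / ((\<zeta> - z) * (\<zeta> - u))"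
      using nz[of \<zeta>] by (simp add: divide_simps) (simp add: algebra_simps)
  qed (use R in auto)
  finally have eq: "g z - g u = \<dots>" .
  show ?thesis unfolding eq
    by (rule norm_circle_mean_le) (use R nz in \<open>auto intro!: continuous_intros cont simp: norm_mult norm_divide abs_mult\<close>)
qed

text \<open>A Borel-Caratheodory estimate with a mean of \<open>\<bar>Re g\<bar>\<close> in place of
  a maximum of \<open>Re g\<close>. Read backwards, it bounds that mean from below when
  \<open>g\<close> is not constant.\<close>

lemma Schwarz_bound:
  assumes hol: "g holomorphic_on cball 0 R" and z: "cmod z < R"
  shows "cmod (g z - g 0) \<le> 2 * cmod z / (R - cmod z) * circle_mean R (\<lambda>\<zeta>. \<bar>Re (g \<zeta>)\<bar>)"
proof -
  have R: "R > 0" using z norm_ge_zero[of z] by linarith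
  have cont: "continuous_on (sphere 0 R) g"
    using hol holomorphic_on_imp_continuous_on continuous_on_subset sphere_cball by blast
  have nz: "\<zeta> - z \<noteq> 0" "\<zeta> \<noteq> 0" if "cmod \<zeta> = R" for \<zeta> using that z R by auto
  have "cmod (g z - g 0) \<le> circle_mean R (\<lambda>\<zeta>. 2 * \<bar>Re (g \<zeta>)\<bar> * R * cmod (z - 0) / (cmod (\<zeta> - z) * cmod (\<zeta> - 0)))"
    using circle_mean_Schwarz_diff[OF hol z, of 0] R by simp
  also have "\<dots> \<le> circle_mean R (\<lambda>\<zeta>. 2 * cmod z / (R - cmod z) * \<bar>Re (g \<zeta>)\<bar>)"
  proof (rule circle_mean_mono)
    fix \<zeta> assume \<zeta>: "cmod \<zeta> = R"
    have "R - cmod z \<le> cmod (\<zeta> - z)" using \<zeta> norm_triangle_ineq2[of \<zeta> z] by simp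
    then have "2 * \<bar>Re (g \<zeta>)\<bar> * cmod z / cmod (\<zeta> - z) \<le> 2 * \<bar>Re (g \<zeta>)\<bar> * cmod z / (R - cmod z)"
      using z by (intro divide_left_mono mult_nonneg_nonneg mult_pos_pos) (use nz[OF \<zeta>] in auto)
    then show "2 * \<bar>Re (g \<zeta>)\<bar> * R * cmod (z - 0) / (cmod (\<zeta> - z) * cmod (\<zeta> - 0)) \<le> 2 * cmod z / (R - cmod z) * \<bar>Re (g \<zeta>)\<bar>"
      using R \<zeta> by (simp add: field_simps)
  qed (use R nz z in \<open>auto intro!: continuous_intros cont\<close>)
  also have "\<dots> = 2 * cmod z / (R - cmod z) * circle_mean R (\<lambda>\<zeta>. \<bar>Re (g \<zeta>)\<bar>)" by (rule circle_mean_cmult)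
  finally show ?thesis .
qed

text \<open>Averaging the kernel before estimating it avoids the factor of order \<open>r\<close> that a pointwise
  bound on \<open>g(z + h) - g z\<close> would lose.\<close>

lemma circle_mean_shift_diff:
  assumes hol: "g holomorphic_on cball 0 R" and r: "0 < r" "r + 1 < R" and h: "cmod h = 1"
  shows "circle_mean r (\<lambda>z. cmod (g (z + h) - g z))
     \<le> 2 * R / ((R - 1)\<^sup>2 - r\<^sup>2) * circle_mean R (\<lambda>\<zeta>. \<bar>Re (g \<zeta>)\<bar>)"
proof -
  have contR: "continuous_on (sphere 0 R) g"
    using hol holomorphic_on_imp_continuous_on continuous_on_subset sphere_cball by blast
  have contc: "continuous_on (cball 0 R) g" using hol holomorphic_on_imp_continuous_on by blast
  have zh: "cmod (z + h) < R" if "cmod z = r" for z using norm_triangle_ineq[of z h] that h r by linarith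
  have nz: "\<zeta> - z \<noteq> 0" "\<zeta> - (z + h) \<noteq> 0" if "cmod \<zeta> = R" "cmod z = r" for \<zeta> z
    using zh[of z] that r by auto
  \<comment> \<open>The product kernel is split by the inequality between arithmetic and geometric
    means, since the mean over \<open>z\<close> of each inverse square is known exactly.\<close>
  define F where "F = (\<lambda>z \<zeta>. \<bar>Re (g \<zeta>)\<bar> * R * (1 / (cmod (\<zeta> - (z + h)))\<^sup>2 + 1 / (cmod (\<zeta> - z))\<^sup>2))"
  have contF: "continuous_on (sphere 0 r \<times> sphere 0 R) (\<lambda>(z, \<zeta>). F z \<zeta>)"
    unfolding F_def case_prod_beta
    by (intro continuous_intros continuous_on_compose2[OF contR]) (use nz in auto)
  have contr: "continuous_on (sphere 0 r) (\<lambda>z. cmod (g (z + h) - g z))"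
    by (intro continuous_intros continuous_on_compose2[OF contc]) (use zh r in \<open>auto simp: less_imp_le\<close>)
  have le: "cmod (g (z + h) - g z) \<le> circle_mean R (F z)" if z: "cmod z = r" for z
  proof -
    have contFz: "continuous_on (sphere 0 R) (F z)" unfolding F_def
      by (intro continuous_intros contR) (use nz z in auto)
    have "cmod (g (z + h) - g z) \<le> circle_mean R (\<lambda>\<zeta>. 2 * \<bar>Re (g \<zeta>)\<bar> * R * cmod (z + h - z) / (cmod (\<zeta> - (z + h)) * cmod (\<zeta> - z)))"
      using zh[OF z] z r by (intro circle_mean_Schwarz_diff hol) auto
    also have "\<dots> \<le> circle_mean R (F z)"
    proof (rule circle_mean_mono[OF _ contFz])
      fix \<zeta> assume \<zeta>: "cmod \<zeta> = R"
      let ?a = "cmod (\<zeta> - (z + h))" and ?b = "cmod (\<zeta> - z)"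
      have "2 * (1 / ?a) * (1 / ?b) \<le> (1 / ?a)\<^sup>2 + (1 / ?b)\<^sup>2" by (rule sum_squares_bound)
      then have "2 / (?a * ?b) \<le> 1 / ?a\<^sup>2 + 1 / ?b\<^sup>2" by (simp add: power_divide)
      then have "\<bar>Re (g \<zeta>)\<bar> * R * (2 / (?a * ?b)) \<le> \<bar>Re (g \<zeta>)\<bar> * R * (1 / ?a\<^sup>2 + 1 / ?b\<^sup>2)"
        using r by (intro mult_left_mono) auto
      then show "2 * \<bar>Re (g \<zeta>)\<bar> * R * cmod (z + h - z) / (?a * ?b) \<le> F z \<zeta>"
        using h by (simp add: F_def mult_ac)
    qed (use r nz z in \<open>auto intro!: continuous_intros contR\<close>)
    finally show ?thesis .
  qed
  have "circle_mean r (\<lambda>z. cmod (g (z + h) - g z)) \<le> circle_mean r (\<lambda>z. circle_mean R (F z))"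
    using le r by (intro circle_mean_mono contr continuous_on_circle_mean[of _ _ F] contF) auto
  also have "\<dots> = circle_mean R (\<lambda>\<zeta>. circle_mean r (\<lambda>z. F z \<zeta>))"
    using r by (intro circle_mean_swap contF) auto
  also have "\<dots> \<le> circle_mean R (\<lambda>\<zeta>. 2 * R / ((R - 1)\<^sup>2 - r\<^sup>2) * \<bar>Re (g \<zeta>)\<bar>)"
  proof (rule circle_mean_mono)
    have "continuous_on (sphere 0 R \<times> sphere 0 r) (\<lambda>(\<zeta>, z). F z \<zeta>)"
      unfolding F_def case_prod_beta
      by (intro continuous_intros continuous_on_compose2[OF contR]) (use nz in auto)
    then show "continuous_on (sphere 0 R) (\<lambda>\<zeta>. circle_mean r (\<lambda>z. F z \<zeta>))"
      using r by (intro continuous_on_circle_mean[of _ _ "\<lambda>\<zeta> z. F z \<zeta>"]) auto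
    fix \<zeta> assume \<zeta>: "cmod \<zeta> = R"
    \<comment> \<open>The shift is moved from \<open>z\<close> to \<open>\<zeta>\<close>: the point
      \<open>\<zeta> - h\<close> still lies outside the circle of radius \<open>r\<close>, so the
      exact mean of the inverse square applies to it as well.\<close>
    have ge: "R - 1 \<le> cmod (\<zeta> - h)" using norm_triangle_ineq2[of \<zeta> h] \<zeta> h by simp
    have 1: "circle_mean r (\<lambda>z. 1 / (cmod (\<zeta> - z))\<^sup>2) = 1 / (R\<^sup>2 - r\<^sup>2)"
      using circle_mean_inverse_square[of r \<zeta>] r \<zeta> by simp
    have "circle_mean r (\<lambda>z. 1 / (cmod (\<zeta> - h - z))\<^sup>2) = 1 / ((cmod (\<zeta> - h))\<^sup>2 - r\<^sup>2)"
      using circle_mean_inverse_square[of r "\<zeta> - h"] r ge by simp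
    then have 2: "circle_mean r (\<lambda>z. 1 / (cmod (\<zeta> - (z + h)))\<^sup>2) = 1 / ((cmod (\<zeta> - h))\<^sup>2 - r\<^sup>2)"
      by (simp add: algebra_simps)
    have pos: "0 < (R - 1)\<^sup>2 - r\<^sup>2" using r by (simp add: power_strict_mono)
    have "(R - 1)\<^sup>2 \<le> (cmod (\<zeta> - h))\<^sup>2" "(R - 1)\<^sup>2 \<le> R\<^sup>2"
      using ge r by (auto intro!: power_mono)
    then have "1 / ((cmod (\<zeta> - h))\<^sup>2 - r\<^sup>2) \<le> 1 / ((R - 1)\<^sup>2 - r\<^sup>2)"
      "1 / (R\<^sup>2 - r\<^sup>2) \<le> 1 / ((R - 1)\<^sup>2 - r\<^sup>2)"
      using pos by (auto intro!: divide_left_mono mult_pos_pos)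
    then have s: "1 / ((cmod (\<zeta> - h))\<^sup>2 - r\<^sup>2) + 1 / (R\<^sup>2 - r\<^sup>2) \<le> 2 / ((R - 1)\<^sup>2 - r\<^sup>2)" by simp
    have "circle_mean r (\<lambda>z. F z \<zeta>) = \<bar>Re (g \<zeta>)\<bar> * R * circle_mean r (\<lambda>z. 1 / (cmod (\<zeta> - (z + h)))\<^sup>2 + 1 / (cmod (\<zeta> - z))\<^sup>2)"
      unfolding F_def by (rule circle_mean_cmult)
    also have "\<dots> = \<bar>Re (g \<zeta>)\<bar> * R * (1 / ((cmod (\<zeta> - h))\<^sup>2 - r\<^sup>2) + 1 / (R\<^sup>2 - r\<^sup>2))"
      by (subst circle_mean_add) (use 1 2 nz[OF \<zeta>] r in \<open>auto intro!: continuous_intros\<close>)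
    also have "\<dots> \<le> \<bar>Re (g \<zeta>)\<bar> * R * (2 / ((R - 1)\<^sup>2 - r\<^sup>2))"
      using s r by (intro mult_left_mono) auto
    finally show "circle_mean r (\<lambda>z. F z \<zeta>) \<le> 2 * R / ((R - 1)\<^sup>2 - r\<^sup>2) * \<bar>Re (g \<zeta>)\<bar>"
      by (simp add: mult_ac)
  qed (use r in \<open>auto intro!: continuous_intros contR\<close>)
  also have "\<dots> = 2 * R / ((R - 1)\<^sup>2 - r\<^sup>2) * circle_mean R (\<lambda>\<zeta>. \<bar>Re (g \<zeta>)\<bar>)" by (rule circle_mean_cmult)
  finally show ?thesis .
qed

section \<open>Entire functions\<close>

text \<open>A cosparse set contains a punctured neighbourhood of every point, so continuity supplies
  the exceptional values. This removes the points excluded by denominators.\<close>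

lemma continuous_eq_0_of_cosparse:
  fixes f :: "complex \<Rightarrow> complex"
  assumes "continuous_on UNIV f" "\<forall>\<^sub>\<approx>z\<in>UNIV. f z = 0"
  shows "f z = 0"
proof -
  have "eventually (\<lambda>z. f z = 0) (at z)" using eventually_cosparse_imp_eventually_at[OF assms(2)] by simp
  then have "(f \<longlongrightarrow> 0) (at z)" using tendsto_eventually by blast
  moreover have "(f \<longlongrightarrow> f z) (at z)" using assms(1) by (simp add: continuous_on_def)
  ultimately show ?thesis using tendsto_unique[OF at_neq_bot] by metis
qed

text \<open>Entire functions have no zero divisors: \<open>g\<close> vanishes on the nonempty open
  set where \<open>f\<close> does not, hence everywhere.\<close>

lemma entire_mult_eq_0:
  assumes "f holomorphic_on UNIV" "g holomorphic_on UNIV" "\<And>z. f z * g z = 0" "f z0 \<noteq> 0"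
  shows "g z = 0"
proof (rule analytic_continuation[OF assms(2)])
  have o: "open {z. f z \<noteq> 0}"
    by (intro open_Collect_neq holomorphic_on_imp_continuous_on assms(1) continuous_on_const)
  show "z0 islimpt {z. f z \<noteq> 0}"
    using o assms(4) by (intro interior_limit_point) (simp add: interior_open)
qed (use assms(3) in auto)

lemma entire_divide_linear:
  assumes "f holomorphic_on UNIV" "f a = 0"
  obtains h where "h holomorphic_on UNIV" "\<And>z. f z = (z - a) * h z"
proof
  show "(\<lambda>z. if z = a then deriv f a else (f z - f a) / (z-a)) holomorphic_on UNIV"
    using pole_lemma[OF assms(1)] by simp
qed (use assms in auto)

text \<open>Splits off the full order of vanishing at one point while keeping the cofactor entire;
  \<open>k = 0\<close> covers points that are not zeros.\<close>

lemma entire_factor: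
  assumes hol: "f holomorphic_on UNIV" and nz: "f z0 \<noteq> 0"
  obtains k h where "h holomorphic_on UNIV" "h a \<noteq> 0" "\<And>z. f z = (z - a) ^ k * h z"
proof (cases "f a = 0")
  case False
  then show ?thesis using that[of f 0] hol by simp
next
  case True
  have nc: "\<not> f constant_on UNIV" using True nz unfolding constant_on_def by (metis UNIV_I)
  obtain g r n where g: "0 < n" "0 < r" "g holomorphic_on ball a r"
     "\<And>w. w \<in> ball a r \<Longrightarrow> f w = (w - a) ^ n * g w" "\<And>w. w \<in> ball a r \<Longrightarrow> g w \<noteq> 0"
    using holomorphic_factor_zero_nonconstant[OF hol open_UNIV connected_UNIV UNIV_I True nc] by metis
  \<comment> \<open>The local cofactor near \<open>a\<close> and the quotient elsewhere agree on the
    overlap, so they glue to an entire function.\<close>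
  define h where "h = (\<lambda>z. if z \<in> ball a r then g z else f z / (z - a) ^ n)"
  have "h holomorphic_on (ball a r \<union> (UNIV - {a}))" unfolding h_def
  proof (rule holomorphic_on_If_Un)
    show "(\<lambda>z. f z / (z - a) ^ n) holomorphic_on UNIV - {a}"
      by (intro holomorphic_intros holomorphic_on_subset[OF hol]) auto
  qed (use g in auto)
  moreover have "ball a r \<union> (UNIV - {a}) = UNIV" using \<open>0 < r\<close> by auto
  ultimately have "h holomorphic_on UNIV" by simp
  moreover have "h a \<noteq> 0" using g by (simp add: h_def)
  moreover have "f z = (z - a) ^ n * h z" for z using g(2,4) by (auto simp: h_def)
  ultimately show ?thesis using that by blast
qed

text \<open>One factor \<open>z\<close> at a time is split off after subtracting the value at the
  origin. The factor \<open>z ^ K\<close> of the remainder is what later forces a large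
  derivative.\<close>

lemma entire_taylor:
  assumes "f holomorphic_on UNIV"
  shows "\<exists>p h. h holomorphic_on UNIV \<and> (\<forall>z. f z = poly p z + z ^ K * h z)"
  using assms
proof (induction K arbitrary: f)
  case 0
  then show ?case by (intro exI[of _ 0] exI[of _ f]) simp
next
  case (Suc K)
  have "(\<lambda>z. f z - f 0) holomorphic_on UNIV" by (intro holomorphic_intros Suc.prems)
  then obtain F where F: "F holomorphic_on UNIV" "\<And>z. f z - f 0 = (z - 0) * F z"
    using entire_divide_linear[of "\<lambda>z. f z - f 0" 0] by auto
  obtain p h where h: "h holomorphic_on UNIV" "\<And>z. F z = poly p z + z ^ K * h z"
    using Suc.IH[OF F(1)] by blast
  have "f z = poly (pCons (f 0) p) z + z ^ Suc K * h z" for z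
    using F(2)[of z] h(2)[of z] by (simp add: algebra_simps)
  then show ?case using h(1) by blast
qed

text \<open>Zeros are divided out one point at a time with their full multiplicity; a zero-free
  entire function has a holomorphic logarithm because the plane is contractible.\<close>

lemma entire_finite_zeros_factor:
  assumes "f holomorphic_on UNIV" "f z0 \<noteq> 0" "finite {z. f z = 0}"
  shows "\<exists>H g. H \<noteq> 0 \<and> g holomorphic_on UNIV \<and> (\<forall>z. f z = poly H z * exp (g z))"
  using assms
proof (induction "card {z. f z = 0}" arbitrary: f rule: less_induct)
  case less
  show ?case
  proof (cases "\<exists>a. f a = 0")
    case False
    then obtain g where "g holomorphic_on UNIV" "\<And>z. f z = exp (g z)"
      using contractible_imp_holomorphic_log[OF less.prems(1) contractible_UNIV] by auto
    then show ?thesis by (intro exI[of _ 1] exI[of _ g]) simp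
  next
    case True
    then obtain a where a: "f a = 0" by blast
    obtain k h where h: "h holomorphic_on UNIV" "h a \<noteq> 0" "\<And>z. f z = (z - a) ^ k * h z"
      using entire_factor[OF less.prems(1,2), of a] by blast
    have sub: "{z. h z = 0} \<subseteq> {z. f z = 0} - {a}" using h by auto
    then have "{z. h z = 0} \<subset> {z. f z = 0}" using a by auto
    then have c: "card {z. h z = 0} < card {z. f z = 0}"
      by (rule psubset_card_mono[OF less.prems(3)])
    have fin: "finite {z. h z = 0}" using sub less.prems(3) finite_subset by blast
    have "h z0 \<noteq> 0" using h(3)[of z0] less.prems(2) by auto
    then obtain H g where "H \<noteq> 0" "g holomorphic_on UNIV" "\<And>z. h z = poly H z * exp (g z)"
      using less.hyps[OF c h(1) _ fin] by blast
    then show ?thesis using h(3)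
      by (intro exI[of _ "[:-a,1:]^k * H"] exI[of _ g]) (auto simp: poly_power)
  qed
qed

text \<open>Each root of \<open>q\<close> must be a root of \<open>p\<close>, since \<open>f\<close>
  is finite there, so the common linear factors can be cancelled until \<open>q\<close> is
  constant.\<close>

lemma entire_quotient_poly:
  fixes q p :: "complex poly"
  assumes "continuous_on UNIV f" "q \<noteq> 0" "\<And>z. poly q z * f z = poly p z"
  shows "\<exists>s. \<forall>z. f z = poly s z"
  using assms(2,3)
proof (induction "degree q" arbitrary: q p)
  case 0
  then obtain c where "q = [:c:]" "c \<noteq> 0" by (metis degree_0_id pCons_0_0)
  then have "f z = poly (smult (1/c) p) z" for z using 0(3)[of z] by (simp add: field_simps)
  then show ?case by blast
next
  case (Suc n)
  have "\<not> constant (poly q)" using Suc.hyps(2) constant_degree by (metis nat.distinct(1))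
  then obtain a where a: "poly q a = 0" using fundamental_theorem_of_algebra by blast
  then obtain q' where q': "q = [:-a,1:] * q'" by (auto simp: poly_eq_0_iff_dvd dvd_def)
  have "poly p a = 0" using Suc.prems(2)[of a] a by simp
  then obtain p' where p': "p = [:-a,1:] * p'" by (auto simp: poly_eq_0_iff_dvd dvd_def)
  have q'0: "q' \<noteq> 0" using Suc.prems q' by auto
  have "degree q = Suc (degree q')" using q'0 unfolding q' by (subst degree_mult_eq) auto
  then have d: "n = degree q'" using Suc.hyps(2) by simp
  \<comment> \<open>Dividing by \<open>z - a\<close> proves this only for
    \<open>z \<noteq> a\<close>; continuity of \<open>f\<close> gives it at
    \<open>a\<close>.\<close>
  have "poly q' z * f z - poly p' z = 0" for z
  proof (rule continuous_eq_0_of_cosparse[where f = "\<lambda>z. poly q' z * f z - poly p' z"])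
    show "continuous_on UNIV (\<lambda>z. poly q' z * f z - poly p' z)" 
      using assms(1) by (intro continuous_intros) auto
    have "poly q' z * f z - poly p' z = 0" if "z \<noteq> a" for z
    proof -
      have "(z - a) * (poly q' z * f z - poly p' z) = poly q z * f z - poly p z"
        by (simp add: q' p' algebra_simps)
      then show ?thesis using Suc.prems(2)[of z] that by simp
    qed
    then show "\<forall>\<^sub>\<approx>z\<in>UNIV. poly q' z * f z - poly p' z = 0"
      unfolding eventually_cosparse_open_eq[OF open_UNIV]
      using eventually_at_in_open'[of "- {a}"] 
      by (intro ballI eventually_mono[OF eventually_neq_at_within[of a]]) auto
  qed
  then show ?case using Suc.hyps(1)[OF d q'0, of p'] by auto
qed

section \<open>Blaschke factors and harmonic majorants\<close>

lemma cmod_blaschke: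
  "(cmod (of_real (R\<^sup>2) - cnj a * z))\<^sup>2 - (R * cmod (z - a))\<^sup>2
     = (R\<^sup>2 - (cmod z)\<^sup>2) * (R\<^sup>2 - (cmod a)\<^sup>2)"
  unfolding power_mult_distrib cmod_power2 by (simp add: algebra_simps power2_eq_square)

text \<open>The zeros in the disc are traded one at a time for the zero-free numerators of their Blaschke factors.\<close>

lemma zero_free_majorant:
  assumes "f holomorphic_on UNIV" "0 < R" "\<And>z. cmod z = R \<Longrightarrow> f z \<noteq> 0"
  shows "\<exists>h. h holomorphic_on UNIV \<and> (\<forall>z\<in>cball 0 R. h z \<noteq> 0 \<and> cmod (f z) \<le> cmod (h z)) \<and>
      (\<forall>z\<in>sphere 0 R. cmod (h z) = cmod (f z))"
proof -
  have "finite {z\<in>cball 0 R. f z = 0}" if f: "f holomorphic_on UNIV" "\<And>z. cmod z = R \<Longrightarrow> f z \<noteq> 0" for f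
  proof (cases "f constant_on UNIV")
    case True
    then obtain c where c: "\<And>z. f z = c" unfolding constant_on_def by auto
    moreover have "f (of_real R) \<noteq> 0" using f(2) \<open>0 < R\<close> by simp
    ultimately show ?thesis by simp
  next
    case False
    show ?thesis by (rule holomorphic_compact_finite_zeros[OF f(1) _ _ _ _ False]) auto
  qed note fin = this
  show ?thesis using assms(1,3)
  proof (induction "card {z\<in>cball 0 R. f z = 0}" arbitrary: f rule: less_induct)
    case less
    note f = less.prems
    show ?case
    proof (cases "\<exists>a\<in>cball 0 R. f a = 0")
      case False
      then show ?thesis using f by (intro exI[of _ f]) auto
    next
      case True
      then obtain a where a: "cmod a \<le> R" "f a = 0" by auto
      then have aR: "cmod a < R" using f(2)[of a] by force
      have "f (of_real R) \<noteq> 0" using f(2)[of "of_real R"] \<open>0 < R\<close> by simp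
      then obtain k h where h: "h holomorphic_on UNIV" "h a \<noteq> 0" "\<And>z. f z = (z - a) ^ k * h z"
        using entire_factor[OF f(1)] by blast
      \<comment> \<open>The numerator of the Blaschke factor, scaled so that its modulus equals
        \<open>cmod (z - a)\<close> on the circle; it is at least that in the disc and has no zero
        there.\<close>
      define b where "b = (\<lambda>z. (of_real (R\<^sup>2) - cnj a * z) / of_real R)"
      define F where "F = (\<lambda>z. b z ^ k * h z)"
      have cb: "cmod (b z) = cmod (of_real (R\<^sup>2) - cnj a * z) / R" for z
        using \<open>0 < R\<close> by (simp add: b_def norm_divide)
      have pos: "0 < R\<^sup>2 - (cmod a)\<^sup>2" using aR by (simp add: power_strict_mono)
      have ble: "cmod (z - a) \<le> cmod (b z)" if "cmod z \<le> R" for z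
      proof -
        have "0 \<le> (R\<^sup>2 - (cmod z)\<^sup>2) * (R\<^sup>2 - (cmod a)\<^sup>2)" using that pos by (intro mult_nonneg_nonneg) (auto simp: power_mono)
        then have "(R * cmod (z - a))\<^sup>2 \<le> (cmod (of_real (R\<^sup>2) - cnj a * z))\<^sup>2"
          using cmod_blaschke[of R a z] by linarith
        then have "R * cmod (z - a) \<le> cmod (of_real (R\<^sup>2) - cnj a * z)" by (rule power2_le_imp_le) simp
        then show ?thesis using \<open>0 < R\<close> by (simp add: cb field_simps)
      qed
      have beq: "cmod (z - a) = cmod (b z)" if "cmod z = R" for z
      proof -
        have "(R * cmod (z - a))\<^sup>2 = (cmod (of_real (R\<^sup>2) - cnj a * z))\<^sup>2"
          using cmod_blaschke[of R a z] that by simp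
        then have "R * cmod (z - a) = cmod (of_real (R\<^sup>2) - cnj a * z)" using \<open>0 < R\<close> by (simp add: power2_eq_iff_nonneg)
        then show ?thesis using \<open>0 < R\<close> by (simp add: cb field_simps)
      qed
      have bnz: "b z \<noteq> 0" if "cmod z \<le> R" for z
      proof
        assume "b z = 0"
        then have "z = a" using ble[OF that] by simp
        then have "of_real (R\<^sup>2) = cnj a * a" using \<open>b z = 0\<close> \<open>0 < R\<close> by (simp add: b_def)
        then have "R\<^sup>2 = (cmod a)\<^sup>2" by (metis complex_norm_square mult.commute of_real_eq_iff)
        then show False using pos by simp
      qed
      have Fhol: "F holomorphic_on UNIV" unfolding F_def b_def using \<open>0 < R\<close> by (intro holomorphic_intros h(1)) auto
      have FR: "cmod (F z) = cmod (f z)" if "cmod z = R" for z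
        using beq[OF that] by (simp add: F_def h(3) norm_mult norm_power)
      have Fle: "cmod (f z) \<le> cmod (F z)" if "cmod z \<le> R" for z
        using ble[OF that] by (simp add: F_def h(3) norm_mult norm_power mult_right_mono power_mono)
      have Fnz: "F z \<noteq> 0" if "cmod z = R" for z using FR[OF that] f(2)[OF that] by auto
      have sub: "{z\<in>cball 0 R. F z = 0} \<subseteq> {z\<in>cball 0 R. f z = 0} - {a}"
        using bnz h(2,3) by (auto simp: F_def)
      have "{z\<in>cball 0 R. F z = 0} \<subset> {z\<in>cball 0 R. f z = 0}" using sub a by auto
      then have "card {z\<in>cball 0 R. F z = 0} < card {z\<in>cball 0 R. f z = 0}"
        by (intro psubset_card_mono fin f)
      then obtain g where g: "g holomorphic_on UNIV" "\<forall>z\<in>cball 0 R. g z \<noteq> 0 \<and> cmod (F z) \<le> cmod (g z)"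
          "\<forall>z\<in>sphere 0 R. cmod (g z) = cmod (F z)" using less.hyps[OF _ Fhol Fnz] by blast
      moreover have "cmod (f z) \<le> cmod (g z)" if "z \<in> cball 0 R" for z
        using g(2) Fle[of z] that by (force intro: order_trans)
      ultimately show ?thesis using FR by (intro exI[of _ g]) auto
    qed
  qed
qed

text \<open>The logarithm of the zero-free majorant: \<open>Re \<phi>\<close> is a harmonic majorant
  of \<open>ln (cmod f)\<close> with equality on the boundary, which reduces Jensen-type
  inequalities to the mean value property.\<close>

lemma log_majorant:
  assumes "f holomorphic_on UNIV" "0 < R" "\<And>z. cmod z = R \<Longrightarrow> f z \<noteq> 0"
  obtains \<phi> where "\<phi> holomorphic_on cball 0 R"
    "\<And>z. cmod z \<le> R \<Longrightarrow> cmod (f z) \<le> exp (Re (\<phi> z))"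
    "\<And>z. cmod z = R \<Longrightarrow> cmod (f z) = exp (Re (\<phi> z))"
proof -
  obtain h where h: "h holomorphic_on UNIV" "\<forall>z\<in>cball 0 R. h z \<noteq> 0 \<and> cmod (f z) \<le> cmod (h z)"
      "\<forall>z\<in>sphere 0 R. cmod (h z) = cmod (f z)"
    using zero_free_majorant[OF assms] by blast
  have "h holomorphic_on cball 0 R" using h(1) holomorphic_on_subset by blast
  then obtain \<phi> where "\<phi> holomorphic_on cball 0 R" "\<And>z. z \<in> cball 0 R \<Longrightarrow> h z = exp (\<phi> z)"
    using contractible_imp_holomorphic_log[of h "cball 0 R"] convex_imp_contractible[OF convex_cball] h(2) by blast
  then show ?thesis using h(2,3) by (intro that[of \<phi>]) auto
qed

text \<open>Some Taylor coefficient of index \<open>n \<ge> m\<close> is nonzero, and Cauchy's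
  inequality for that coefficient is the growth bound.\<close>

lemma entire_not_poly_growth:
  assumes hol: "f holomorphic_on UNIV" and np: "\<not> (\<exists>p. \<forall>z. f z = poly p z)"
  obtains n c where "m \<le> n" "0 < c"
    "\<And>r B. 0 < r \<Longrightarrow> (\<And>z. cmod z = r \<Longrightarrow> cmod (f z) \<le> B) \<Longrightarrow> c * r ^ n \<le> B"
proof -
  have "\<exists>n\<ge>m. (deriv ^^ n) f 0 \<noteq> 0"
  proof (rule ccontr)
    assume "\<not> ?thesis"
    then have z: "(deriv ^^ n) f 0 = 0" if "m \<le> n" for n using that by blast
    have "f x = poly (\<Sum>k<m. monom ((deriv ^^ k) f 0 / fact k) k) x" for x
    proof -
      have "(\<lambda>n. (deriv ^^ n) f 0 / fact n * (x - 0) ^ n) sums f x"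
        by (rule holomorphic_power_series[of f 0 "cmod x + 1"]) (auto intro: holomorphic_on_subset[OF hol])
      moreover have "(\<lambda>n. (deriv ^^ n) f 0 / fact n * (x - 0) ^ n) sums (\<Sum>n<m. (deriv ^^ n) f 0 / fact n * (x - 0) ^ n)"
        by (rule sums_finite) (use z in auto)
      ultimately have "f x = (\<Sum>n<m. (deriv ^^ n) f 0 / fact n * (x - 0) ^ n)" by (rule sums_unique2)
      then show ?thesis by (simp add: poly_sum poly_monom)
    qed
    then show False using np by blast
  qed
  then obtain n where n: "m \<le> n" "(deriv ^^ n) f 0 \<noteq> 0" by blast
  show ?thesis
  proof (rule that[of n "cmod ((deriv ^^ n) f 0) / fact n"])
    fix r B :: real assume r: "0 < r" and B: "\<And>z. cmod z = r \<Longrightarrow> cmod (f z) \<le> B"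
    have "cmod ((deriv ^^ n) f 0) \<le> fact n * B / r ^ n"
      using r B hol by (intro Cauchy_inequality) (auto intro: holomorphic_on_subset holomorphic_on_imp_continuous_on continuous_on_subset)
    then show "cmod ((deriv ^^ n) f 0) / fact n * r ^ n \<le> B" using r by (simp add: field_simps)
  qed (use n in auto)
qed

section \<open>Jensen's inequality and the growth scales\<close>

text \<open>In this form continuity is evident also at zeros of the argument; the case
  \<open>x = 0\<close> rests on the default value of \<open>ln 0\<close>.\<close>

lemma log_plus_eq: "0 \<le> x \<Longrightarrow> log_plus x = ln (max 1 x)"
  by (cases "x = 0"; cases "x \<le> 1") (auto simp: log_plus_def max_def)

lemma log_plus_nonneg [simp]: "0 \<le> log_plus x"
  by (simp add: log_plus_def)

lemma continuous_on_log_plus [continuous_intros]: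
  fixes f :: "'b::topological_space \<Rightarrow> 'c::real_normed_vector"
  assumes "continuous_on S f"
  shows "continuous_on S (\<lambda>z. log_plus (norm (f z)))"
  unfolding log_plus_eq[OF norm_ge_zero] by (intro continuous_on_ln continuous_intros assms) (auto simp: max_def)

lemma proximity_fun_eq: "proximity_fun f r = circle_mean r (\<lambda>z. log_plus (cmod (f z)))"
  by (simp add: proximity_fun_def circle_mean_def)

lemma nevanlinna_char_entire:
  assumes "f holomorphic_on UNIV"
  shows "nevanlinna_char f r = circle_mean r (\<lambda>z. log_plus (cmod (f z)))"
proof -
  have "\<not> is_pole f z" for z using not_is_pole_holomorphic[OF open_UNIV UNIV_I assms] .
  then show ?thesis
    by (simp add: nevanlinna_char_def proximity_fun_eq pole_counting_fun_def pole_count_def)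
qed

text \<open>After division by \<open>z ^ k\<close> the value at the origin is nonzero, and the
  harmonic majorant has mean at least \<open>ln (cmod (h 0))\<close>. The discarded term
  \<open>k * ln r\<close> is nonnegative because \<open>1 \<le> r\<close>.\<close>

lemma jensen_lower_bound:
  assumes hol: "f holomorphic_on UNIV" and nz: "f z0 \<noteq> 0"
  obtains C where "\<And>r. 1 \<le> r \<Longrightarrow> (\<And>z. cmod z = r \<Longrightarrow> f z \<noteq> 0) \<Longrightarrow> - C \<le> circle_mean r (\<lambda>z. ln (cmod (f z)))"
proof -
  obtain k h where h: "h holomorphic_on UNIV" "h 0 \<noteq> 0" "\<And>z. f z = (z - 0) ^ k * h z"
    using entire_factor[OF hol nz] by blast
  show ?thesis
  proof (rule that[of "- ln (cmod (h 0))"])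
    fix r :: real assume r: "1 \<le> r" and fz: "\<And>z. cmod z = r \<Longrightarrow> f z \<noteq> 0"
    then have hz: "h z \<noteq> 0" if "cmod z = r" for z using h(3)[of z] that by auto
    obtain \<phi> where \<phi>: "\<phi> holomorphic_on cball 0 r"
        "\<And>z. cmod z \<le> r \<Longrightarrow> cmod (h z) \<le> exp (Re (\<phi> z))"
        "\<And>z. cmod z = r \<Longrightarrow> cmod (h z) = exp (Re (\<phi> z))"
      using log_majorant[OF h(1) less_le_trans[OF zero_less_one r] hz] by blast
    have cont: "continuous_on (sphere 0 r) \<phi>"
      using \<phi>(1) holomorphic_on_imp_continuous_on continuous_on_subset sphere_cball by blast
    have "ln (cmod (h 0)) \<le> ln (exp (Re (\<phi> 0)))" using \<phi>(2)[of 0] r h(2) by (subst ln_le_cancel_iff) auto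
    also have "\<dots> = Re (\<phi> 0)" by simp
    also have "\<dots> = circle_mean r (\<lambda>z. Re (\<phi> z))"
      using circle_mean_Re[OF cont] circle_mean_center[OF \<phi>(1)] r by simp
    also have "\<dots> \<le> circle_mean r (\<lambda>z. ln (cmod (f z)))"
    proof (rule circle_mean_mono)
      have "continuous_on (sphere 0 r) f"
        using hol holomorphic_on_imp_continuous_on continuous_on_subset by blast
      then show "continuous_on (sphere 0 r) (\<lambda>z. ln (cmod (f z)))"
        using fz by (intro continuous_intros) auto
      fix z assume z: "cmod z = r"
      have "ln (cmod (f z)) = k * ln r + Re (\<phi> z)"
        using r by (simp add: h(3) norm_mult norm_power z \<phi>(3)[OF z] ln_mult ln_realpow)
      moreover have "0 \<le> k * ln r" using r by simp
      ultimately show "Re (\<phi> z) \<le> ln (cmod (f z))" by linarith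
    qed (use r in \<open>auto intro!: continuous_intros cont\<close>)
    finally show "- (- ln (cmod (h 0))) \<le> circle_mean r (\<lambda>z. ln (cmod (f z)))" by simp
  qed
qed

text \<open>Uses \<open>\<bar>x\<bar> = 2 * max 0 x - x\<close> and the mean value property of
  \<open>Re g\<close>; a bound for one sign of \<open>Re g\<close> thus controls its absolute
  value.\<close>

lemma circle_mean_abs_Re:
  assumes hol: "g holomorphic_on cball 0 R" and R: "0 < R"
  shows "circle_mean R (\<lambda>z. \<bar>Re (g z)\<bar>) = 2 * circle_mean R (\<lambda>z. max 0 (Re (g z))) - Re (g 0)"
proof -
  have cont: "continuous_on (sphere 0 R) g"
    using hol holomorphic_on_imp_continuous_on continuous_on_subset sphere_cball by blast
  have "circle_mean R (\<lambda>z. \<bar>Re (g z)\<bar>) = circle_mean R (\<lambda>z. 2 * max 0 (Re (g z)) - Re (g z))"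
    using R by (intro circle_mean_cong) auto
  also have "\<dots> = 2 * circle_mean R (\<lambda>z. max 0 (Re (g z))) - Re (g 0)"
    using R by (subst circle_mean_diff)
      (auto intro!: continuous_intros cont simp: circle_mean_cmult circle_mean_Re[OF cont] circle_mean_center[OF hol])
  finally show ?thesis .
qed

text \<open>On the circle the positive part of \<open>Re \<phi>\<close> is
  \<open>log_plus (cmod f)\<close>, so the mean of \<open>\<bar>Re \<phi>\<bar>\<close> is at most
  twice the proximity function up to a constant. The Schwarz bound carries this to the disc of half
  the radius.\<close>

lemma ln_modulus_le_proximity:
  assumes hol: "f holomorphic_on UNIV" and f0: "f 0 \<noteq> 0" and R: "0 < R" "\<And>z. cmod z = R \<Longrightarrow> f z \<noteq> 0"
    and z: "2 * cmod z \<le> R"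
  shows "cmod (f z) \<le> exp (3 * \<bar>ln (cmod (f 0))\<bar> + 4 * circle_mean R (\<lambda>z. log_plus (cmod (f z))))"
proof -
  obtain \<phi> where \<phi>: "\<phi> holomorphic_on cball 0 R"
      "\<And>z. cmod z \<le> R \<Longrightarrow> cmod (f z) \<le> exp (Re (\<phi> z))"
      "\<And>z. cmod z = R \<Longrightarrow> cmod (f z) = exp (Re (\<phi> z))"
    using log_majorant[OF hol R] by blast
  let ?T = "circle_mean R (\<lambda>z. log_plus (cmod (f z)))"
  let ?P = "circle_mean R (\<lambda>z. \<bar>Re (\<phi> z)\<bar>)"
  have cont: "continuous_on (sphere 0 R) \<phi>"
    using \<phi>(1) holomorphic_on_imp_continuous_on continuous_on_subset sphere_cball by blast
  have "ln (cmod (f 0)) \<le> ln (exp (Re (\<phi> 0)))" using \<phi>(2)[of 0] R f0 by (subst ln_le_cancel_iff) auto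
  then have lb: "ln (cmod (f 0)) \<le> Re (\<phi> 0)" by simp
  have "circle_mean R (\<lambda>z. max 0 (Re (\<phi> z))) = ?T"
    using R \<phi>(3) by (intro circle_mean_cong) (auto simp: log_plus_def)
  then have P: "?P = 2 * ?T - Re (\<phi> 0)" using circle_mean_abs_Re[OF \<phi>(1) R(1)] by simp
  have P0: "0 \<le> ?P" by (rule circle_mean_nonneg) (use R in \<open>auto intro!: continuous_intros cont\<close>)
  have lt: "cmod z < R" using z R(1) norm_ge_zero[of z] by linarith
  have "cmod (\<phi> z - \<phi> 0) \<le> 2 * cmod z / (R - cmod z) * ?P" by (rule Schwarz_bound[OF \<phi>(1) lt])
  also have "\<dots> \<le> 2 * ?P" using P0 z lt by (intro mult_right_mono) (auto simp: divide_simps)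
  finally have "Re (\<phi> z) - Re (\<phi> 0) \<le> 2 * ?P" using complex_Re_le_cmod[of "\<phi> z - \<phi> 0"] by simp
  \<comment> \<open>Here \<open>Re (\<phi> z) \<le> Re (\<phi> 0) + 2 * ?P = 4 * ?T - Re (\<phi>
    0)\<close>, and \<open>Re (\<phi> 0)\<close> is at least \<open>ln (cmod (f 0))\<close>.\<close>
  then have "Re (\<phi> z) \<le> 3 * \<bar>ln (cmod (f 0))\<bar> + 4 * ?T" using P lb P0 by linarith
  then show ?thesis using \<phi>(2)[of z] lt by (smt (verit) exp_le_cancel_iff)
qed

section \<open>Circles free of zeros; maximum modulus and proximity function\<close>

lemma entire_countable_zeros:
  assumes hol: "f holomorphic_on UNIV" and nz: "f z0 \<noteq> 0"
  shows "countable {z. f z = 0}"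
proof (cases "f constant_on UNIV")
  case True then show ?thesis using nz by (auto simp: constant_on_def)
next
  case False
  show ?thesis using holomorphic_countable_zeros[OF hol open_UNIV connected_UNIV _ False] by (simp add: fsigma_UNIV)
qed

text \<open>The moduli of the zeros form a countable set and cannot fill an interval.\<close>

lemma circle_without_zeros:
  assumes hol: "f holomorphic_on UNIV" and nz: "f z0 \<noteq> 0" and ab: "a < b"
  obtains R where "a < R" "R < b" "\<And>z. cmod z = R \<Longrightarrow> f z \<noteq> 0"
proof -
  have "countable (cmod ` {z. f z = 0})" using entire_countable_zeros[OF hol nz] by simp
  moreover have "uncountable {a<..<b}" using ab by (simp add: uncountable_open_interval)
  ultimately have "\<not> {a<..<b} \<subseteq> cmod ` {z. f z = 0}" using countable_subset by blast
  then obtain R where "a < R" "R < b" "R \<notin> cmod ` {z. f z = 0}" by (meson greaterThanLessThan_iff subsetI)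
  then show ?thesis by (intro that[of R]) auto
qed

lemma log_plus_add_1: "0 \<le> x \<Longrightarrow> log_plus (x + 1) \<le> log_plus x + ln 2"
proof -
  assume "0 \<le> x"
  then have "ln (max 1 (x + 1)) \<le> ln (max 1 x * 2)" by (subst ln_le_cancel_iff) auto
  also have "\<dots> = ln (max 1 x) + ln 2" by (subst ln_mult) auto
  finally show ?thesis using \<open>0 \<le> x\<close> by (simp add: log_plus_eq)
qed

lemma log_plus_mono: "0 \<le> x \<Longrightarrow> x \<le> y \<Longrightarrow> log_plus x \<le> log_plus y"
  by (auto simp: log_plus_eq max_def)

text \<open>The bound by the majorant needs a nonzero value at the origin and a circle without
  zeros. The first is arranged by adding a constant, at the cost of \<open>ln 2\<close>, the second
  by moving \<open>R\<close> between \<open>2 * r\<close> and \<open>3 * r\<close>.\<close>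

lemma max_modulus_le_proximity:
  assumes hol: "f holomorphic_on UNIV"
  obtains C where "0 \<le> C" "\<And>r. 0 < r \<Longrightarrow> \<exists>R. 2 * r < R \<and> R < 3 * r \<and>
     (\<forall>z\<in>cball 0 r. cmod (f z) \<le> exp (C + 4 * circle_mean R (\<lambda>z. log_plus (cmod (f z)))))"
proof -
  obtain b :: complex where b: "f 0 + b \<noteq> 0" "cmod b \<le> 1"
    by (cases "f 0 = 0") (auto intro: that[of 1] that[of 0])
  define F where "F = (\<lambda>z. f z + b)"
  have F: "F holomorphic_on UNIV" unfolding F_def by (intro holomorphic_intros hol)
  have F0: "F 0 \<noteq> 0" using b by (simp add: F_def)
  define C where "C = 3 * \<bar>ln (cmod (F 0))\<bar> + 4 * ln 2"
  have C: "0 \<le> C" by (simp add: C_def)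
  show ?thesis
  proof (rule that[of "C + ln 2"])
    fix r :: real assume r: "0 < r"
    obtain R where R: "2 * r < R" "R < 3 * r" "\<And>z. cmod z = R \<Longrightarrow> F z \<noteq> 0"
      using circle_without_zeros[OF F F0, of "2*r" "3*r"] r by auto
    have cont: "continuous_on (sphere 0 R) f" "continuous_on (sphere 0 R) F"
      using hol F holomorphic_on_imp_continuous_on continuous_on_subset by blast+
    let ?T = "circle_mean R (\<lambda>z. log_plus (cmod (f z)))"
    have T0: "0 \<le> ?T" using r R by (intro circle_mean_nonneg continuous_intros cont) auto
    have "circle_mean R (\<lambda>z. log_plus (cmod (F z))) \<le> circle_mean R (\<lambda>z. log_plus (cmod (f z)) + ln 2)"
    proof (intro circle_mean_mono continuous_intros cont)
      fix z
      have "cmod (F z) \<le> cmod (f z) + 1" unfolding F_def using norm_triangle_ineq[of "f z" b] b(2) by linarith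
      then show "log_plus (cmod (F z)) \<le> log_plus (cmod (f z)) + ln 2"
        using log_plus_mono[of "cmod (F z)" "cmod (f z) + 1"] log_plus_add_1[of "cmod (f z)"] by simp
    qed (use r R in auto)
    also have "\<dots> = ?T + ln 2" using r R by (subst circle_mean_add) (auto intro!: continuous_intros cont)
    finally have TF: "circle_mean R (\<lambda>z. log_plus (cmod (F z))) \<le> ?T + ln 2" .
    have "cmod (f z) \<le> exp (C + ln 2 + 4 * ?T)" if z: "z \<in> cball 0 r" for z
    proof -
      have "cmod (F z) \<le> exp (3 * \<bar>ln (cmod (F 0))\<bar> + 4 * circle_mean R (\<lambda>z. log_plus (cmod (F z))))"
        using z R r by (intro ln_modulus_le_proximity F F0) auto
      also have "\<dots> \<le> exp (C + 4 * ?T)" using TF by (simp add: C_def)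
      finally have "cmod (F z) \<le> exp (C + 4 * ?T)" .
      moreover have "1 \<le> exp (C + 4 * ?T)" using C T0 by simp
      moreover have "cmod (f z) \<le> cmod (F z) + 1" unfolding F_def using norm_triangle_ineq4[of "f z + b" b] b(2) by simp
      ultimately have "cmod (f z) \<le> 2 * exp (C + 4 * ?T)" by linarith
      also have "\<dots> = exp (C + ln 2 + 4 * ?T)" by (simp add: exp_add)
      finally show ?thesis .
    qed
    then show "\<exists>R. 2 * r < R \<and> R < 3 * r \<and> (\<forall>z\<in>cball 0 r. cmod (f z) \<le> exp (C + ln 2 + 4 * circle_mean R (\<lambda>z. log_plus (cmod (f z)))))"
      using R by blast
  qed (use C in simp)
qed

section \<open>Order conditions as explicit growth bounds, and doubling\<close>

lemma ereal_less_one_obtain_real: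
  assumes "(x::ereal) < 1"
  obtains \<mu> :: real where "x < ereal \<mu>" "0 < \<mu>" "\<mu> < 1"
proof -
  have "max x 0 < 1" using assms by simp
  then obtain y where y: "max x 0 < ereal y" "ereal y < 1" using ereal_dense2 by blast
  show ?thesis
  proof (rule that[of y])
    show "x < ereal y" using y(1) by (simp only: max_less_iff_conj)
    show "0 < y" using y(1) by (simp add: max_less_iff_conj)
    show "y < 1" using y(2) by simp
  qed
qed

lemma hyper_order_less_1:
  assumes "hyper_order f < 1"
  obtains \<mu> where "0 < \<mu>" "\<mu> < 1" "eventually (\<lambda>r. nevanlinna_char f r \<le> exp (r powr \<mu>)) at_top"
proof -
  obtain \<mu> where \<mu>: "hyper_order f < ereal \<mu>" "0 < \<mu>" "\<mu> < 1" using ereal_less_one_obtain_real[OF assms] by blast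
  have "eventually (\<lambda>r. ereal (ln (ln (nevanlinna_char f r)) / ln r) < ereal \<mu>) at_top"
    using \<mu>(1) unfolding hyper_order_def by (rule Limsup_lessD)
  then have "eventually (\<lambda>r. nevanlinna_char f r \<le> exp (r powr \<mu>)) at_top"
    using eventually_gt_at_top[of 1]
  proof eventually_elim
    case (elim r)
    let ?T = "nevanlinna_char f r"
    \<comment> \<open>For values at most one the iterated logarithm carries no information, but then
      the bound is trivial because the right-hand side is at least one.\<close>
    show ?case
    proof (cases "?T \<le> 1")
      case True then show ?thesis by (smt (verit) one_le_exp_iff powr_ge_zero)
    next
      case False
      then have l: "0 < ln ?T" by simp
      have "ln (ln ?T) \<le> \<mu> * ln r" using elim by (simp add: divide_simps split: if_splits)
      then have "exp (ln (ln ?T)) \<le> exp (\<mu> * ln r)" by simp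
      then have "ln ?T \<le> r powr \<mu>" using l elim by (simp add: powr_def)
      then have "exp (ln ?T) \<le> exp (r powr \<mu>)" by simp
      then show ?thesis using False by simp
    qed
  qed
  then show ?thesis using that \<mu> by blast
qed

lemma growth_order_less_1:
  assumes "growth_order f < 1"
  obtains \<mu> where "0 < \<mu>" "\<mu> < 1" "eventually (\<lambda>r. nevanlinna_char f r \<le> r powr \<mu>) at_top"
proof -
  obtain \<mu> where \<mu>: "growth_order f < ereal \<mu>" "0 < \<mu>" "\<mu> < 1" using ereal_less_one_obtain_real[OF assms] by blast
  have "eventually (\<lambda>r. ereal (ln (nevanlinna_char f r) / ln r) < ereal \<mu>) at_top"
    using \<mu>(1) unfolding growth_order_def by (rule Limsup_lessD)
  then have "eventually (\<lambda>r. nevanlinna_char f r \<le> r powr \<mu>) at_top"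
    using eventually_gt_at_top[of 1]
  proof eventually_elim
    case (elim r)
    let ?T = "nevanlinna_char f r"
    show ?case
    proof (cases "?T \<le> 0")
      case True then show ?thesis by (smt (verit) powr_ge_zero)
    next
      case False
      have "ln ?T \<le> \<mu> * ln r" using elim by (simp add: divide_simps split: if_splits)
      then have "exp (ln ?T) \<le> exp (\<mu> * ln r)" by simp
      then show ?thesis using False elim by (simp add: powr_def)
    qed
  qed
  then show ?thesis using that \<mu> by blast
qed

text \<open>If every late step more than doubled \<open>p\<close>, then \<open>p\<close> would grow
  exponentially along the progression, faster than \<open>exp (C * x powr \<mu>)\<close> with
  \<open>\<mu> < 1\<close> allows.\<close>

lemma frequently_doubling:
  fixes p :: "nat \<Rightarrow> real"
  assumes pos: "eventually (\<lambda>n. 0 < p n) sequentially"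
    and ub: "eventually (\<lambda>n. p n \<le> exp (C * (a + real n * L) powr \<mu>)) sequentially"
    and "0 < L" "0 < \<mu>" "\<mu> < 1"
  shows "\<exists>\<^sub>F n in sequentially. p (Suc n) \<le> 2 * p n"
proof (rule ccontr)
  assume "\<not> ?thesis"
  then have "eventually (\<lambda>n. 2 * p n < p (Suc n)) sequentially"
    by (simp add: not_frequently not_le)
  from eventually_conj[OF this eventually_conj[OF pos ub]]
  obtain N where N: "\<And>n. N \<le> n \<Longrightarrow> 2 * p n < p (Suc n) \<and> 0 < p n \<and> p n \<le> exp (C * (a + real n * L) powr \<mu>)"
    unfolding eventually_sequentially by auto
  have ge: "2 ^ k * p N \<le> p (N + k)" for k
  proof (induction k)
    case (Suc k) then show ?case using N[of "N + k"] by simp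
  qed simp
  define x where "x = (\<lambda>k. a + real (N + k) * L)"
  have "filterlim (\<lambda>k. N + k) sequentially sequentially"
    using filterlim_add_const_nat_at_top[of N] by (simp add: add.commute[of N])
  then have "filterlim (\<lambda>k. real (N + k) * L) at_top sequentially"
    using \<open>0 < L\<close> by (intro filterlim_at_top_mult_tendsto_pos[OF tendsto_const] filterlim_compose[OF filterlim_real_sequentially])
  then have x: "filterlim x at_top sequentially"
    unfolding x_def by (rule filterlim_tendsto_add_at_top[OF tendsto_const])
  have inv: "(\<lambda>k. inverse (x k)) \<longlonglongrightarrow> 0" using x by (rule tendsto_inverse_0_at_top)
  have pw: "(\<lambda>k. x k powr (\<mu> - 1)) \<longlonglongrightarrow> 0" using x \<open>\<mu> < 1\<close> by (intro tendsto_neg_powr) auto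
  \<comment> \<open>The logarithm of the growth inequality, divided by \<open>x k\<close>. As
    \<open>k\<close> grows the left side tends to \<open>ln 2 / L\<close> and the right side to
    zero.\<close>
  have le: "eventually (\<lambda>k. (1 - (a + N * L) * inverse (x k)) * (ln 2 / L) + ln (p N) * inverse (x k) \<le> C * x k powr (\<mu> - 1)) sequentially"
    using x[unfolded filterlim_at_top_dense, rule_format, of 0]
  proof eventually_elim
    case (elim k)
    have "2 ^ k * p N \<le> exp (C * x k powr \<mu>)" using ge[of k] N[of "N + k"] by (simp add: x_def)
    then have "ln (2 ^ k * p N) \<le> ln (exp (C * x k powr \<mu>))" using N[of N] by (subst ln_le_cancel_iff) auto
    moreover have "ln (2 ^ k * p N) = k * ln 2 + ln (p N)" using N[of N] by (subst ln_mult) (auto simp: ln_realpow)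
    ultimately have "k * ln 2 + ln (p N) \<le> C * x k powr \<mu>" by simp
    then have "(k * ln 2 + ln (p N)) * inverse (x k) \<le> C * x k powr \<mu> * inverse (x k)"
      using elim by (intro mult_right_mono) auto
    also have "\<dots> = C * x k powr (\<mu> - 1)"
      using elim by (simp add: powr_diff field_simps)
    also have "(k * ln 2 + ln (p N)) * inverse (x k) =
        (1 - (a + N * L) * inverse (x k)) * (ln 2 / L) + ln (p N) * inverse (x k)"
    proof -
      have "real k * L = x k - (a + N * L)" by (simp add: x_def algebra_simps)
      then have "real k = (x k - (a + N * L)) / L" using \<open>0 < L\<close> by (simp add: eq_divide_eq)
      then have kx: "real k * inverse (x k) = (1 - (a + N * L) * inverse (x k)) / L"
        using elim by (simp add: divide_simps)
      have "(k * ln 2 + ln (p N)) * inverse (x k) = (real k * inverse (x k)) * ln 2 + ln (p N) * inverse (x k)"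
        by (simp add: algebra_simps)
      then show ?thesis unfolding kx by simp
    qed
    finally show ?case .
  qed
  have "(1 - (a + N * L) * 0) * (ln 2 / L) + ln (p N) * 0 \<le> C * 0"
    by (rule tendsto_le[OF sequentially_bot _ _ le]) (intro tendsto_intros inv pw)+
  then show False using \<open>0 < L\<close> by (simp add: field_simps)
qed

section \<open>Maximum modulus\<close>

text \<open>The closed disc makes bounds at interior points immediate; the maximum principle shows
  that the supremum is attained on the circle.\<close>

definition max_modulus :: "(complex \<Rightarrow> complex) \<Rightarrow> real \<Rightarrow> real" where
  "max_modulus f r = (SUP z\<in>cball 0 r. cmod (f z))"

lemma max_modulus_attained:
  assumes "f holomorphic_on UNIV" "0 < r"
  obtains z where "cmod z = r" "max_modulus f r = cmod (f z)" "\<And>u. cmod u \<le> r \<Longrightarrow> cmod (f u) \<le> cmod (f z)"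
proof -
  have cont: "continuous_on A f" for A
    using assms(1) holomorphic_on_imp_continuous_on continuous_on_subset by blast
  have "of_real r \<in> sphere (0::complex) r" using assms(2) by simp
  then have ne: "sphere (0::complex) r \<noteq> {}" by blast
  have "continuous_on (sphere 0 r) (\<lambda>z. cmod (f z))" by (intro continuous_on_norm cont)
  from continuous_attains_sup[OF compact_sphere ne this]
  obtain z where z: "z \<in> sphere 0 r" "\<And>u. u \<in> sphere 0 r \<Longrightarrow> cmod (f u) \<le> cmod (f z)" by auto
  have le: "cmod (f u) \<le> cmod (f z)" if "cmod u \<le> r" for u
  proof (rule maximum_modulus_frontier[of f "cball 0 r"])
    show "f holomorphic_on interior (cball 0 r)" using assms(1) holomorphic_on_subset by blast
    show "continuous_on (closure (cball 0 r)) f" by (rule cont)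
    fix x :: complex assume "x \<in> frontier (cball 0 r)"
    then show "cmod (f x) \<le> cmod (f z)" using z(2) assms(2) by simp
  qed (use that in auto)
  have "max_modulus f r = cmod (f z)" unfolding max_modulus_def
    using z(1) le by (intro cSup_eq_maximum) auto
  then show ?thesis using that z(1) le by auto
qed

lemma cmod_le_max_modulus:
  assumes "f holomorphic_on UNIV" "0 < r" "cmod z \<le> r"
  shows "cmod (f z) \<le> max_modulus f r"
  by (rule max_modulus_attained[OF assms(1,2)]) (use assms(3) in simp)

lemma max_modulus_le:
  assumes "f holomorphic_on UNIV" "0 < r" "\<And>z. cmod z = r \<Longrightarrow> cmod (f z) \<le> B"
  shows "max_modulus f r \<le> B"
  by (rule max_modulus_attained[OF assms(1,2)]) (use assms(3) in simp)

lemma max_modulus_nonneg: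
  assumes "f holomorphic_on UNIV" "0 < r"
  shows "0 \<le> max_modulus f r"
  by (rule max_modulus_attained[OF assms]) simp

lemma max_modulus_deriv_le:
  assumes hol: "f holomorphic_on UNIV" and r: "0 < r" and s: "0 < s"
  shows "max_modulus (deriv f) r \<le> max_modulus f (r + s) / s"
proof (rule max_modulus_le)
  show "deriv f holomorphic_on UNIV" using hol by (intro holomorphic_deriv) auto
  fix z assume z: "cmod z = r"
  have "cmod ((deriv ^^ 1) f z) \<le> fact 1 * max_modulus f (r + s) / s ^ 1"
  proof (rule Cauchy_inequality)
    fix x assume "cmod (z - x) = s"
    then show "cmod (f x) \<le> max_modulus f (r + s)"
      using z r s norm_triangle_sub[of x z] by (intro cmod_le_max_modulus hol) (auto simp: norm_minus_commute)
  qed (use s hol in \<open>auto intro: holomorphic_on_subset holomorphic_on_imp_continuous_on continuous_on_subset\<close>)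
  then show "cmod (deriv f z) \<le> max_modulus f (r + s) / s" by simp
qed (use r in auto)

lemma cmod_diff_le_max_modulus_deriv:
  assumes hol: "f holomorphic_on UNIV" and r: "0 < r" and z: "cmod z \<le> r" "cmod u \<le> r"
  shows "cmod (f z - f u) \<le> max_modulus (deriv f) r * cmod (z - u)"
proof (rule field_differentiable_bound[of "cball 0 r"])
  fix x :: complex assume "x \<in> cball 0 r"
  then show "(f has_field_derivative deriv f x) (at x within cball 0 r)"
    using hol holomorphic_derivI by blast
  have "deriv f holomorphic_on UNIV" using hol by (intro holomorphic_deriv) auto
  then show "cmod (deriv f x) \<le> max_modulus (deriv f) r" using \<open>x \<in> cball 0 r\<close> r by (intro cmod_le_max_modulus) auto
qed (use z in auto)

lemma max_modulus_superpolynomial: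
  assumes hol: "f holomorphic_on UNIV" and np: "\<not> (\<exists>p. \<forall>z. f z = poly p z)"
  shows "eventually (\<lambda>r. C * r ^ m < max_modulus f r) at_top"
proof -
  obtain n c where n: "Suc m \<le> n" "0 < c"
    "\<And>r B. 0 < r \<Longrightarrow> (\<And>z. cmod z = r \<Longrightarrow> cmod (f z) \<le> B) \<Longrightarrow> c * r ^ n \<le> B"
    using entire_not_poly_growth[OF hol np, of "Suc m"] by blast
  show ?thesis using eventually_gt_at_top[of "max 1 (C / c)"]
  proof eventually_elim
    case (elim r)
    then have r: "1 < r" "C < c * r" using n(2) by (auto simp: field_simps)
    then have "C * r ^ m < c * r * r ^ m" by (intro mult_strict_right_mono) auto
    also have "\<dots> = c * r ^ Suc m" by simp
    also have "\<dots> \<le> c * r ^ n" using r n by (intro mult_left_mono power_increasing) auto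
    also have "\<dots> \<le> max_modulus f r" using r by (intro n(3) cmod_le_max_modulus hol) auto
    finally show ?case .
  qed
qed

text \<open>Radii are sampled in steps of \<open>L\<close>. The predicate \<open>P\<close> collects
  everything else that is wanted at the same radius.\<close>

lemma max_modulus_frequently_doubling:
  assumes hol: "f holomorphic_on UNIV" and np: "\<not> (\<exists>p. \<forall>z. f z = poly p z)"
    and growth: "eventually (\<lambda>r. max_modulus f r \<le> exp (C * r powr \<mu>)) at_top"
    and "0 < L" "0 < \<mu>" "\<mu> < 1"
    and P: "eventually P at_top"
  obtains r where "P r" "max_modulus f (r + L) \<le> 2 * max_modulus f r"
proof -
  have lim: "filterlim (\<lambda>n. 0 + real n * L) at_top sequentially"
    using \<open>0 < L\<close> by (simp, intro filterlim_at_top_mult_tendsto_pos[OF tendsto_const] filterlim_real_sequentially)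
  have pos: "eventually (\<lambda>r. 0 < max_modulus f r) at_top"
    using max_modulus_superpolynomial[OF hol np, of 0 0] by simp
  have "\<exists>\<^sub>F n in sequentially. max_modulus f (0 + real (Suc n) * L) \<le> 2 * max_modulus f (0 + real n * L)"
    by (rule frequently_doubling[OF eventually_compose_filterlim[OF pos lim] eventually_compose_filterlim[OF growth lim] assms(4-6)])
  then have "\<exists>\<^sub>F n in sequentially. max_modulus f (0 + real (Suc n) * L) \<le> 2 * max_modulus f (0 + real n * L) \<and> P (0 + real n * L)"
    using eventually_compose_filterlim[OF P lim] by (rule frequently_eventually_frequently)
  then obtain n where "max_modulus f (0 + real (Suc n) * L) \<le> 2 * max_modulus f (0 + real n * L)" "P (0 + real n * L)"
    using frequently_ex by blast
  then show ?thesis using that[of "real n * L"] by (simp add: algebra_simps)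
qed

section \<open>Polynomial bounds and lower bounds for the derivative\<close>

lemma poly_upper_bound:
  fixes p :: "complex poly"
  obtains C where "0 < C" "\<And>z. 1 \<le> cmod z \<Longrightarrow> cmod (poly p z) \<le> C * cmod z ^ degree p"
proof
  let ?C = "(\<Sum>i\<le>degree p. cmod (coeff p i)) + 1"
  show "0 < ?C" by (smt (verit) norm_ge_zero sum_nonneg)
  fix z :: complex assume z: "1 \<le> cmod z"
  have "cmod (poly p z) \<le> (\<Sum>i\<le>degree p. cmod (coeff p i * z ^ i))"
    unfolding poly_altdef by (rule norm_sum)
  also have "\<dots> \<le> (\<Sum>i\<le>degree p. cmod (coeff p i) * cmod z ^ degree p)"
    using z by (intro sum_mono) (auto simp: norm_mult norm_power intro!: mult_left_mono power_increasing)
  also have "\<dots> \<le> ?C * cmod z ^ degree p" by (simp add: sum_distrib_right distrib_right)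
  finally show "cmod (poly p z) \<le> ?C * cmod z ^ degree p" .
qed

lemma poly_lower_bound:
  fixes p :: "complex poly"
  assumes "p \<noteq> 0"
  shows "\<exists>c R. 0 < c \<and> (\<forall>z. R \<le> cmod z \<longrightarrow> c * cmod z ^ degree p \<le> cmod (poly p z))"
  using assms
proof (induction p)
  case (pCons a p)
  show ?case
  proof (cases "p = 0")
    case True
    then show ?thesis using pCons by (intro exI[of _ "cmod a"]) auto
  next
    case False
    then obtain c R where c: "0 < c" "\<And>z. R \<le> cmod z \<Longrightarrow> c * cmod z ^ degree p \<le> cmod (poly p z)"
      using pCons by auto
    have "c / 2 * cmod z ^ degree (pCons a p) \<le> cmod (poly (pCons a p) z)"
      if z: "max R (max 1 (2 * cmod a / c)) \<le> cmod z" for z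
    proof -
      have 1: "cmod z * (c * cmod z ^ degree p) \<le> cmod z * cmod (poly p z)"
        using z c(2)[of z] by (intro mult_left_mono) auto
      have "cmod a * 1 \<le> c / 2 * cmod z ^ 1" using z c(1) by (simp add: field_simps)
      also have "\<dots> \<le> c / 2 * cmod z ^ Suc (degree p)" using z c(1) by (intro mult_left_mono power_increasing) auto
      finally have "cmod a \<le> c / 2 * cmod z ^ Suc (degree p)" by simp
      moreover have "cmod z * cmod (poly p z) - cmod a \<le> cmod (a + z * poly p z)"
        using norm_diff_ineq[of "z * poly p z" a] by (simp add: norm_mult add.commute)
      moreover have "cmod z * (c * cmod z ^ degree p) = c * cmod z ^ Suc (degree p)" by simp
      ultimately have "c / 2 * cmod z ^ Suc (degree p) \<le> cmod (a + z * poly p z)" using 1 by linarith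
      then show ?thesis using False by simp
    qed
    then show ?thesis using c(1) by (intro exI[of _ "c/2"] exI[of _ "max R (max 1 (2 * cmod a / c))"]) auto
  qed
qed simp

lemma poly_upper_bound_cball:
  fixes p :: "complex poly"
  obtains C where "0 < C" "\<And>r z. 1 \<le> r \<Longrightarrow> cmod z \<le> r \<Longrightarrow> cmod (poly p z) \<le> C * r ^ degree p"
proof -
  obtain C where C: "0 < C" "\<And>z. 1 \<le> cmod z \<Longrightarrow> cmod (poly p z) \<le> C * cmod z ^ degree p"
    using poly_upper_bound by blast
  have hol: "poly p holomorphic_on UNIV" by (intro holomorphic_intros)
  show ?thesis
  proof (rule that[OF C(1)])
    fix r :: real and z assume r: "1 \<le> r" "cmod z \<le> r"
    have "cmod (poly p z) \<le> max_modulus (poly p) r" using r by (intro cmod_le_max_modulus hol) auto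
    also have "\<dots> \<le> C * r ^ degree p" using r C(2) by (intro max_modulus_le hol) auto
    finally show "cmod (poly p z) \<le> C * r ^ degree p" .
  qed
qed

text \<open>Along the ray through a maximum point of \<open>h\<close>, the modulus of \<open>V\<close> grows at least like \<open>t ^ K\<close>.
  This replaces the Wiman--Valiron estimate \<open>z V' / V \<sim> \<nu>(r)\<close>.\<close>

lemma power_mult_max_modulus_deriv:
  fixes K :: nat
  assumes h: "h holomorphic_on UNIV" and r: "0 < r" and V: "V = (\<lambda>z. z ^ K * h z)"
  shows "K * max_modulus V r \<le> r * max_modulus (deriv V) r"
proof -
  have Vhol: "V holomorphic_on UNIV" unfolding V by (intro holomorphic_intros h)
  obtain z where z: "cmod z = r" "\<And>u. cmod u \<le> r \<Longrightarrow> cmod (h u) \<le> cmod (h z)"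
    using max_modulus_attained[OF h r] by blast
  let ?X = "r * max_modulus (deriv V) r"
  have MV: "max_modulus V r \<le> cmod (V z)"
    using r z by (intro max_modulus_le Vhol) (auto simp: V norm_mult norm_power intro!: mult_left_mono)
  \<comment> \<open>The increment of \<open>V\<close> along the radius contains the factor
    \<open>1 - t ^ K\<close>; cancelling \<open>1 - t\<close> leaves a geometric sum, which tends to
    \<open>K\<close> as \<open>t\<close> tends to one.\<close>
  have le: "(\<Sum>i<K. t ^ i) * cmod (V z) \<le> ?X" if t: "0 < t" "t < 1" for t :: real
  proof -
    have "cmod (V (of_real t * z)) = t ^ K * r ^ K * cmod (h (of_real t * z))"
      using t z by (simp add: V norm_mult norm_power power_mult_distrib)
    also have "\<dots> \<le> t ^ K * r ^ K * cmod (h z)"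
      using t z r by (intro mult_left_mono z(2)) (auto simp: norm_mult mult_le_cancel_right1)
    also have "\<dots> = t ^ K * cmod (V z)" using z by (simp add: V norm_mult norm_power)
    finally have "(1 - t ^ K) * cmod (V z) \<le> cmod (V z) - cmod (V (of_real t * z))" by (simp add: algebra_simps)
    also have "\<dots> \<le> cmod (V z - V (of_real t * z))" by (rule norm_triangle_ineq2)
    also have "\<dots> \<le> max_modulus (deriv V) r * cmod (z - of_real t * z)"
      using t z r by (intro cmod_diff_le_max_modulus_deriv Vhol) (auto simp: norm_mult mult_le_cancel_right1)
    also have "cmod (z - of_real t * z) = (1 - t) * r"
    proof -
      have "z - of_real t * z = of_real (1 - t) * z" by (simp add: algebra_simps)
      then show ?thesis using t z by (simp only: norm_mult norm_of_real)
    qed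
    finally have "(1 - t) * ((\<Sum>i<K. t ^ i) * cmod (V z)) \<le> (1 - t) * ?X"
      by (simp add: one_diff_power_eq algebra_simps)
    then show ?thesis using t by simp
  qed
  have "((\<lambda>t. (\<Sum>i<K. t ^ i) * cmod (V z)) \<longlongrightarrow> (\<Sum>i<K. 1 ^ i) * cmod (V z)) (at_left (1::real))"
    by (intro tendsto_intros)
  moreover have "eventually (\<lambda>t. (\<Sum>i<K. t ^ i) * cmod (V z) \<le> ?X) (at_left (1::real))"
    using eventually_at_left_real[of 0 "1::real"] le by (auto elim!: eventually_mono)
  ultimately have "(\<Sum>i<K. 1 ^ i) * cmod (V z) \<le> ?X" using tendsto_upperbound by fastforce
  then have "K * cmod (V z) \<le> ?X" by simp
  moreover have "K * max_modulus V r \<le> K * cmod (V z)" using MV by (intro mult_left_mono) auto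
  ultimately show ?thesis by linarith
qed

text \<open>Since \<open>K\<close> is arbitrary and the error polynomial,
  \<open>r * max_modulus (deriv f) r\<close> outgrows every multiple of
  \<open>max_modulus f r\<close> when \<open>f\<close> is not a polynomial.\<close>

lemma max_modulus_deriv_lower_bound:
  fixes K :: nat
  assumes f: "f holomorphic_on UNIV"
  obtains C s where "\<And>r. 1 \<le> r \<Longrightarrow> K * max_modulus f r \<le> r * max_modulus (deriv f) r + C * r ^ s"
proof -
  obtain p h where h: "h holomorphic_on UNIV" "\<And>z. f z = poly p z + z ^ K * h z"
    using entire_taylor[OF f] by blast
  define V where "V = (\<lambda>z. z ^ K * h z)"
  have V: "V holomorphic_on UNIV" unfolding V_def by (intro holomorphic_intros h)
  have f': "deriv f holomorphic_on UNIV" and V': "deriv V holomorphic_on UNIV" using f V by (auto intro!: holomorphic_deriv)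
  have dV: "deriv V z = deriv f z - poly (pderiv p) z" for z
  proof -
    have "V = (\<lambda>z. f z - poly p z)" using h(2) by (auto simp: V_def)
    moreover have "((\<lambda>z. f z - poly p z) has_field_derivative deriv f z - poly (pderiv p) z) (at z)"
      using f by (intro derivative_intros holomorphic_derivI[of f UNIV]) auto
    ultimately show ?thesis by (metis DERIV_imp_deriv)
  qed
  obtain C where C: "0 < C" "\<And>r z. 1 \<le> r \<Longrightarrow> cmod z \<le> r \<Longrightarrow> cmod (poly p z) \<le> C * r ^ degree p"
    using poly_upper_bound_cball by blast
  obtain D where D: "0 < D" "\<And>r z. 1 \<le> r \<Longrightarrow> cmod z \<le> r \<Longrightarrow> cmod (poly (pderiv p) z) \<le> D * r ^ degree (pderiv p)"
    using poly_upper_bound_cball by blast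
  define s where "s = max (degree p) (Suc (degree (pderiv p)))"
  show ?thesis
  proof (rule that[of "K * C + D" s])
    fix r :: real assume r: "1 \<le> r"
    have e: "r ^ degree p \<le> r ^ s" "r ^ Suc (degree (pderiv p)) \<le> r ^ s"
      by (rule power_increasing; use r in \<open>simp add: s_def\<close>)+
    have "max_modulus f r \<le> max_modulus V r + C * r ^ degree p"
    proof (rule max_modulus_le[OF f])
      fix z assume z: "cmod z = r"
      have "cmod (f z) \<le> cmod (poly p z) + cmod (V z)" using h(2)[of z] norm_triangle_ineq by (auto simp: V_def)
      then show "cmod (f z) \<le> max_modulus V r + C * r ^ degree p"
        using C(2)[of r z] cmod_le_max_modulus[OF V, of r z] r z by linarith
    qed (use r in auto)
    also have "C * r ^ degree p \<le> C * r ^ s" using e C(1) by (intro mult_left_mono) auto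
    finally have "K * max_modulus f r \<le> K * (max_modulus V r + C * r ^ s)" by (intro mult_left_mono) auto
    moreover have "K * max_modulus V r \<le> r * max_modulus (deriv V) r"
      using r by (intro power_mult_max_modulus_deriv[OF h(1)] V_def) auto
    moreover have "max_modulus (deriv V) r \<le> max_modulus (deriv f) r + D * r ^ degree (pderiv p)"
    proof (rule max_modulus_le[OF V'])
      fix z assume z: "cmod z = r"
      have "cmod (deriv V z) \<le> cmod (deriv f z) + cmod (poly (pderiv p) z)" unfolding dV by (rule norm_triangle_ineq4)
      then show "cmod (deriv V z) \<le> max_modulus (deriv f) r + D * r ^ degree (pderiv p)"
        using D(2)[of r z] cmod_le_max_modulus[OF f', of r z] r z by linarith
    qed (use r in auto)
    then have "r * max_modulus (deriv V) r \<le> r * (max_modulus (deriv f) r + D * r ^ degree (pderiv p))"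
      using r by (intro mult_left_mono) auto
    moreover have "D * r ^ Suc (degree (pderiv p)) \<le> D * r ^ s" using e D(1) by (intro mult_left_mono) auto
    ultimately show "K * max_modulus f r \<le> r * max_modulus (deriv f) r + (K * C + D) * r ^ s"
      by (simp add: algebra_simps)
  qed
qed

section \<open>Difference equations and order less than one\<close>

text \<open>At a maximum point of \<open>w\<close> on a doubling circle the difference is so small
  that the left side absorbs at most half of \<open>A1 * w\<close>, and the other half exceeds the
  polynomial \<open>A0\<close>.\<close>

lemma slow_difference_equation_high_degree:
  fixes q A0 A1 :: "complex poly"
  assumes w: "w holomorphic_on UNIV" and np: "\<not> (\<exists>p. \<forall>z. w z = poly p z)"
    and eq: "\<And>z. poly q z * (w (z + 1) - w (z - 1)) = poly A1 z * w z + poly A0 z"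
    and growth: "eventually (\<lambda>r. max_modulus w r \<le> exp (C * r powr \<mu>)) at_top" and \<mu>: "0 < \<mu>" "\<mu> < 1"
    and deg: "A1 \<noteq> 0" "degree q \<le> degree A1"
  shows False
proof -
  obtain c R where c: "0 < c" "\<And>z. R \<le> cmod z \<Longrightarrow> c * cmod z ^ degree A1 \<le> cmod (poly A1 z)"
    using poly_lower_bound[OF deg(1)] by blast
  obtain Cq where Cq: "0 < Cq" "\<And>z. 1 \<le> cmod z \<Longrightarrow> cmod (poly q z) \<le> Cq * cmod z ^ degree q"
    using poly_upper_bound by blast
  obtain C0 where C0: "0 < C0" "\<And>z. 1 \<le> cmod z \<Longrightarrow> cmod (poly A0 z) \<le> C0 * cmod z ^ degree A0"
    using poly_upper_bound by blast
  \<comment> \<open>Chosen so that Cauchy's estimate with radius \<open>L - 1\<close>, doubling and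
    the segment of length two give the bound \<open>c * ?M / (2 * Cq)\<close> for the
    difference.\<close>
  define L where "L = 1 + 8 * Cq / c"
  have L: "1 < L" "0 < L" using c Cq by (simp_all add: L_def add_pos_pos)
  have ev: "eventually (\<lambda>r. 1 \<le> r \<and> R \<le> r \<and> 2 * C0 / c * r ^ degree A0 < max_modulus w r) at_top"
    by (intro eventually_conj eventually_ge_at_top max_modulus_superpolynomial w np)
  obtain r where r: "1 \<le> r" "R \<le> r" "2 * C0 / c * r ^ degree A0 < max_modulus w r"
      and dbl: "max_modulus w (r + L) \<le> 2 * max_modulus w r"
    using max_modulus_frequently_doubling[OF w np growth L(2) \<mu> ev] by metis
  have r0: "0 < r" using r(1) by simp
  obtain z where z: "cmod z = r" "max_modulus w r = cmod (w z)"
    using max_modulus_attained[OF w r0] by metis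
  let ?M = "max_modulus w r"
  have M0: "0 \<le> ?M" by (simp add: z)
  have "cmod (w (z + 1) - w (z - 1)) \<le> max_modulus (deriv w) (r + 1) * cmod ((z + 1) - (z - 1))"
    using r z norm_triangle_ineq[of z 1] norm_triangle_ineq4[of z 1] by (intro cmod_diff_le_max_modulus_deriv w) auto
  also have "\<dots> = max_modulus (deriv w) (r + 1) * 2" by simp
  also have "max_modulus (deriv w) (r + 1) \<le> max_modulus w (r + 1 + (L - 1)) / (L - 1)"
    using r L by (intro max_modulus_deriv_le w) auto
  also have "\<dots> \<le> 2 * ?M / (L - 1)" using dbl L by (intro divide_right_mono) auto
  also have "\<dots> = c * ?M / (4 * Cq)" using c Cq by (simp add: L_def)
  finally have d: "cmod (w (z + 1) - w (z - 1)) \<le> c * ?M / (2 * Cq)" by simp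
  have "c * r ^ degree A1 * ?M \<le> cmod (poly A1 z) * cmod (w z)"
    using c(2)[of z] r z M0 by (auto intro!: mult_right_mono)
  also have "\<dots> = cmod (poly q z * (w (z + 1) - w (z - 1)) - poly A0 z)" by (simp add: eq norm_mult)
  also have "\<dots> \<le> cmod (poly q z) * cmod (w (z + 1) - w (z - 1)) + cmod (poly A0 z)"
    using norm_triangle_ineq4 by (metis norm_mult)
  also have "\<dots> \<le> Cq * r ^ degree q * (c * ?M / (2 * Cq)) + C0 * r ^ degree A0"
    using d Cq(2)[of z] C0(2)[of z] r z Cq(1) by (intro add_mono mult_mono) auto
  also have "\<dots> = c * ?M / 2 * r ^ degree q + C0 * r ^ degree A0" using Cq by simp
  also have "c * ?M / 2 * r ^ degree q \<le> c * ?M / 2 * r ^ degree A1"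
    using c M0 r deg by (intro mult_left_mono power_increasing) auto
  finally have "c * ?M / 2 * r ^ degree A1 \<le> C0 * r ^ degree A0" by (simp add: field_simps)
  moreover have "c * ?M / 2 * 1 \<le> c * ?M / 2 * r ^ degree A1"
    using c M0 r by (intro mult_left_mono) auto
  ultimately have "c * ?M / 2 \<le> C0 * r ^ degree A0" by linarith
  then show False using r(3) c(1) by (simp add: field_simps)
qed

text \<open>The doubling circle is taken for \<open>deriv w\<close>. At its maximum point the
  difference is at least as large as the derivative, so the equation bounds \<open>r * M(w')\<close>
  by a fixed multiple of \<open>M(w)\<close> plus a polynomial, against the arbitrary factor
  \<open>K\<close> in the lower bound for the derivative.\<close>

lemma slow_difference_equation_low_degree:
  fixes q A0 A1 :: "complex poly"
  assumes w: "w holomorphic_on UNIV" and np: "\<not> (\<exists>p. \<forall>z. w z = poly p z)"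
    and eq: "\<And>z. poly q z * (w (z + 1) - w (z - 1)) = poly A1 z * w z + poly A0 z"
    and growth: "eventually (\<lambda>r. max_modulus (deriv w) r \<le> exp (C * r powr \<mu>)) at_top" and \<mu>: "0 < \<mu>" "\<mu> < 1"
    and np': "\<not> (\<exists>p. \<forall>z. deriv w z = poly p z)"
    and deg: "q \<noteq> 0" "A1 = 0 \<or> degree A1 < degree q"
  shows False
proof -
  have w': "deriv w holomorphic_on UNIV" using w by (auto intro!: holomorphic_deriv)
  obtain c R where c: "0 < c" "\<And>z. R \<le> cmod z \<Longrightarrow> c * cmod z ^ degree q \<le> cmod (poly q z)"
    using poly_lower_bound[OF deg(1)] by blast
  obtain C0 where C0: "0 < C0" "\<And>z. 1 \<le> cmod z \<Longrightarrow> cmod (poly A0 z) \<le> C0 * cmod z ^ degree A0"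
    using poly_upper_bound by blast
  \<comment> \<open>The gap between the degrees of \<open>A1\<close> and \<open>q\<close> pays for
    one factor \<open>cmod z\<close>.\<close>
  obtain C1 where C1: "0 < C1" "\<And>z. 1 \<le> cmod z \<Longrightarrow> cmod z * cmod (poly A1 z) \<le> C1 * cmod z ^ degree q"
  proof (cases "A1 = 0")
    case True then show ?thesis using that[of 1] by simp
  next
    case False
    obtain D where D: "0 < D" "\<And>z. 1 \<le> cmod z \<Longrightarrow> cmod (poly A1 z) \<le> D * cmod z ^ degree A1"
      using poly_upper_bound by blast
    show ?thesis
    proof (rule that[OF D(1)])
      fix z :: complex assume z: "1 \<le> cmod z"
      have "cmod z * cmod (poly A1 z) \<le> cmod z * (D * cmod z ^ degree A1)" using D(2)[OF z] by (intro mult_left_mono) auto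
      also have "\<dots> = D * cmod z ^ Suc (degree A1)" by simp
      also have "\<dots> \<le> D * cmod z ^ degree q" using deg(2) False D(1) z by (intro mult_left_mono power_increasing) auto
      finally show "cmod z * cmod (poly A1 z) \<le> D * cmod z ^ degree q" .
    qed
  qed
  \<comment> \<open>With \<open>C1 + 1 \<le> c * K\<close> the term \<open>C1 * ?M\<close> is
    absorbed and a full \<open>?M\<close> is left, bounded by a polynomial.\<close>
  define K where "K = nat \<lceil>(C1 + 1) / c\<rceil>"
  have K: "C1 + 1 \<le> c * K" using c(1) C1(1) unfolding K_def by (simp add: pos_divide_le_eq[symmetric] mult.commute[of c] real_nat_ceiling_ge)
  obtain B s where B: "\<And>r. 1 \<le> r \<Longrightarrow> K * max_modulus w r \<le> r * max_modulus (deriv w) r + B * r ^ s"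
    using max_modulus_deriv_lower_bound[OF w] by blast
  define m where "m = max s (Suc (degree A0))"
  have ev: "eventually (\<lambda>r. 1 \<le> r \<and> R \<le> r \<and> (c * \<bar>B\<bar> + C0) * r ^ m < max_modulus w r) at_top"
    by (intro eventually_conj eventually_ge_at_top max_modulus_superpolynomial w np)
  \<comment> \<open>The unit shift plus a Cauchy radius of four: doubling then lets
    \<open>deriv w\<close> vary by at most half its maximum within distance one of the maximum
    point.\<close>
  have five: "(0::real) < 5" by simp
  obtain r where r: "1 \<le> r" "R \<le> r" "(c * \<bar>B\<bar> + C0) * r ^ m < max_modulus w r"
      and dbl: "max_modulus (deriv w) (r + 5) \<le> 2 * max_modulus (deriv w) r"
    using max_modulus_frequently_doubling[OF w' np' growth five \<mu> ev] by metis
  have r0: "0 < r" using r(1) by simp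
  obtain z where z: "cmod z = r" "max_modulus (deriv w) r = cmod (deriv w z)"
    using max_modulus_attained[OF w' r0] by metis
  let ?N = "max_modulus (deriv w) r" and ?M = "max_modulus w r"
  have M0: "0 \<le> ?M" using r by (intro max_modulus_nonneg w) auto
  have N0: "0 \<le> ?N" by (simp add: z)
  \<comment> \<open>Once the linear part at \<open>z\<close> is removed, at most
    \<open>?N / 2\<close> times the length two remains, so the difference keeps at least
    \<open>2 * ?N - ?N\<close>.\<close>
  have "cmod ((w (z + 1) - deriv w z * (z + 1)) - (w (z - 1) - deriv w z * (z - 1))) \<le> ?N / 2 * cmod ((z + 1) - (z - 1))"
  proof (rule field_differentiable_bound[of "cball z 1"])
    fix x assume x: "x \<in> cball z 1"
    show "((\<lambda>x. w x - deriv w z * x) has_field_derivative deriv w x - deriv w z) (at x within cball z 1)"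
      using w by (auto intro!: derivative_eq_intros holomorphic_derivI)
    have x1: "cmod x \<le> r + 1" "cmod (x - z) \<le> 1"
      using x z norm_triangle_sub[of x z] by (auto simp: dist_norm norm_minus_commute)
    have "cmod (deriv w x - deriv w z) \<le> max_modulus (deriv (deriv w)) (r + 1) * cmod (x - z)"
      using x1 z r by (intro cmod_diff_le_max_modulus_deriv w') auto
    also have "\<dots> \<le> max_modulus (deriv w) (r + 1 + 4) / 4 * 1"
    proof (rule mult_mono)
      show "max_modulus (deriv (deriv w)) (r + 1) \<le> max_modulus (deriv w) (r + 1 + 4) / 4"
        using r by (intro max_modulus_deriv_le w') auto
      show "0 \<le> max_modulus (deriv w) (r + 1 + 4) / 4"
        using r by (intro divide_nonneg_pos max_modulus_nonneg w') auto
    qed (use x1 in auto)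
    also have "\<dots> \<le> ?N / 2"
    proof -
      have e: "r + 1 + 4 = r + 5" by simp
      show ?thesis using dbl unfolding e by linarith
    qed
    finally show "cmod (deriv w x - deriv w z) \<le> ?N / 2" .
  qed (auto simp: dist_norm)
  also have "\<dots> = ?N" by simp
  also have "(w (z + 1) - deriv w z * (z + 1)) - (w (z - 1) - deriv w z * (z - 1)) = (w (z + 1) - w (z - 1)) - 2 * deriv w z"
    by (simp add: algebra_simps)
  finally have "cmod (2 * deriv w z) \<le> ?N + cmod (w (z + 1) - w (z - 1))"
    using norm_triangle_sub[of "2 * deriv w z" "w (z + 1) - w (z - 1)"] by (simp add: norm_minus_commute)
  then have d: "?N \<le> cmod (w (z + 1) - w (z - 1))" using z by (simp add: norm_mult)
  have c1: "cmod z * cmod (poly A1 z) \<le> C1 * r ^ degree q" using C1(2)[of z] z r by simp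
  have cw: "cmod (w z) \<le> ?M" using z r by (intro cmod_le_max_modulus w) auto
  have c0: "r * cmod (poly A0 z) \<le> r * (C0 * r ^ degree A0)" using C0(2)[of z] z r by simp
  have "(r ^ degree q) * (c * (r * ?N)) = r * (c * r ^ degree q * ?N)" by simp
  also have "\<dots> \<le> r * (cmod (poly q z) * cmod (w (z + 1) - w (z - 1)))"
    using c r z d N0 by (intro mult_left_mono mult_mono) auto
  also have "\<dots> = r * cmod (poly A1 z * w z + poly A0 z)" by (simp add: eq[symmetric] norm_mult)
  also have "\<dots> \<le> r * (cmod (poly A1 z) * cmod (w z) + cmod (poly A0 z))"
    using r norm_triangle_ineq by (intro mult_left_mono) (auto simp: norm_mult[symmetric])
  also have "\<dots> = (cmod z * cmod (poly A1 z)) * cmod (w z) + r * cmod (poly A0 z)"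
    by (simp add: z algebra_simps)
  also have "\<dots> \<le> (C1 * r ^ degree q) * ?M + r * (C0 * r ^ degree A0)"
    using C1(1) r0 by (intro add_mono mult_mono c1 cw c0) auto
  also have "\<dots> = r ^ degree q * (C1 * ?M) + 1 * (C0 * r ^ Suc (degree A0))" by simp
  also have "\<dots> \<le> r ^ degree q * (C1 * ?M) + r ^ degree q * (C0 * r ^ Suc (degree A0))"
    using r C0 by (intro add_left_mono mult_right_mono) auto
  also have "\<dots> = r ^ degree q * (C1 * ?M + C0 * r ^ Suc (degree A0))" by (simp add: distrib_left)
  finally have 1: "c * (r * ?N) \<le> C1 * ?M + C0 * r ^ Suc (degree A0)"
    using r by (subst (asm) mult_le_cancel_left_pos) auto
  have "(C1 + 1) * ?M \<le> (c * K) * ?M" using K M0 by (intro mult_right_mono) auto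
  also have "\<dots> = c * (K * ?M)" by simp
  also have "\<dots> \<le> c * (r * ?N + B * r ^ s)" using B[OF r(1)] c(1) by (intro mult_left_mono) auto
  also have "\<dots> \<le> C1 * ?M + C0 * r ^ Suc (degree A0) + c * B * r ^ s" using 1 by (simp add: algebra_simps)
  finally have "?M \<le> C0 * r ^ Suc (degree A0) + c * B * r ^ s" by (simp add: algebra_simps)
  also have "C0 * r ^ Suc (degree A0) \<le> C0 * r ^ m"
    using r C0 by (intro mult_left_mono power_increasing) (auto simp: m_def)
  also have "c * B * r ^ s \<le> c * \<bar>B\<bar> * r ^ s" using c r by (intro mult_right_mono mult_left_mono) auto
  also have "\<dots> \<le> c * \<bar>B\<bar> * r ^ m"
    using r c by (intro mult_left_mono power_increasing) (auto simp: m_def)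
  finally show False using r(3) by (simp add: algebra_simps)
qed

section \<open>Shifts of polynomials\<close>

text \<open>Allowing every \<open>n\<close> from the degree upwards gives at once the leading
  coefficient and the vanishing of all higher ones.\<close>

lemma coeff_pcompose_shift_top:
  fixes p :: "'a::comm_ring_1 poly"
  assumes "degree p \<le> n"
  shows "coeff (pcompose p [:a, 1:]) n = coeff p n"
  using assms
proof (induction p arbitrary: n)
  case (pCons b p)
  show ?case
  proof (cases "p = 0")
    case False
    then obtain m where m: "n = Suc m" "degree p \<le> m" using pCons.prems by (cases n) auto
    have "coeff p (Suc m) = 0" using m by (intro coeff_eq_0) simp
    then show ?thesis using pCons.IH[of m] pCons.IH[of "Suc m"] m by (simp add: pcompose_pCons)
  qed (simp add: pcompose_pCons)
qed simp

text \<open>These are the first two terms of the binomial expansion; the first-order term is what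
  distinguishes a shift from the identity.\<close>

lemma coeff_pcompose_shift_subtop:
  fixes p :: "'a::comm_ring_1 poly"
  assumes "degree p \<le> Suc n"
  shows "coeff (pcompose p [:a, 1:]) n = coeff p n + of_nat (Suc n) * a * coeff p (Suc n)"
  using assms
proof (induction p arbitrary: n)
  case (pCons b p)
  show ?case
  proof (cases "p = 0")
    case False
    then have d: "degree p \<le> n" using pCons.prems by simp
    show ?thesis
    proof (cases n)
      case 0
      then show ?thesis using coeff_pcompose_shift_top[of p 0 a] d by (simp add: pcompose_pCons)
    next
      case (Suc m)
      then show ?thesis using coeff_pcompose_shift_top[of p n a] d pCons.IH[of m]
        by (simp add: pcompose_pCons algebra_simps)
    qed
  qed (simp add: pcompose_pCons)
qed simp

text \<open>On a ray where \<open>b * z ^ n\<close> is positive, \<open>exp P\<close> grows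
  exponentially while \<open>exp Q\<close> stays bounded, so the right side has only polynomial
  growth.\<close>

lemma exp_poly_ray_contradiction:
  fixes U V W P Q :: "complex poly"
  assumes eq: "\<And>z. poly U z * exp (poly P z) = poly V z * exp (poly Q z) + poly W z"
    and "U \<noteq> 0" and n: "0 < n" and deg: "degree P \<le> n" "degree Q \<le> n"
    and b: "coeff P n = b" "coeff Q n = - b" "b \<noteq> 0"
  shows False
proof -
  \<comment> \<open>The direction of the ray: an \<open>n\<close>-th root that turns
    \<open>b\<close> into its modulus.\<close>
  obtain u where u: "u ^ n = of_real (cmod b) / b"
    using exists_complex_root[OF gr_implies_not0[OF n], of "of_real (cmod b) / b"] by metis
  then have "cmod (u ^ n) = 1" using b(3) by (simp add: norm_divide)
  then have u1: "cmod u = 1" using n power_eq_1_iff[of "cmod u" n] by (simp add: norm_power)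
  have rest: "\<exists>C. \<forall>t\<ge>1. cmod (poly P (of_real t * u) - of_real t ^ n * (u ^ n * coeff P n)) \<le> C * t ^ (n - 1)"
    if "degree P \<le> n" for P :: "complex poly"
  proof -
    define R where "R = P - monom (coeff P n) n"
    have "coeff R i = 0" if "n - 1 < i" for i
      using that n \<open>degree P \<le> n\<close> by (cases "i = n") (auto simp: R_def intro: coeff_eq_0)
    then have dR: "degree R \<le> n - 1" by (intro degree_le) auto
    obtain C where C: "0 < C" "\<And>z. 1 \<le> cmod z \<Longrightarrow> cmod (poly R z) \<le> C * cmod z ^ degree R"
      using poly_upper_bound by blast
    have "cmod (poly P (of_real t * u) - of_real t ^ n * (u ^ n * coeff P n)) \<le> C * t ^ (n - 1)" if t: "1 \<le> t" for t
    proof -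
      have "poly P (of_real t * u) - of_real t ^ n * (u ^ n * coeff P n) = poly R (of_real t * u)"
        by (simp add: R_def poly_monom power_mult_distrib mult_ac)
      moreover have "cmod (poly R (of_real t * u)) \<le> C * t ^ degree R"
        using C(2)[of "of_real t * u"] t u1 by (simp add: norm_mult)
      moreover have "C * t ^ degree R \<le> C * t ^ (n - 1)" using C(1) dR t by (intro mult_left_mono power_increasing) auto
      ultimately show ?thesis by simp
    qed
    then show ?thesis by blast
  qed
  obtain C1 where C1: "\<And>t. 1 \<le> t \<Longrightarrow> cmod (poly P (of_real t * u) - of_real t ^ n * (u ^ n * coeff P n)) \<le> C1 * t ^ (n - 1)"
    using rest[OF deg(1)] by blast
  obtain C2 where C2: "\<And>t. 1 \<le> t \<Longrightarrow> cmod (poly Q (of_real t * u) - of_real t ^ n * (u ^ n * coeff Q n)) \<le> C2 * t ^ (n - 1)"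
    using rest[OF deg(2)] by blast
  obtain c R where c: "0 < c" "\<And>z. R \<le> cmod z \<Longrightarrow> c * cmod z ^ degree U \<le> cmod (poly U z)"
    using poly_lower_bound[OF \<open>U \<noteq> 0\<close>] by blast
  obtain Cv where Cv: "0 < Cv" "\<And>z. 1 \<le> cmod z \<Longrightarrow> cmod (poly V z) \<le> Cv * cmod z ^ degree V"
    using poly_upper_bound by blast
  obtain Cw where Cw: "0 < Cw" "\<And>z. 1 \<le> cmod z \<Longrightarrow> cmod (poly W z) \<le> Cw * cmod z ^ degree W"
    using poly_upper_bound by blast
  \<comment> \<open>Half the leading modulus: the leading term contributes
    \<open>2 * \<beta> * t ^ n\<close>, and for large \<open>t\<close> the lower terms use up at
    most \<open>\<beta> * t ^ n\<close>.\<close>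
  define \<beta> where "\<beta> = cmod b / 2"
  have \<beta>: "0 < \<beta>" using b by (simp add: \<beta>_def)
  define k where "k = max (degree V) (degree W)"
  have key: "eventually (\<lambda>t. 1 \<le> (Cv + Cw) / (c * \<beta> ^ k) * ((\<beta> * t) ^ k / exp (\<beta> * t))) at_top"
    using eventually_ge_at_top[of "max R (max 1 (max (C1 / \<beta>) (C2 / \<beta>)))"]
  proof eventually_elim
    case (elim t)
    then have t: "R \<le> t" "1 \<le> t" "C1 \<le> \<beta> * t" "C2 \<le> \<beta> * t" using \<beta> by (auto simp: field_simps)
    let ?z = "of_real t * u"
    have z: "cmod ?z = t" using t u1 by (simp add: norm_mult)
    have tn: "t * t ^ (n - 1) = t ^ n" using n by (cases n) auto
    have ub: "u ^ n * b = of_real (cmod b)" using b u by simp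
    have x: "C * t ^ (n - 1) \<le> \<beta> * t ^ n" if "C \<le> \<beta> * t" for C
    proof -
      have "C * t ^ (n - 1) \<le> (\<beta> * t) * t ^ (n - 1)" using that t(2) by (intro mult_right_mono) auto
      then show ?thesis by (simp only: mult.assoc tn)
    qed
    have Re_b: "Re (of_real t ^ n * of_real (cmod b)) = 2 * (\<beta> * t ^ n)"
      by (simp add: \<beta>_def flip: of_real_power of_real_mult)
    have "cmod (poly P ?z - of_real t ^ n * of_real (cmod b)) \<le> \<beta> * t ^ n"
      using order_trans[OF C1[OF t(2)] x[OF t(3)]] by (simp only: b(1) ub)
    then have "\<bar>Re (poly P ?z) - 2 * (\<beta> * t ^ n)\<bar> \<le> \<beta> * t ^ n"
      using abs_Re_le_cmod[of "poly P ?z - of_real t ^ n * of_real (cmod b)"] by (simp only: minus_complex.sel Re_b)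
    then have P: "\<beta> * t ^ n \<le> Re (poly P ?z)" by linarith
    have "cmod (poly Q ?z + of_real t ^ n * of_real (cmod b)) \<le> \<beta> * t ^ n"
      using order_trans[OF C2[OF t(2)] x[OF t(4)]] by (simp only: b(2) mult_minus_right ub diff_minus_eq_add)
    then have "\<bar>Re (poly Q ?z) + 2 * (\<beta> * t ^ n)\<bar> \<le> \<beta> * t ^ n"
      using abs_Re_le_cmod[of "poly Q ?z + of_real t ^ n * of_real (cmod b)"] by (simp only: plus_complex.sel Re_b)
    then have "Re (poly Q ?z) \<le> - (\<beta> * t ^ n)" by linarith
    also have "\<dots> \<le> 0" using \<beta> t by simp
    finally have Q: "Re (poly Q ?z) \<le> 0" .
    have "t ^ 1 \<le> t ^ n" using t n by (intro power_increasing) auto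
    then have "\<beta> * t \<le> \<beta> * t ^ n" using \<beta> by simp
    then have "exp (\<beta> * t) \<le> exp (Re (poly P ?z))" using P by simp
    moreover have "c \<le> cmod (poly U ?z)"
    proof -
      have "c * 1 \<le> c * t ^ degree U" using c t by (intro mult_left_mono) auto
      then show ?thesis using c(2)[of ?z] z t by simp
    qed
    ultimately have "c * exp (\<beta> * t) \<le> cmod (poly U ?z) * exp (Re (poly P ?z))"
      using c by (intro mult_mono) auto
    also have "\<dots> = cmod (poly V ?z * exp (poly Q ?z) + poly W ?z)" by (simp add: eq[symmetric] norm_mult)
    also have "\<dots> \<le> cmod (poly V ?z) * exp (Re (poly Q ?z)) + cmod (poly W ?z)"
      using norm_triangle_ineq[of "poly V ?z * exp (poly Q ?z)"] by (simp add: norm_mult)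
    also have "\<dots> \<le> cmod (poly V ?z) * 1 + cmod (poly W ?z)" using Q by (intro add_right_mono mult_left_mono) auto
    also have "\<dots> \<le> Cv * t ^ degree V + Cw * t ^ degree W" using Cv(2)[of ?z] Cw(2)[of ?z] z t by simp
    also have "\<dots> \<le> Cv * t ^ k + Cw * t ^ k"
      using Cv Cw t by (intro add_mono mult_left_mono power_increasing) (auto simp: k_def)
    finally have "c * exp (\<beta> * t) \<le> (Cv + Cw) * t ^ k" by (simp add: distrib_right)
    then have "1 \<le> (Cv + Cw) * t ^ k / (c * exp (\<beta> * t))" using c by (simp add: le_divide_eq)
    also have "\<dots> = (Cv + Cw) / (c * \<beta> ^ k) * ((\<beta> * t) ^ k / exp (\<beta> * t))"
      using \<beta> by (simp add: power_mult_distrib)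
    finally show ?case .
  qed
  have "((\<lambda>s. s ^ k / exp s) \<longlongrightarrow> 0) (at_top :: real filter)" by (rule tendsto_power_div_exp_0)
  moreover have "filterlim (\<lambda>t. \<beta> * t) at_top at_top"
    using \<beta> by (intro filterlim_tendsto_pos_mult_at_top[OF tendsto_const] filterlim_ident)
  ultimately have "((\<lambda>t. (\<beta> * t) ^ k / exp (\<beta> * t)) \<longlongrightarrow> 0) at_top" by (rule filterlim_compose)
  then have "((\<lambda>t. (Cv + Cw) / (c * \<beta> ^ k) * ((\<beta> * t) ^ k / exp (\<beta> * t))) \<longlongrightarrow> (Cv + Cw) / (c * \<beta> ^ k) * 0) at_top"
    by (intro tendsto_intros)
  then have "(1::real) \<le> (Cv + Cw) / (c * \<beta> ^ k) * 0" by (rule tendsto_lowerbound[OF _ key]) simp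
  then show False by simp
qed

text \<open>If the degree were \<open>n \<ge> 2\<close>, the forward and backward differences of
  \<open>g\<close> would have degree \<open>n - 1 \<ge> 1\<close> and opposite leading coefficients,
  as excluded along a ray.\<close>

lemma shift_difference_exponent_linear:
  fixes g U V W :: "complex poly"
  assumes eq: "\<And>z. poly U z * exp (poly g (z + 1) - poly g z) = poly V z * exp (poly g (z - 1) - poly g z) + poly W z"
    and "U \<noteq> 0"
  shows "degree g \<le> 1"
proof (rule ccontr)
  assume "\<not> degree g \<le> 1"
  then obtain m where m: "degree g = Suc (Suc m)" by (metis One_nat_def less_eq_Suc_le not_less nat.exhaust order_refl zero_le)
  define S where "S = (\<lambda>a. pcompose g [:a, 1:] - g)"
  have cS: "coeff (S a) (Suc m) = of_nat (Suc (Suc m)) * a * lead_coeff g" for a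
    using coeff_pcompose_shift_subtop[of g "Suc m" a] m by (simp add: S_def)
  have dS: "degree (S a) \<le> Suc m" for a
  proof (rule degree_le, intro allI impI)
    fix i assume "Suc m < i"
    then have "degree g \<le> i" using m by simp
    then show "coeff (S a) i = 0" using coeff_pcompose_shift_top[of g i a] by (simp add: S_def)
  qed
  have "g \<noteq> 0" using m by auto
  then have "lead_coeff g \<noteq> 0" by simp
  then have nz: "of_nat (Suc (Suc m)) * 1 * lead_coeff g \<noteq> 0" by (simp only: mult_1_right mult_eq_0_iff of_nat_eq_0_iff) simp
  have p: "poly (S a) z = poly g (z + a) - poly g z" for a z by (simp add: S_def poly_pcompose add.commute)
  show False
  proof (rule exp_poly_ray_contradiction[OF _ \<open>U \<noteq> 0\<close> zero_less_Suc dS dS cS _ nz])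
    show "poly U z * exp (poly (S 1) z) = poly V z * exp (poly (S (-1)) z) + poly W z" for z
      using eq[of z] by (simp add: p)
    show "coeff (S (-1)) (Suc m) = - (of_nat (Suc (Suc m)) * 1 * lead_coeff g)" by (simp add: cS algebra_simps)
  qed
qed

text \<open>For positive degree the shift changes the coefficient just below the leading
  one.\<close>

lemma shift_eq_imp_const:
  fixes D :: "'a::{idom,ring_char_0} poly"
  assumes "pcompose D [:a, 1:] = D" "a \<noteq> 0"
  shows "degree D = 0"
proof (rule ccontr)
  assume "degree D \<noteq> 0"
  then obtain m where m: "degree D = Suc m" by (cases "degree D") auto
  then have "of_nat (Suc m) * a * lead_coeff D = 0"
    using coeff_pcompose_shift_subtop[of D m a] assms(1) by simp
  moreover have "D \<noteq> 0" using m by auto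
  ultimately show False using assms(2) by (auto simp del: of_nat_Suc)
qed

text \<open>The left side has degree at most that of \<open>H\<close>, so \<open>p\<close> is
  constant, and the leading coefficient determines it. If \<open>H\<close> is not constant, the next
  coefficient gives \<open>E + 1 / E = 0\<close>.\<close>

lemma shift_combination_eq_mult:
  fixes H p :: "complex poly" and E :: complex
  assumes eq: "smult E (pcompose H [:1, 1:]) - smult (1 / E) (pcompose H [:-1, 1:]) = p * H"
    and H: "H \<noteq> 0" and E: "E \<noteq> 0"
  shows "p = [:E - 1 / E:]" and "degree H \<noteq> 0 \<Longrightarrow> E = \<i> \<or> E = - \<i>"
proof -
  have "degree (p * H) \<le> degree H"
  proof (rule degree_le, intro allI impI)
    fix i assume i: "degree H < i"
    then have "coeff H i = 0" by (rule coeff_eq_0)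
    then show "coeff (p * H) i = 0"
      using coeff_pcompose_shift_top[of H i 1] coeff_pcompose_shift_top[of H i "-1"] i unfolding eq[symmetric] by simp
  qed
  then have "p = 0 \<or> degree p = 0" using H by (metis add_le_same_cancel2 degree_mult_eq le_zero_eq)
  then have "degree p = 0" by auto
  then obtain c where c: "p = [:c:]" by (metis degree_0_id)
  have lead: "lead_coeff H \<noteq> 0" using H by simp
  have "coeff (p * H) (degree H) = (E - 1 / E) * lead_coeff H"
    using coeff_pcompose_shift_top[of H "degree H" 1] coeff_pcompose_shift_top[of H "degree H" "-1"]
    unfolding eq[symmetric] by (simp add: algebra_simps)
  then have "c * lead_coeff H = (E - 1 / E) * lead_coeff H" by (simp add: c)
  then have cE: "c = E - 1 / E" using lead by simp
  show "p = [:E - 1 / E:]" using c cE by simp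
  assume "degree H \<noteq> 0"
  then obtain m where m: "degree H = Suc m" by (cases "degree H") auto
  have "coeff (p * H) m = E * (coeff H m + of_nat (Suc m) * lead_coeff H) - 1 / E * (coeff H m - of_nat (Suc m) * lead_coeff H)"
  proof -
    have h: "coeff (pcompose H [:1, 1:]) m = coeff H m + of_nat (Suc m) * lead_coeff H"
      "coeff (pcompose H [:-1, 1:]) m = coeff H m - of_nat (Suc m) * lead_coeff H"
      using coeff_pcompose_shift_subtop[of H m 1] coeff_pcompose_shift_subtop[of H m "-1"] m
      by (auto simp del: of_nat_Suc)
    show ?thesis unfolding eq[symmetric] coeff_diff coeff_smult h ..
  qed
  then have "(E - 1 / E) * coeff H m = E * (coeff H m + of_nat (Suc m) * lead_coeff H) - 1 / E * (coeff H m - of_nat (Suc m) * lead_coeff H)"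
    by (simp add: c cE)
  then have "(E + 1 / E) * (of_nat (Suc m) * lead_coeff H) = 0" by (simp add: algebra_simps)
  then have "E + 1 / E = 0" using lead by (simp only: mult_eq_0_iff of_nat_eq_0_iff) auto
  then have "E * E + 1 = 0" using E by (simp add: field_simps)
  then have "(E - \<i>) * (E + \<i>) = 0" by (simp add: algebra_simps)
  then show "E = \<i> \<or> E = - \<i>" by (auto simp: eq_neg_iff_add_eq_0)
qed

text \<open>The hypothesis says that the first difference of \<open>H\<close> is invariant under a
  shift and hence constant.\<close>

lemma second_difference_0_imp_degree_le_1:
  fixes H :: "complex poly"
  assumes "pcompose H [:1, 1:] + pcompose H [:-1, 1:] = smult 2 H"
  shows "degree H \<le> 1"
proof (rule ccontr)
  assume "\<not> degree H \<le> 1"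
  then obtain m where m: "degree H = Suc (Suc m)" by (metis One_nat_def less_eq_Suc_le not_less nat.exhaust order_refl zero_le)
  define D where "D = pcompose H [:1, 1:] - H"
  have "pcompose (pcompose H [:1, 1:]) [:-1, 1:] = H"
    by (simp add: pcompose_assoc[symmetric] pcompose_pCons)
  then have "pcompose D [:-1, 1:] = H - pcompose H [:-1, 1:]" by (simp add: D_def pcompose_diff)
  also have "\<dots> = D"
  proof -
    have "smult (1 + 1) H = H + H" by (simp only: smult_add_left smult_1_left)
    then have "smult 2 H = H + H" by (simp only: one_add_one)
    then show ?thesis using assms by (simp add: D_def algebra_simps)
  qed
  finally have "degree D = 0" by (rule shift_eq_imp_const) simp
  then have "coeff D (Suc m) = 0" by (simp add: coeff_eq_0)
  moreover have "coeff D (Suc m) = of_nat (Suc (Suc m)) * lead_coeff H"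
    using coeff_pcompose_shift_subtop[of H "Suc m" 1] m by (simp add: D_def)
  ultimately have "lead_coeff H = 0" by (simp only: mult_eq_0_iff of_nat_eq_0_iff) simp
  moreover have "H \<noteq> 0" using m by auto
  ultimately show False by simp
qed

lemma poly_primitive:
  fixes p :: "'a::field_char_0 poly"
  obtains P where "pderiv P = p"
proof
  show "pderiv (\<Sum>i\<le>degree p. monom (coeff p i / of_nat (Suc i)) (Suc i)) = p"
  proof (rule poly_eqI)
    fix n
    show "coeff (pderiv (\<Sum>i\<le>degree p. monom (coeff p i / of_nat (Suc i)) (Suc i))) n = coeff p n"
      by (simp add: coeff_pderiv coeff_sum coeff_monom coeff_eq_0 del: of_nat_Suc)
  qed
qed

section \<open>Shifts of the exponent\<close>

text \<open>The fraction \<open>1 / 4\<close> is what survives of the mean of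
  \<open>\<bar>Re g\<bar>\<close> once the shift terms have been subtracted.\<close>

lemma eventually_ln_less_linear: "eventually (\<lambda>x::real. a + b * ln x < x / 4) at_top"
proof -
  have "((\<lambda>x::real. a * inverse x + b * (ln x / x)) \<longlongrightarrow> a * 0 + b * 0) at_top"
    by (intro tendsto_intros ln_x_over_x_tendsto_0 tendsto_inverse_0_at_top filterlim_ident)
  then have "eventually (\<lambda>x. a * inverse x + b * (ln x / x) < 1 / 4) at_top"
    by (rule order_tendstoD) simp
  then show ?thesis using eventually_gt_at_top[of 0]
    by eventually_elim (simp add: field_simps)
qed

text \<open>Admitting all larger constants and exponents lets several polynomials share one common
  pair.\<close>

lemma poly_growth_bound:
  fixes p :: "complex poly"
  shows "\<exists>K k. \<forall>K' k' r z. K \<le> K' \<longrightarrow> k \<le> k' \<longrightarrow> 1 \<le> r \<longrightarrow> cmod z = r \<longrightarrow> cmod (poly p z) \<le> K' * r ^ k'"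
proof -
  obtain C where C: "0 < C" "\<And>z. 1 \<le> cmod z \<Longrightarrow> cmod (poly p z) \<le> C * cmod z ^ degree p"
    using poly_upper_bound by blast
  have "cmod (poly p z) \<le> K' * r ^ k'" if "C \<le> K'" "degree p \<le> k'" "1 \<le> r" "cmod z = r" for K' k' r z
  proof -
    have "C * r ^ degree p \<le> K' * r ^ k'" using that C(1) by (intro mult_mono power_increasing) auto
    then show ?thesis using C(2)[of z] that by simp
  qed
  then show ?thesis by blast
qed

text \<open>Two upper bounds for \<open>ln (cmod (R z))\<close>, by \<open>Re (g z)\<close> plus
  shift terms through \<open>F\<close> and by \<open>ln B\<close> through the definition of
  \<open>R\<close>, meet Jensen's lower bound for its mean. Together they bound the mean of the
  negative part of \<open>Re g\<close>.\<close>

lemma exp_shift_polynomial_small_imp_False: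
  fixes X Y Z p s :: "complex poly"
  assumes g: "g holomorphic_on UNIV" and nc: "g z1 \<noteq> g 0"
    and growth: "eventually (\<lambda>r. circle_mean r (\<lambda>z. \<bar>Re (g z)\<bar>) \<le> exp (C * r powr \<mu>)) at_top" and \<mu>: "0 < \<mu>" "\<mu> < 1"
    and R: "\<And>z. R z = poly p z + poly s z * deriv g z"
    and F: "\<And>z. R z = exp (g z) * (poly X z * exp (g (z + 1) - g z) + poly Y z * exp (g (z - 1) - g z) + poly Z z)"
    and nz: "R z0 \<noteq> 0"
  shows False
proof -
  define P where "P = (\<lambda>r. circle_mean r (\<lambda>z. \<bar>Re (g z)\<bar>))"
  have cg: "continuous_on A g" for A using g holomorphic_on_imp_continuous_on continuous_on_subset by blast
  have hg: "g holomorphic_on A" for A using g holomorphic_on_subset by blast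
  have Rhol: "R holomorphic_on UNIV"
    unfolding R[abs_def] by (intro holomorphic_intros g) auto
  obtain CJ where CJ: "\<And>r. 1 \<le> r \<Longrightarrow> (\<And>z. cmod z = r \<Longrightarrow> R z \<noteq> 0) \<Longrightarrow> - CJ \<le> circle_mean r (\<lambda>z. ln (cmod (R z)))"
    using jensen_lower_bound[OF Rhol nz] by blast
  have z1: "cmod z1 > 0" using nc by auto
  define \<kappa> where "\<kappa> = cmod (g z1 - g 0) / (4 * cmod z1)"
  have \<kappa>: "0 < \<kappa>" using nc z1 by (simp add: \<kappa>_def)
  \<comment> \<open>The Schwarz bound at the fixed point \<open>z1\<close>, read as a lower bound:
    the mean grows at least linearly.\<close>
  have Plow: "\<kappa> * r \<le> P r" if r: "2 * cmod z1 < r" for r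
  proof -
    have lt: "cmod z1 < r" using r z1 by linarith
    have "cmod (g z1 - g 0) \<le> 2 * cmod z1 / (r - cmod z1) * P r"
      unfolding P_def by (intro Schwarz_bound hg lt)
    then have "cmod (g z1 - g 0) * (r - cmod z1) \<le> 2 * cmod z1 * P r"
      using r z1 by (simp add: field_simps)
    moreover have "cmod (g z1 - g 0) * (r / 2) \<le> cmod (g z1 - g 0) * (r - cmod z1)"
      using r by (intro mult_left_mono) auto
    ultimately have "cmod (g z1 - g 0) * r \<le> 4 * cmod z1 * P r" by simp
    then show ?thesis using z1 by (simp add: \<kappa>_def field_simps)
  qed
  \<comment> \<open>Each zero of \<open>R\<close> excludes countably many offsets, so some offset
    keeps all circles of the progression free of zeros, as Jensen's inequality requires.\<close>
  obtain r0 where r0: "0 < r0" "\<And>n z. cmod z = r0 + real n * 33 \<Longrightarrow> R z \<noteq> 0"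
  proof -
    have cz: "countable {z. R z = 0}" by (rule entire_countable_zeros[OF Rhol nz])
    have "countable (\<Union>n::nat. (\<lambda>z. cmod z - real n * 33) ` {z. R z = 0})" using cz by (intro countable_UN countable_image) auto
    moreover have "uncountable {0<..<1::real}" by (simp add: uncountable_open_interval)
    ultimately have "\<not> {0<..<1} \<subseteq> (\<Union>n::nat. (\<lambda>z. cmod z - real n * 33) ` {z. R z = 0})" using countable_subset by blast
    then obtain x where x: "x \<in> {0<..<1}" "x \<notin> (\<Union>n::nat. (\<lambda>z. cmod z - real n * 33) ` {z. R z = 0})" by blast
    show ?thesis
    proof (rule that)
      show "0 < x" using x by simp
      fix n z assume "cmod z = x + real n * 33"
      then have "x = cmod z - real n * 33" by simp
      then show "R z \<noteq> 0" using x(2) by blast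
    qed
  qed
  define \<rho> where "\<rho> = (\<lambda>n. r0 + real n * 33)"
  have \<rho>: "filterlim \<rho> at_top sequentially" unfolding \<rho>_def
    by (intro filterlim_tendsto_add_at_top[OF tendsto_const] filterlim_at_top_mult_tendsto_pos[OF tendsto_const] filterlim_real_sequentially) simp
  have Plim: "filterlim (\<lambda>n. P (\<rho> n)) at_top sequentially"
  proof (rule filterlim_at_top_mono)
    show "filterlim (\<lambda>n. \<kappa> * \<rho> n) at_top sequentially"
      using \<kappa> \<rho> by (intro filterlim_tendsto_pos_mult_at_top[OF tendsto_const])
    show "eventually (\<lambda>n. \<kappa> * \<rho> n \<le> P (\<rho> n)) sequentially"
      using eventually_compose_filterlim[OF eventually_gt_at_top[of "2 * cmod z1"] \<rho>] by eventually_elim (rule Plow)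
  qed
  obtain KX kX where KX: "\<And>K k r z. KX \<le> K \<Longrightarrow> kX \<le> k \<Longrightarrow> 1 \<le> r \<Longrightarrow> cmod z = r \<Longrightarrow> cmod (poly X z) \<le> K * r ^ k"
    using poly_growth_bound[of X] by blast
  obtain KY kY where KY: "\<And>K k r z. KY \<le> K \<Longrightarrow> kY \<le> k \<Longrightarrow> 1 \<le> r \<Longrightarrow> cmod z = r \<Longrightarrow> cmod (poly Y z) \<le> K * r ^ k"
    using poly_growth_bound[of Y] by blast
  obtain KZ kZ where KZ: "\<And>K k r z. KZ \<le> K \<Longrightarrow> kZ \<le> k \<Longrightarrow> 1 \<le> r \<Longrightarrow> cmod z = r \<Longrightarrow> cmod (poly Z z) \<le> K * r ^ k"
    using poly_growth_bound[of Z] by blast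
  obtain Kp kp where Kp: "\<And>K k r z. Kp \<le> K \<Longrightarrow> kp \<le> k \<Longrightarrow> 1 \<le> r \<Longrightarrow> cmod z = r \<Longrightarrow> cmod (poly p z) \<le> K * r ^ k"
    using poly_growth_bound[of p] by blast
  obtain Ks ks where Ks: "\<And>K k r z. Ks \<le> K \<Longrightarrow> ks \<le> k \<Longrightarrow> 1 \<le> r \<Longrightarrow> cmod z = r \<Longrightarrow> cmod (poly s z) \<le> K * r ^ k"
    using poly_growth_bound[of s] by blast
  define K where "K = Max {1, KX, KY, KZ, Kp, Ks}"
  define k where "k = Max {kX, kY, kZ, kp, ks}"
  have Kge: "1 \<le> K" "KX \<le> K" "KY \<le> K" "KZ \<le> K" "Kp \<le> K" "Ks \<le> K" unfolding K_def by (auto intro!: Max_ge)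
  have kge: "kX \<le> k" "kY \<le> k" "kZ \<le> k" "kp \<le> k" "ks \<le> k" unfolding k_def by (auto intro!: Max_ge)
  define c1 where "c1 = ln (3 * K) + ln (2 * K) + CJ + \<bar>Re (g 0)\<bar> - (2 * real k + 1) * ln \<kappa>"
  \<comment> \<open>The step 33 is what makes the two shift differences together contribute at most \<open>P r / 4\<close>.\<close>
  have step: "P r / 4 \<le> c1 + (2 * real k + 2) * ln (P r)"
    if r: "1 \<le> r" "2 * cmod z1 < r" and P1: "1 \<le> P r" and dbl: "P (r + 33) \<le> 2 * P r" and Rz: "\<And>z. cmod z = r \<Longrightarrow> R z \<noteq> 0" for r
  proof -
    \<comment> \<open>A bound for \<open>R\<close> that is linear in \<open>P r\<close>, so that its
      logarithm costs only \<open>ln (P r)\<close>. \<open>Q\<close> below bounds the three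
      polynomial coefficients in \<open>F\<close> together.\<close>
    define B where "B = 2 * K * r ^ Suc k * P r"
    define Q where "Q = 3 * K * r ^ k"
    have rk: "1 \<le> r ^ k" "1 \<le> r ^ Suc k" by (rule one_le_power[OF r(1)])+
    have Q1: "1 \<le> Q" using Kge(1) mult_mono[OF Kge(1) rk(1)] by (simp add: Q_def)
    have B1: "1 \<le> B"
      using mult_mono[OF mult_mono[OF Kge(1) rk(2)] P1] Kge(1) P1 r unfolding B_def by simp
    have Rle: "cmod (R z) \<le> B" if z: "cmod z = r" for z
    proof -
      \<comment> \<open>Cauchy's estimate on a unit circle, whose points keep distance at least 32
        from the circle of radius \<open>r + 33\<close> where doubling applies.\<close>
      have "cmod ((deriv ^^ 1) (\<lambda>u. g u - g 0) z) \<le> fact 1 * (r * P r) / 1 ^ 1"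
      proof (rule Cauchy_inequality)
        show "(\<lambda>u. g u - g 0) holomorphic_on ball z 1" by (intro holomorphic_intros hg)
        show "continuous_on (cball z 1) (\<lambda>u. g u - g 0)" by (intro continuous_intros cg)
        fix u assume "cmod (z - u) = 1"
        then have u: "cmod u \<le> r + 1" using z norm_triangle_sub[of u z] by (simp add: norm_minus_commute)
        have "cmod (g u - g 0) \<le> 2 * cmod u / (r + 33 - cmod u) * P (r + 33)"
          unfolding P_def using u by (intro Schwarz_bound hg) auto
        also have "\<dots> \<le> 2 * (r + 1) / 32 * (2 * P r)"
        proof (intro mult_mono dbl frac_le)
          show "0 \<le> P (r + 33)" unfolding P_def using r by (intro circle_mean_nonneg continuous_intros cg) auto
        qed (use u r in auto)
        also have "\<dots> = (r + 1) / 8 * P r" by simp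
        also have "\<dots> \<le> r * P r" using r P1 by (intro mult_right_mono) auto
        finally show "cmod (g u - g 0) \<le> r * P r" .
      qed simp
      moreover have "deriv (\<lambda>u. g u - g 0) z = deriv g z"
        using holomorphic_on_imp_differentiable_at[OF g, of z] by simp
      ultimately have g': "cmod (deriv g z) \<le> r * P r" by simp
      have "cmod (R z) \<le> cmod (poly p z) + cmod (poly s z) * cmod (deriv g z)"
        unfolding R by (metis norm_mult norm_triangle_ineq)
      also have "\<dots> \<le> K * r ^ k + (K * r ^ k) * (r * P r)"
        using Kp[OF Kge(5) kge(4) r(1) z] Ks[OF Kge(6) kge(5) r(1) z] g' Kge(1) r
        by (intro add_mono mult_mono) auto
      also have "\<dots> \<le> (K * r ^ k) * (r * P r) + (K * r ^ k) * (r * P r)"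
        using mult_mono[OF r(1) P1] mult_left_mono[of 1 "r * P r" "K * r ^ k"] Kge(1) r
        by (intro add_right_mono) simp
      finally show ?thesis by (simp add: B_def mult_ac)
    qed
    define d1 d2 where "d1 = (\<lambda>z. cmod (g (z + 1) - g z))" and "d2 = (\<lambda>z. cmod (g (z + - 1) - g z))"
    have d0: "0 \<le> d1 z" "0 \<le> d2 z" for z by (simp_all add: d1_def d2_def)
    have cd: "continuous_on (sphere 0 r) d1" "continuous_on (sphere 0 r) d2" unfolding d1_def d2_def
      by (intro continuous_intros continuous_on_compose2[OF cg[of UNIV]]; simp)+
    have cR: "continuous_on (sphere 0 r) (\<lambda>z. ln (cmod (R z)))"
      using Rz Rhol by (intro continuous_intros) (auto intro: holomorphic_on_imp_continuous_on holomorphic_on_subset)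
    \<comment> \<open>The bound \<open>ln B\<close> handles the value \<open>0\<close> of the
      maximum, and the bound through \<open>exp (g z)\<close> handles
      \<open>- Re (g z)\<close>.\<close>
    have pt: "max 0 (Re (- g z)) \<le> (ln Q + ln B + d1 z + d2 z) - ln (cmod (R z))" if z: "cmod z = r" for z
    proof -
      have e1: "exp (Re (g (z + 1) - g z)) \<le> exp (d1 z + d2 z)"
        using complex_Re_le_cmod[of "g (z + 1) - g z"] d0(2)[of z] unfolding exp_le_cancel_iff d1_def by linarith
      have e2: "exp (Re (g (z - 1) - g z)) \<le> exp (d1 z + d2 z)"
        using complex_Re_le_cmod[of "g (z - 1) - g z"] d0(1)[of z] unfolding exp_le_cancel_iff d2_def by simp
      have e3: "1 \<le> exp (d1 z + d2 z)" using d0[of z] by simp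
      have "cmod (poly X z * exp (g (z + 1) - g z) + poly Y z * exp (g (z - 1) - g z) + poly Z z)
          \<le> cmod (poly X z) * exp (Re (g (z + 1) - g z)) + cmod (poly Y z) * exp (Re (g (z - 1) - g z)) + cmod (poly Z z) * 1"
        by (rule order_trans[OF norm_triangle_le[OF add_right_mono[OF norm_triangle_ineq]]]) (auto simp: norm_mult)
      also have "\<dots> \<le> (K * r ^ k) * exp (d1 z + d2 z) + (K * r ^ k) * exp (d1 z + d2 z) + (K * r ^ k) * exp (d1 z + d2 z)"
        using KX[OF Kge(2) kge(1) r(1) z] KY[OF Kge(3) kge(2) r(1) z] KZ[OF Kge(4) kge(3) r(1) z] Kge(1) r e1 e2 e3
        by (intro add_mono mult_mono) auto
      also have "\<dots> = Q * exp (d1 z + d2 z)" by (simp add: Q_def)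
      finally have "cmod (R z) \<le> exp (Re (g z)) * (Q * exp (d1 z + d2 z))"
        unfolding F norm_mult norm_exp_eq_Re by (intro mult_left_mono) auto
      then have "ln (cmod (R z)) \<le> ln (exp (Re (g z)) * (Q * exp (d1 z + d2 z)))"
        using Rz[OF z] Q1 by (subst ln_le_cancel_iff) auto
      also have "\<dots> = Re (g z) + (ln Q + (d1 z + d2 z))" using Q1 by (simp add: ln_mult)
      finally have 1: "ln (cmod (R z)) \<le> Re (g z) + (ln Q + (d1 z + d2 z))" .
      have 2: "ln (cmod (R z)) \<le> ln B" using Rle[OF z] Rz[OF z] B1 by (subst ln_le_cancel_iff) auto
      have "0 \<le> ln Q" "0 \<le> ln B" using Q1 B1 by auto
      then show ?thesis using 1 2 d0[of z] by simp
    qed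
    have sh: "circle_mean r (\<lambda>z. cmod (g (z + h) - g z)) \<le> P r / 8" if h: "cmod h = 1" for h
    proof -
      have "circle_mean r (\<lambda>z. cmod (g (z + h) - g z)) \<le> 2 * (r + 33) / ((r + 33 - 1)\<^sup>2 - r\<^sup>2) * P (r + 33)"
        unfolding P_def using r by (intro circle_mean_shift_diff hg h) auto
      also have "(r + 33 - 1)\<^sup>2 - r\<^sup>2 = 32 * (2 * r + 32)" by (simp add: power2_eq_square algebra_simps)
      \<comment> \<open>The kernel factor is at most \<open>1 / 16\<close> precisely from
        \<open>r = 1\<close> on; doubling makes it \<open>1 / 8\<close> for each shift.\<close>
      also have "2 * (r + 33) / (32 * (2 * r + 32)) * P (r + 33) \<le> 1 / 16 * (2 * P r)"
      proof (intro mult_mono dbl)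
        show "2 * (r + 33) / (32 * (2 * r + 32)) \<le> 1 / 16" using r by (simp add: field_simps)
        show "0 \<le> P (r + 33)" unfolding P_def using r by (intro circle_mean_nonneg continuous_intros cg) auto
      qed auto
      finally show ?thesis by simp
    qed
    \<comment> \<open>Applied to \<open>- g\<close>, because it is the decay of
      \<open>exp (g z)\<close> that the lower bound for \<open>R\<close> limits.\<close>
    have "P r = 2 * circle_mean r (\<lambda>z. max 0 (Re (- g z))) - Re (- g 0)"
      using circle_mean_abs_Re[of "\<lambda>z. - g z" r] r holomorphic_on_minus[OF hg] by (simp add: P_def)
    also have "circle_mean r (\<lambda>z. max 0 (Re (- g z))) \<le> circle_mean r (\<lambda>z. (ln Q + ln B + d1 z + d2 z) - ln (cmod (R z)))"
      using r pt by (intro circle_mean_mono continuous_intros cg cd cR) auto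
    also have "\<dots> = ln Q + ln B + circle_mean r d1 + circle_mean r d2 - circle_mean r (\<lambda>z. ln (cmod (R z)))"
      using r cd cR by (simp add: circle_mean_diff circle_mean_add continuous_on_add)
    also have "\<dots> \<le> ln Q + ln B + P r / 8 + P r / 8 + CJ"
      using sh[of 1] sh[of "-1"] CJ[OF r(1) Rz] by (simp add: d1_def d2_def)
    finally have "P r / 4 \<le> ln Q + ln B + CJ + \<bar>Re (g 0)\<bar>" by simp
    also have "ln Q = ln (3 * K) + k * ln r" using Kge(1) r by (simp add: Q_def ln_mult ln_realpow)
    also have "ln B = ln (2 * K) + Suc k * ln r + ln (P r)"
    proof -
      have "ln B = ln (2 * K * r ^ Suc k) + ln (P r)" unfolding B_def using Kge(1) r P1 by (intro ln_mult_pos) auto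
      also have "ln (2 * K * r ^ Suc k) = ln (2 * K) + ln (r ^ Suc k)" using Kge(1) r by (intro ln_mult_pos) auto
      finally show ?thesis using r by (simp add: ln_realpow del: power_Suc)
    qed
    finally have "P r / 4 \<le> ln (3 * K) + ln (2 * K) + CJ + \<bar>Re (g 0)\<bar> + (2 * real k + 1) * ln r + ln (P r)"
      by (simp add: algebra_simps)
    \<comment> \<open>The linear lower bound for \<open>P\<close> turns \<open>ln r\<close> into
      \<open>ln (P r)\<close>, so that only \<open>P r\<close> and its logarithm are
      compared.\<close>
    moreover have "(2 * real k + 1) * ln r \<le> (2 * real k + 1) * (ln (P r) - ln \<kappa>)"
    proof (intro mult_left_mono)
      have "ln (\<kappa> * r) \<le> ln (P r)" using Plow[OF r(2)] \<kappa> r P1 by (subst ln_le_cancel_iff) auto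
      then show "ln r \<le> ln (P r) - ln \<kappa>" using \<kappa> r by (simp add: ln_mult)
    qed auto
    ultimately show ?thesis by (simp add: c1_def algebra_simps)
  qed
  have "\<exists>\<^sub>F n in sequentially. P (\<rho> (Suc n)) \<le> 2 * P (\<rho> n)"
  proof (rule frequently_doubling)
    show "eventually (\<lambda>n. 0 < P (\<rho> n)) sequentially"
      using Plim[unfolded filterlim_at_top_dense] by blast
    show "eventually (\<lambda>n. P (\<rho> n) \<le> exp (C * (r0 + real n * 33) powr \<mu>)) sequentially"
      using eventually_compose_filterlim[OF growth \<rho>] by (simp add: P_def \<rho>_def)
  qed (use \<mu> in auto)
  moreover have "eventually (\<lambda>n. 1 \<le> \<rho> n \<and> 2 * cmod z1 < \<rho> n \<and> 1 \<le> P (\<rho> n) \<and> c1 + (2 * real k + 2) * ln (P (\<rho> n)) < P (\<rho> n) / 4) sequentially"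
    by (intro eventually_conj eventually_compose_filterlim[OF eventually_ge_at_top \<rho>] eventually_compose_filterlim[OF eventually_gt_at_top \<rho>]
        eventually_compose_filterlim[OF eventually_ge_at_top Plim] eventually_compose_filterlim[OF eventually_ln_less_linear Plim])
  ultimately have "\<exists>\<^sub>F n in sequentially. P (\<rho> (Suc n)) \<le> 2 * P (\<rho> n) \<and> (1 \<le> \<rho> n \<and> 2 * cmod z1 < \<rho> n \<and> 1 \<le> P (\<rho> n) \<and> c1 + (2 * real k + 2) * ln (P (\<rho> n)) < P (\<rho> n) / 4)"
    by (rule frequently_eventually_frequently)
  then obtain n where n: "P (\<rho> (Suc n)) \<le> 2 * P (\<rho> n)" "1 \<le> \<rho> n" "2 * cmod z1 < \<rho> n" "1 \<le> P (\<rho> n)"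
      "c1 + (2 * real k + 2) * ln (P (\<rho> n)) < P (\<rho> n) / 4"
    using frequently_ex by blast
  have "\<rho> (Suc n) = \<rho> n + 33" by (simp add: \<rho>_def)
  then have dbl: "P (\<rho> n + 33) \<le> 2 * P (\<rho> n)" using n(1) by simp
  have "P (\<rho> n) / 4 \<le> c1 + (2 * real k + 2) * ln (P (\<rho> n))"
    by (rule step[OF n(2-4) dbl]) (use r0(2)[of _ n] in \<open>simp add: \<rho>_def\<close>)
  then show False using n(5) by linarith
qed

section \<open>Solutions of the equation\<close>

lemma transcendental_entire_not_poly:
  assumes "transcendental_entire w"
  shows "\<not> (\<exists>p. \<forall>z. w z = poly p z)"
proof
  assume "\<exists>p. \<forall>z. w z = poly p z"
  then obtain p where "\<And>z. w z = poly p z" by blast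
  then have "rational_function w" unfolding rational_function_def by (intro exI[of _ p] exI[of _ 1]) simp
  then show False using assms by (simp add: transcendental_entire_def)
qed

lemma deriv_eq_poly_imp_poly:
  assumes f: "f holomorphic_on UNIV" and d: "\<And>z. deriv f z = poly p z"
  shows "\<exists>P. \<forall>z. f z = poly P z"
proof -
  obtain P where P: "pderiv P = p" using poly_primitive by blast
  have "((\<lambda>z. f z - poly P z) has_field_derivative 0) (at z)" for z
  proof -
    have "((\<lambda>z. f z - poly P z) has_field_derivative deriv f z - poly (pderiv P) z) (at z)"
      using f by (intro derivative_intros holomorphic_derivI[of f UNIV]) auto
    then show ?thesis by (simp add: P d)
  qed
  then have "\<exists>c. \<forall>z. f z - poly P z = c" 
    using has_field_derivative_zero_constant[of UNIV "\<lambda>z. f z - poly P z"] by simp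
  then obtain c where "\<And>z. f z - poly P z = c" by blast
  then have "f z = poly (P + [:c:]) z" for z by (metis add.commute diff_add_cancel poly_add poly_const_conv)
  then show ?thesis by blast
qed

text \<open>The equalities are stated off the roots of \<open>q\<close>, where division by zero
  cannot interfere. The last conclusion links the pointwise condition on \<open>a\<close> to its
  numerator.\<close>

lemma rational_function_common_denominator:
  assumes "rational_function a" "rational_function b" "rational_function c"
  obtains q A B C where "q \<noteq> 0" "\<And>z. poly q z \<noteq> 0 \<Longrightarrow> poly q z * a z = poly A z \<and> poly q z * b z = poly B z \<and> poly q z * c z = poly C z"
    "A = 0 \<longleftrightarrow> (\<forall>z. a z = 0)"
proof -
  obtain pa qa where a: "qa \<noteq> 0" "\<And>z. a z = poly pa z / poly qa z" "coprime pa qa" using assms(1) unfolding rational_function_def by blast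
  obtain pb qb where b: "qb \<noteq> 0" "\<And>z. b z = poly pb z / poly qb z" using assms(2) unfolding rational_function_def by blast
  obtain pc qc where c: "qc \<noteq> 0" "\<And>z. c z = poly pc z / poly qc z" using assms(3) unfolding rational_function_def by blast
  show ?thesis
  proof (rule that[of "qa * qb * qc" "pa * qb * qc" "pb * qa * qc" "pc * qa * qb"])
    show "(pa * qb * qc = 0) \<longleftrightarrow> (\<forall>z. a z = 0)"
    proof
      assume z: "\<forall>z. a z = 0"
      \<comment> \<open>By the default value of division, \<open>a z = 0\<close> may also mean a
        pole; hence the product with the denominator.\<close>
      have "poly (pa * qa) z = 0" for z using z a(2)[of z] by auto
      then have "pa * qa = 0" using poly_all_0_iff_0 by blast
      then show "pa * qb * qc = 0" using a(1) by simp
    qed (use a b c in auto)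
  qed (use a b c in auto)
qed

lemma poly_eq_off_roots:
  fixes q :: "complex poly"
  assumes "q \<noteq> 0" "\<And>z. poly q z \<noteq> 0 \<Longrightarrow> poly A z = poly B z"
  shows "A = B"
proof -
  have "poly (q * (A - B)) z = 0" for z using assms(2)[of z] by auto
  then have "q * (A - B) = 0" using poly_all_0_iff_0 by blast
  then show ?thesis using assms(1) by simp
qed

text \<open>Multiplying by \<open>q * w\<close> clears all denominators off a sparse set. The
  product of \<open>q * w\<close> with the desired identity then vanishes everywhere by continuity,
  and \<open>q * w\<close> cancels because it is not identically zero.\<close>

lemma solves_equation_entire_identity:
  assumes w: "w holomorphic_on UNIV" "w z0 \<noteq> 0" and q: "q \<noteq> 0"
    and eq: "solves_equation a a0 a1 w"
    and den: "\<And>z. poly q z \<noteq> 0 \<Longrightarrow> poly q z * a z = poly A z \<and> poly q z * a0 z = poly A0 z \<and> poly q z * a1 z = poly A1 z"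
  shows "poly A z * deriv w z = w z * (poly A1 z * w z + poly A0 z - poly q z * (w (z + 1) - w (z - 1)))"
proof -
  have wc: "continuous_on S w" "w holomorphic_on S" for S
    using w(1) holomorphic_on_imp_continuous_on holomorphic_on_subset by blast+
  have wsh: "(\<lambda>z. w (z + 1)) holomorphic_on UNIV" "(\<lambda>z. w (z - 1)) holomorphic_on UNIV"
    by (rule holomorphic_on_compose_gen[OF _ w(1), unfolded o_def]; auto intro!: holomorphic_intros)+
  define G where "G = (\<lambda>z. poly A z * deriv w z - w z * (poly A1 z * w z + poly A0 z - poly q z * (w (z + 1) - w (z - 1))))"
  have G: "G holomorphic_on UNIV" unfolding G_def by (intro holomorphic_intros w(1) wsh) auto
  have qw: "(\<lambda>z. poly q z * w z) holomorphic_on UNIV" by (intro holomorphic_intros w(1))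
  have qwG: "poly q z * w z * G z = 0" for z
  proof (rule continuous_eq_0_of_cosparse[where f = "\<lambda>z. poly q z * w z * G z"])
    show "continuous_on UNIV (\<lambda>z. poly q z * w z * G z)"
      by (intro holomorphic_on_imp_continuous_on holomorphic_on_mult qw G)
    show "\<forall>\<^sub>\<approx>z\<in>UNIV. poly q z * w z * G z = 0"
      using eq unfolding solves_equation_def
    proof eventually_elim
      case (elim z)
      show ?case
      proof (cases "poly q z = 0 \<or> w z = 0")
        case False
        then have qz: "poly q z \<noteq> 0" "w z \<noteq> 0" by auto
        define t where "t = deriv w z / w z"
        have t: "w z * t = deriv w z" using qz(2) by (simp add: t_def)
        have "poly q z * w z * (w (z + 1) - w (z - 1)) + poly q z * a z * (w z * t)
            = poly q z * w z * (w (z + 1) - w (z - 1) + a z * t)" by (simp add: algebra_simps)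
        also have "\<dots> = poly q z * w z * (a1 z * w z + a0 z)" using elim by (simp add: t_def)
        also have "\<dots> = (poly q z * a1 z) * w z * w z + (poly q z * a0 z) * w z" by (simp add: algebra_simps)
        finally have "poly q z * w z * (w (z + 1) - w (z - 1)) + poly q z * a z * deriv w z
            = (poly q z * a1 z) * w z * w z + (poly q z * a0 z) * w z" unfolding t .
        then have "poly q z * w z * (w (z + 1) - w (z - 1)) + poly A z * deriv w z = poly A1 z * w z * w z + poly A0 z * w z"
          using den[OF qz(1)] by simp
        then have "G z = 0" by (simp add: G_def algebra_simps)
        then show ?thesis by simp
      qed auto
    qed
  qed
  obtain z2 where "poly q z2 * w z2 \<noteq> 0"
  proof (rule ccontr)
    assume "\<not> thesis"
    then have z: "w z * poly q z = 0" for z using that[of z] by (auto simp: mult.commute)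
    have "poly q z = 0" for z
      by (rule entire_mult_eq_0[OF w(1) _ z w(2)]) (intro holomorphic_intros)
    then show False using q poly_all_0_iff_0 by blast
  qed
  then have "G z = 0" using entire_mult_eq_0[OF qw G qwG] by blast
  then show ?thesis by (simp add: G_def)
qed

text \<open>At a zero of order \<open>k\<close> the derivative vanishes only to order
  \<open>k - 1\<close>, the right side to order at least \<open>k\<close>; the missing factor must
  come from \<open>A\<close>.\<close>

lemma zero_of_logarithmic_derivative_identity:
  assumes w: "w holomorphic_on UNIV" "w z0 \<noteq> 0" and G: "G holomorphic_on UNIV"
    and eq: "\<And>z. poly A z * deriv w z = w z * G z" and a: "w a = 0"
  shows "poly A a = 0"
proof -
  obtain k h where h: "h holomorphic_on UNIV" "h a \<noteq> 0" "\<And>z. w z = (z - a) ^ k * h z"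
    using entire_factor[OF w] by blast
  obtain j where k: "k = Suc j" using a h(2) h(3)[of a] by (cases k) auto
  have dw: "deriv w z = (z - a) ^ j * (of_nat k * h z + (z - a) * deriv h z)" for z
  proof -
    have "w = (\<lambda>z. (z - a) ^ k * h z)" using h(3) by blast
    moreover have "((\<lambda>z. (z - a) ^ k * h z) has_field_derivative (z - a) ^ j * (of_nat k * h z + (z - a) * deriv h z)) (at z)"
    proof -
      have e: "k - Suc 0 = j" by (simp add: k)
      have "((\<lambda>z. (z - a) ^ k) has_field_derivative of_nat k * ((1 - 0) * (z - a) ^ (k - Suc 0))) (at z)"
        by (intro DERIV_power DERIV_diff DERIV_ident DERIV_const)
      from DERIV_mult[OF this holomorphic_derivI[OF h(1) open_UNIV UNIV_I]]
      have "((\<lambda>z. (z - a) ^ k * h z) has_field_derivative of_nat k * ((1 - 0) * (z - a) ^ j) * h z + deriv h z * (z - a) ^ k) (at z)"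
        unfolding e .
      moreover have "of_nat k * ((1 - 0) * (z - a) ^ j) * h z + deriv h z * (z - a) ^ k = (z - a) ^ j * (of_nat k * h z + (z - a) * deriv h z)"
        by (simp add: k algebra_simps)
      ultimately show ?thesis by simp
    qed
    ultimately show ?thesis by (metis DERIV_imp_deriv)
  qed
  have h': "deriv h holomorphic_on UNIV" using h(1) by (intro holomorphic_deriv) auto
  have "poly A z * (of_nat k * h z + (z - a) * deriv h z) - (z - a) * h z * G z = 0" for z
  proof (rule continuous_eq_0_of_cosparse[where f = "\<lambda>z. poly A z * (of_nat k * h z + (z - a) * deriv h z) - (z - a) * h z * G z"])
    show "continuous_on UNIV (\<lambda>z. poly A z * (of_nat k * h z + (z - a) * deriv h z) - (z - a) * h z * G z)"
      by (intro holomorphic_on_imp_continuous_on holomorphic_intros h(1) h' G)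
    have "poly A z * (of_nat k * h z + (z - a) * deriv h z) - (z - a) * h z * G z = 0" if "z \<noteq> a" for z
    proof -
      have "(z - a) ^ j * (poly A z * (of_nat k * h z + (z - a) * deriv h z) - (z - a) * h z * G z) = 0"
        using eq[of z] by (simp add: dw h(3) k algebra_simps)
      then show ?thesis using that by simp
    qed
    then show "\<forall>\<^sub>\<approx>z\<in>UNIV. poly A z * (of_nat k * h z + (z - a) * deriv h z) - (z - a) * h z * G z = 0"
      unfolding eventually_cosparse_open_eq[OF open_UNIV]
      by (intro ballI eventually_mono[OF eventually_neq_at_within[of a]]) auto
  qed
  from this[of a] show ?thesis using h(2) by (simp add: k del: of_nat_Suc)
qed

section \<open>Solutions without logarithmic derivative term\<close>

lemma powr_scale_le:
  assumes "1 \<le> r" "0 \<le> c" "0 < \<mu>" "0 \<le> (b::real)" "0 \<le> x" "x \<le> c * r"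
  shows "b + d * x powr \<mu> \<le> (b + \<bar>d\<bar> * c powr \<mu>) * r powr \<mu>"
proof -
  have "d * x powr \<mu> \<le> \<bar>d\<bar> * (c * r) powr \<mu>"
    using assms by (intro mult_mono powr_mono2) auto
  also have "\<dots> = \<bar>d\<bar> * c powr \<mu> * r powr \<mu>" using assms by (simp add: powr_mult)
  finally have 1: "d * x powr \<mu> \<le> \<bar>d\<bar> * c powr \<mu> * r powr \<mu>" .
  have "1 \<le> r powr \<mu>" using assms by (intro ge_one_powr_ge_zero) auto
  then have "b * 1 \<le> b * r powr \<mu>" using assms by (intro mult_left_mono)
  then show ?thesis using 1 by (simp add: distrib_right)
qed

text \<open>The characteristic is evaluated at some \<open>R < 3 * r\<close>, which changes only the
  constant in front of \<open>r powr \<mu>\<close>.\<close>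

lemma max_modulus_growth_of_order:
  assumes w: "w holomorphic_on UNIV" and \<mu>: "0 < \<mu>"
    and T: "eventually (\<lambda>r. nevanlinna_char w r \<le> r powr \<mu>) at_top"
  obtains C where "eventually (\<lambda>r. max_modulus w r \<le> exp (C * r powr \<mu>)) at_top"
proof -
  obtain C where C: "0 \<le> C" "\<And>r. 0 < r \<Longrightarrow> \<exists>R. 2 * r < R \<and> R < 3 * r \<and>
     (\<forall>z\<in>cball 0 r. cmod (w z) \<le> exp (C + 4 * circle_mean R (\<lambda>z. log_plus (cmod (w z)))))"
    using max_modulus_le_proximity[OF w] by blast
  obtain R0 where R0: "\<And>r. R0 \<le> r \<Longrightarrow> nevanlinna_char w r \<le> r powr \<mu>"
    using T unfolding eventually_at_top_linorder by blast
  show ?thesis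
  proof (rule that)
    show "eventually (\<lambda>r. max_modulus w r \<le> exp ((C + \<bar>4\<bar> * 3 powr \<mu>) * r powr \<mu>)) at_top"
      using eventually_ge_at_top[of "max 1 R0"]
    proof eventually_elim
      case (elim r)
      then have r: "1 \<le> r" "R0 \<le> r" by auto
      obtain R where R: "2 * r < R" "R < 3 * r"
        "\<forall>z\<in>cball 0 r. cmod (w z) \<le> exp (C + 4 * circle_mean R (\<lambda>z. log_plus (cmod (w z))))"
        using C(2)[of r] r by auto
      have "circle_mean R (\<lambda>z. log_plus (cmod (w z))) \<le> R powr \<mu>"
        using R0[of R] R r unfolding nevanlinna_char_entire[OF w] by simp
      moreover have "C + 4 * R powr \<mu> \<le> (C + \<bar>4\<bar> * 3 powr \<mu>) * r powr \<mu>"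
        using r R C(1) \<mu> by (intro powr_scale_le) auto
      ultimately have "C + 4 * circle_mean R (\<lambda>z. log_plus (cmod (w z))) \<le> (C + \<bar>4\<bar> * 3 powr \<mu>) * r powr \<mu>" by linarith
      then have "exp (C + 4 * circle_mean R (\<lambda>z. log_plus (cmod (w z)))) \<le> exp ((C + \<bar>4\<bar> * 3 powr \<mu>) * r powr \<mu>)" by simp
      then show ?case using R(3) r by (intro max_modulus_le w) (auto intro: order_trans)
    qed
  qed
qed

text \<open>The split is on whether \<open>A1 / q\<close> tends to zero at infinity. If it does, the
  derivative has to double, and Cauchy's estimate on unit discs passes the growth bound on to
  it.\<close>

lemma slow_difference_equation_imp_False:
  assumes w: "w holomorphic_on UNIV" and np: "\<not> (\<exists>p. \<forall>z. w z = poly p z)"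
    and eq: "\<And>z. poly q z * (w (z + 1) - w (z - 1)) = poly A1 z * w z + poly A0 z"
    and q: "q \<noteq> 0" and ord: "growth_order w < 1"
  shows False
proof -
  obtain \<mu> where \<mu>: "0 < \<mu>" "\<mu> < 1" "eventually (\<lambda>r. nevanlinna_char w r \<le> r powr \<mu>) at_top"
    using growth_order_less_1[OF ord] by blast
  obtain C where C: "eventually (\<lambda>r. max_modulus w r \<le> exp (C * r powr \<mu>)) at_top"
    using max_modulus_growth_of_order[OF w \<mu>(1,3)] by blast
  show False
  proof (cases "A1 = 0 \<or> degree A1 < degree q")
    case False
    then show ?thesis using slow_difference_equation_high_degree[OF w np eq C \<mu>(1,2)] by auto
  next
    case True
    have np': "\<not> (\<exists>p. \<forall>z. deriv w z = poly p z)" using deriv_eq_poly_imp_poly[OF w] np by blast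
    obtain R0 where R0: "\<And>r. R0 \<le> r \<Longrightarrow> max_modulus w r \<le> exp (C * r powr \<mu>)"
      using C unfolding eventually_at_top_linorder by blast
    have "eventually (\<lambda>r. max_modulus (deriv w) r \<le> exp ((0 + \<bar>C\<bar> * 2 powr \<mu>) * r powr \<mu>)) at_top"
      using eventually_ge_at_top[of "max 1 R0"]
    proof eventually_elim
      case (elim r)
      then have r: "1 \<le> r" "R0 \<le> r" by auto
      have "max_modulus (deriv w) r \<le> max_modulus w (r + 1) / 1"
        using r by (intro max_modulus_deriv_le w) auto
      also have "\<dots> \<le> exp (0 + C * (r + 1) powr \<mu>)" using R0[of "r + 1"] r by simp
      also have "\<dots> \<le> exp ((0 + \<bar>C\<bar> * 2 powr \<mu>) * r powr \<mu>)"
        unfolding exp_le_cancel_iff using r \<mu> by (intro powr_scale_le) auto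
      finally show ?case .
    qed
    then show ?thesis using slow_difference_equation_low_degree[OF w np eq _ \<mu>(1,2) np' q True] by blast
  qed
qed

section \<open>Solutions with logarithmic derivative term\<close>

lemma degree_le_1_obtain:
  assumes "degree p \<le> 1"
  obtains c d where "p = [:c, d:]"
proof (cases p)
  case (pCons c r)
  then have "degree r = 0" using assms by (cases "r = 0") auto
  then show ?thesis using that pCons by (metis degree_0_id)
qed

text \<open>On large circles \<open>H\<close> is bounded away from zero, so the positive part of
  \<open>Re g\<close> is at most \<open>log_plus (cmod w)\<close> plus a constant, and the mean
  value property controls the negative part.\<close>

lemma circle_mean_exponent_growth:
  assumes w: "w holomorphic_on UNIV" and g: "g holomorphic_on UNIV" and H: "H \<noteq> 0"
    and wHg: "\<And>z. w z = poly H z * exp (g z)" and \<mu>: "0 < \<mu>"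
    and T: "eventually (\<lambda>r. nevanlinna_char w r \<le> exp (r powr \<mu>)) at_top"
  obtains C where "eventually (\<lambda>r. circle_mean r (\<lambda>z. \<bar>Re (g z)\<bar>) \<le> exp (C * r powr \<mu>)) at_top"
proof -
  obtain c R where c: "0 < c" "\<And>z. R \<le> cmod z \<Longrightarrow> c * cmod z ^ degree H \<le> cmod (poly H z)"
    using poly_lower_bound[OF H] by blast
  define B where "B = 2 * \<bar>ln c\<bar> + \<bar>Re (g 0)\<bar>"
  have B: "0 \<le> B" by (simp add: B_def)
  show ?thesis
  proof (rule that)
    show "eventually (\<lambda>r. circle_mean r (\<lambda>z. \<bar>Re (g z)\<bar>) \<le> exp ((ln (2 + B) + 1) * r powr \<mu>)) at_top"
      using T eventually_ge_at_top[of "max 1 R"]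
    proof eventually_elim
      case (elim r)
      then have r: "1 \<le> r" "R \<le> r" by auto
      have cont: "continuous_on (sphere 0 r) g" "continuous_on (sphere 0 r) w"
        using w g holomorphic_on_imp_continuous_on continuous_on_subset by blast+
      have pt: "max 0 (Re (g z)) \<le> log_plus (cmod (w z)) + \<bar>ln c\<bar>" if z: "cmod z = r" for z
      proof -
        have "c * 1 \<le> c * r ^ degree H" using c r by (intro mult_left_mono) auto
        then have "c \<le> cmod (poly H z)" using c(2)[of z] r z by simp
        then have "c * exp (Re (g z)) \<le> cmod (w z)" by (simp add: wHg norm_mult mult_right_mono)
        then have "ln (c * exp (Re (g z))) \<le> ln (cmod (w z))"
          using c(1) by (intro ln_mono) (auto intro: less_le_trans)
        then have "ln c + Re (g z) \<le> ln (cmod (w z))" using c(1) by (simp add: ln_mult)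
        moreover have "ln (cmod (w z)) \<le> log_plus (cmod (w z))" by (simp add: log_plus_def)
        ultimately have "Re (g z) \<le> log_plus (cmod (w z)) + \<bar>ln c\<bar>" by linarith
        then show ?thesis using log_plus_nonneg[of "cmod (w z)"] by simp
      qed
      have "circle_mean r (\<lambda>z. max 0 (Re (g z))) \<le> circle_mean r (\<lambda>z. log_plus (cmod (w z)) + \<bar>ln c\<bar>)"
        using r pt by (intro circle_mean_mono continuous_intros cont) auto
      also have "\<dots> = circle_mean r (\<lambda>z. log_plus (cmod (w z))) + \<bar>ln c\<bar>"
        using r by (subst circle_mean_add) (auto intro!: continuous_intros cont)
      also have "circle_mean r (\<lambda>z. log_plus (cmod (w z))) \<le> exp (r powr \<mu>)"
        using elim(1) unfolding nevanlinna_char_entire[OF w] .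
      finally have m: "circle_mean r (\<lambda>z. max 0 (Re (g z))) \<le> exp (r powr \<mu>) + \<bar>ln c\<bar>" by simp
      have "circle_mean r (\<lambda>z. \<bar>Re (g z)\<bar>) = 2 * circle_mean r (\<lambda>z. max 0 (Re (g z))) - Re (g 0)"
        using r by (intro circle_mean_abs_Re holomorphic_on_subset[OF g]) auto
      then have "circle_mean r (\<lambda>z. \<bar>Re (g z)\<bar>) \<le> 2 * exp (r powr \<mu>) + B" using m by (simp add: B_def)
      also have "\<dots> \<le> (2 + B) * exp (r powr \<mu>)"
        using mult_left_mono[of 1 "exp (r powr \<mu>)" B] B by (simp add: distrib_right)
      also have "\<dots> = exp (ln (2 + B) * 1 + r powr \<mu>)" using B by (simp add: exp_add)
      also have "\<dots> \<le> exp ((ln (2 + B) + 1) * r powr \<mu>)"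
      proof -
        have "1 \<le> r powr \<mu>" using r \<mu> by (intro ge_one_powr_ge_zero) auto
        then have "ln (2 + B) * 1 \<le> ln (2 + B) * r powr \<mu>" using B by (intro mult_left_mono) auto
        then show ?thesis by (simp add: distrib_right)
      qed
      finally show ?case .
    qed
  qed
qed

text \<open>The last conclusion keeps the equation as a polynomial identity, from which the special
  values of \<open>a1\<close> are read off.\<close>

lemma solution_form:
  fixes q A A0 A1 :: "complex poly"
  assumes w: "w holomorphic_on UNIV" and np: "\<not> (\<exists>p. \<forall>z. w z = poly p z)"
    and q: "q \<noteq> 0" and A: "A \<noteq> 0"
    and eq: "\<And>z. poly A z * deriv w z = w z * (poly A1 z * w z + poly A0 z - poly q z * (w (z + 1) - w (z - 1)))"
    and ord: "hyper_order w < 1"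
  obtains H d where "H \<noteq> 0" "d \<noteq> 0" "\<And>z. w z = poly H z * exp (d * z)"
    "q * (smult (exp d) (pcompose H [:1, 1:]) - smult (1 / exp d) (pcompose H [:-1, 1:])) = A1 * H"
proof -
  obtain \<mu> where \<mu>: "0 < \<mu>" "\<mu> < 1" "eventually (\<lambda>r. nevanlinna_char w r \<le> exp (r powr \<mu>)) at_top"
    using hyper_order_less_1[OF ord] by blast
  have "\<exists>z0. w z0 \<noteq> 0"
  proof (rule ccontr)
    assume "\<not> ?thesis"
    then have "\<forall>z. w z = poly 0 z" by simp
    then show False using np by blast
  qed
  then obtain z0 where z0: "w z0 \<noteq> 0" by blast
  have wsh: "(\<lambda>z. w (z + 1)) holomorphic_on UNIV" "(\<lambda>z. w (z - 1)) holomorphic_on UNIV"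
    by (rule holomorphic_on_compose_gen[OF _ w, unfolded o_def]; auto intro!: holomorphic_intros)+
  have Ghol: "(\<lambda>z. poly A1 z * w z + poly A0 z - poly q z * (w (z + 1) - w (z - 1))) holomorphic_on UNIV"
    by (intro holomorphic_intros w wsh)
  have "{z. w z = 0} \<subseteq> {z. poly A z = 0}"
    using zero_of_logarithmic_derivative_identity[OF w z0 Ghol eq] by blast
  then have "finite {z. w z = 0}" using poly_roots_finite[OF A] finite_subset by blast
  then obtain H g where H: "H \<noteq> 0" and g: "g holomorphic_on UNIV" and wHg: "\<And>z. w z = poly H z * exp (g z)"
    using entire_finite_zeros_factor[OF w z0] by blast
  \<comment> \<open>After inserting \<open>w = H * exp g\<close> and dividing by
    \<open>- exp (g z)\<close>, the terms without a further exponential form \<open>R\<close>; the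
    rest is \<open>exp (g z)\<close> times the combination with coefficients \<open>X\<close>,
    \<open>Y\<close>, \<open>Z\<close>.\<close>
  define X where "X = H * q * pcompose H [:1, 1:]"
  define Y where "Y = - (H * q * pcompose H [:-1, 1:])"
  define Z where "Z = - (A1 * H * H)"
  define p where "p = A0 * H - A * pderiv H"
  define s where "s = - (A * H)"
  define R where "R = (\<lambda>z. poly p z + poly s z * deriv g z)"
  have dw: "deriv w z = (poly (pderiv H) z + poly H z * deriv g z) * exp (g z)" for z
  proof -
    have "w = (\<lambda>z. poly H z * exp (g z))" using wHg by blast
    moreover have "((\<lambda>z. poly H z * exp (g z)) has_field_derivative (poly (pderiv H) z + poly H z * deriv g z) * exp (g z)) (at z)"
      using g by (auto intro!: derivative_eq_intros holomorphic_derivI[of g UNIV] simp: algebra_simps)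
    ultimately show ?thesis by (metis DERIV_imp_deriv)
  qed
  have F: "R z = exp (g z) * (poly X z * exp (g (z + 1) - g z) + poly Y z * exp (g (z - 1) - g z) + poly Z z)" for z
  proof -
    have sh: "poly (pcompose H [:1, 1:]) z = poly H (z + 1)" "poly (pcompose H [:-1, 1:]) z = poly H (z - 1)"
      by (simp_all add: poly_pcompose add.commute)
    have e: "exp (g (z + 1)) = exp (g z) * exp (g (z + 1) - g z)" "exp (g (z - 1)) = exp (g z) * exp (g (z - 1) - g z)"
      by (simp_all add: exp_diff)
    have "exp (g z) * R z = exp (g z) * (exp (g z) * (poly X z * exp (g (z + 1) - g z) + poly Y z * exp (g (z - 1) - g z) + poly Z z))"
      using eq[of z] unfolding dw wHg e R_def X_def Y_def Z_def p_def s_def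
      by (simp add: sh algebra_simps)
    then show ?thesis by simp
  qed
  have nc: "\<exists>z1. g z1 \<noteq> g 0"
  proof (rule ccontr)
    assume "\<not> ?thesis"
    then have gc: "g z = g 0" for z by blast
    have "\<forall>z. w z = poly (smult (exp (g 0)) H) z" by (subst wHg, subst gc) simp
    then show False using np by blast
  qed
  obtain C where C: "eventually (\<lambda>r. circle_mean r (\<lambda>z. \<bar>Re (g z)\<bar>) \<le> exp (C * r powr \<mu>)) at_top"
    using circle_mean_exponent_growth[OF w g H wHg \<mu>(1,3)] by blast
  have R0: "R z = 0" for z
  proof (rule ccontr)
    assume nz: "R z \<noteq> 0"
    obtain z1 where "g z1 \<noteq> g 0" using nc by blast
    from exp_shift_polynomial_small_imp_False[OF g this C \<mu>(1,2) _ F nz, of p s] show False by (simp add: R_def)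
  qed
  \<comment> \<open>With \<open>R = 0\<close> the entire function \<open>deriv g\<close> is a
    quotient of polynomials, hence a polynomial.\<close>
  have "\<exists>s. \<forall>z. deriv g z = poly s z"
  proof (rule entire_quotient_poly)
    have "deriv g holomorphic_on UNIV" using g by (intro holomorphic_deriv) auto
    then show "continuous_on UNIV (deriv g)" by (rule holomorphic_on_imp_continuous_on)
    show "s \<noteq> 0" using A H by (simp add: s_def)
    show "poly s z * deriv g z = poly (- p) z" for z using R0[of z] by (simp add: R_def add_eq_0_iff)
  qed
  then obtain \<gamma> where \<gamma>: "\<And>z. g z = poly \<gamma> z" using deriv_eq_poly_imp_poly[OF g] by blast
  have "X \<noteq> 0"
  proof -
    have "pcompose H [:1, 1:] \<noteq> 0" using H by (simp add: pcompose_eq_0_iff)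
    then show ?thesis using H q by (simp add: X_def)
  qed
  have XYZ: "poly X z * exp (g (z + 1) - g z) + poly Y z * exp (g (z - 1) - g z) + poly Z z = 0" for z
    using F[of z] R0[of z] by simp
  have "degree \<gamma> \<le> 1"
  proof (rule shift_difference_exponent_linear[OF _ \<open>X \<noteq> 0\<close>])
    show "poly X z * exp (poly \<gamma> (z + 1) - poly \<gamma> z) = poly (- Y) z * exp (poly \<gamma> (z - 1) - poly \<gamma> z) + poly (- Z) z" for z
      using XYZ[of z] by (simp add: \<gamma> algebra_simps eq_neg_iff_add_eq_0)
  qed
  then obtain c d where cd: "\<gamma> = [:c, d:]" by (rule degree_le_1_obtain)
  have gz: "g z = c + d * z" for z by (simp add: \<gamma> cd mult.commute)
  \<comment> \<open>The constant term of the exponent is absorbed into the polynomial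
    factor.\<close>
  have wz: "w z = poly (smult (exp c) H) z * exp (d * z)" for z by (simp add: wHg gz exp_add)
  have "d \<noteq> 0"
  proof
    assume "d = 0"
    then have "\<forall>z. w z = poly (smult (exp c) H) z" using wz by simp
    then show False using np by blast
  qed
  \<comment> \<open>For a linear exponent the shift exponentials are the constants
    \<open>exp d\<close> and \<open>1 / exp d\<close>.\<close>
  have "X * [:exp d:] + Y * [:1 / exp d:] + Z = 0"
  proof -
    have "poly (X * [:exp d:] + Y * [:1 / exp d:] + Z) z = 0" for z
      using XYZ[of z] by (simp add: gz algebra_simps exp_minus inverse_eq_divide)
    then show ?thesis using poly_all_0_iff_0 by blast
  qed
  then have "H * (q * (smult (exp d) (pcompose H [:1, 1:]) - smult (1 / exp d) (pcompose H [:-1, 1:])) - A1 * H) = 0"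
    by (simp add: X_def Y_def Z_def algebra_simps)
  then have HH: "q * (smult (exp d) (pcompose H [:1, 1:]) - smult (1 / exp d) (pcompose H [:-1, 1:])) = A1 * H"
    using H by simp
  show ?thesis
  proof (rule that[of "smult (exp c) H" d])
    show "q * (smult (exp d) (pcompose (smult (exp c) H) [:1, 1:]) - smult (1 / exp d) (pcompose (smult (exp c) H) [:-1, 1:])) = A1 * smult (exp c) H"
      using arg_cong[OF HH, of "smult (exp c)"] by (simp add: pcompose_smult algebra_simps smult_diff_right mult.commute)
  qed (use H wz \<open>d \<noteq> 0\<close> in auto)
qed

text \<open>The real \<open>\<sigma>\<close> treats both signs at once; \<open>k\<close> is the
  ambiguity left by the period of \<open>exp\<close>.\<close>

lemma exp_eq_imaginary_unit_obtain:
  assumes "\<sigma> = 1 \<or> \<sigma> = - 1" "exp d = of_real \<sigma> * \<i>"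
  obtains k :: int where "d = (2 * of_int k + of_real \<sigma> / 2) * of_real pi * \<i>"
proof -
  have "exp (of_real (\<sigma> * pi / 2) * \<i>) = of_real \<sigma> * \<i>"
    using assms(1) by (auto simp: exp_eq_polar complex_eq_iff cis.code mult.commute exp_Euler)
  then have "exp d = exp (of_real (\<sigma> * pi / 2) * \<i>)" using assms(2) by simp
  then obtain n :: int where "d = of_real (\<sigma> * pi / 2) * \<i> + (of_int (2 * n) * pi) * \<i>"
    using exp_eq[of d] by blast
  then have "d = (2 * of_int n + of_real \<sigma> / 2) * of_real pi * \<i>" by (simp add: algebra_simps)
  then show ?thesis by (rule that)
qed

text \<open>Here \<open>a1 = \<plusminus> 2 \<i>\<close> is the value at which \<open>E - 1 / E = a1\<close> has a double root \<open>E = \<plusminus> \<i>\<close>; this is what lets \<open>H\<close> have degree one.\<close>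

lemma shift_combination_critical:
  fixes H :: "complex poly"
  assumes \<sigma>: "\<sigma> = 1 \<or> \<sigma> = - 1"
    and eq: "smult (exp d) (pcompose H [:1, 1:]) - smult (1 / exp d) (pcompose H [:-1, 1:]) = [:of_real \<sigma> * (2 * \<i>):] * H"
    and H: "H \<noteq> 0" and w: "\<And>z. w z = poly H z * exp (d * z)"
  shows "\<exists>(k :: int) (C1 :: complex) (C0 :: complex). cmod C1 + cmod C0 \<noteq> 0 \<and>
            (\<forall>z. w z = (C1 * z + C0) * exp ((2 * of_int k + of_real \<sigma> / 2) * of_real pi * \<i> * z))"
proof -
  have "[:of_real \<sigma> * (2 * \<i>):] = [:exp d - 1 / exp d:]"
    using shift_combination_eq_mult(1)[OF eq H] by simp
  then have "exp d - 1 / exp d = of_real \<sigma> * (2 * \<i>)" by simp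
  then have "exp d * exp d - 1 = of_real \<sigma> * (2 * \<i>) * exp d" by (simp add: field_simps)
  moreover have "(of_real \<sigma> * \<i>) * (of_real \<sigma> * \<i>) = - 1" using \<sigma> by auto
  ultimately have "(exp d - of_real \<sigma> * \<i>) * (exp d - of_real \<sigma> * \<i>) = 0" by (simp add: algebra_simps)
  then have E: "exp d = of_real \<sigma> * \<i>" by simp
  have E': "1 / exp d = - (of_real \<sigma> * \<i>)" using \<sigma> by (auto simp: E)
  \<comment> \<open>Since \<open>1 / exp d = - exp d\<close> here, the combination of the two shifts
    turns into their sum, that is, into a second difference.\<close>
  have "smult (of_real \<sigma> * \<i>) (pcompose H [:1, 1:] + pcompose H [:-1, 1:]) = smult (of_real \<sigma> * \<i>) (smult 2 H)"
    using eq unfolding E' unfolding E by (simp add: smult_add_right algebra_simps)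
  then have "pcompose H [:1, 1:] + pcompose H [:-1, 1:] = smult 2 H"
    using \<sigma> by (metis complex_i_not_zero mult_eq_0_iff of_real_eq_0_iff smult_eq_iff zero_neq_neg_one zero_neq_one)
  then have "degree H \<le> 1" by (rule second_difference_0_imp_degree_le_1)
  then obtain C0 C1 where C: "H = [:C0, C1:]" by (rule degree_le_1_obtain)
  obtain k :: int where "d = (2 * of_int k + of_real \<sigma> / 2) * of_real pi * \<i>" using exp_eq_imaginary_unit_obtain[OF \<sigma> E] by blast
  moreover have "cmod C1 + cmod C0 \<noteq> 0" using H unfolding C by (auto simp: add_nonneg_eq_0_iff)
  ultimately show ?thesis using w by (intro exI[of _ k] exI[of _ C1] exI[of _ C0]) (simp add: C algebra_simps)
qed

theorem theorem1p2:
  fixes a a0 a1 w :: "complex \<Rightarrow> complex"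
  assumes "rational_function a" and "rational_function a0" and "rational_function a1"
    and "(\<exists>z. a1 z \<noteq> 0) \<or> (\<exists>z. a0 z \<noteq> 0)"
    and "transcendental_entire w"
    and "hyper_order w < 1"
    and "solves_equation a a0 a1 w"
  shows "((\<forall>z. a z = 0) \<longrightarrow> growth_order w \<ge> 1) \<and>
    ((\<exists>z. a z \<noteq> 0) \<longrightarrow>
      (\<exists>(H :: complex poly) (d :: complex). H \<noteq> 0 \<and> d \<noteq> 0 \<and>
         (\<forall>z. w z = poly H z * exp (d * z)) \<and>
         ((\<exists>p :: complex poly. \<forall>z. a1 z = poly p z) \<and>
          (\<exists>z. a1 z \<noteq> 2 * \<i>) \<and> (\<exists>z. a1 z \<noteq> - 2 * \<i>) \<longrightarrow>
            (\<exists>C :: complex. C \<noteq> 0 \<and> (\<forall>z. w z = C * exp (d * z))))) \<and>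
      ((\<forall>z. a1 z = 2 * \<i>) \<longrightarrow>
         (\<exists>(k :: int) (C1 :: complex) (C0 :: complex). cmod C1 + cmod C0 \<noteq> 0 \<and>
            (\<forall>z. w z = (C1 * z + C0) * exp ((2 * of_int k + 1 / 2) * of_real pi * \<i> * z)))) \<and>
      ((\<forall>z. a1 z = - 2 * \<i>) \<longrightarrow>
         (\<exists>(k :: int) (C1 :: complex) (C0 :: complex). cmod C1 + cmod C0 \<noteq> 0 \<and>
            (\<forall>z. w z = (C1 * z + C0) * exp ((2 * of_int k - 1 / 2) * of_real pi * \<i> * z)))))"
proof -
  have w: "w holomorphic_on UNIV" using assms(5) by (simp add: transcendental_entire_def)
  have np: "\<not> (\<exists>p. \<forall>z. w z = poly p z)" by (rule transcendental_entire_not_poly[OF assms(5)])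
  have "\<exists>z0. w z0 \<noteq> 0"
  proof (rule ccontr)
    assume "\<not> ?thesis"
    then have "\<forall>z. w z = poly 0 z" by simp
    then show False using np by blast
  qed
  then obtain z0 where z0: "w z0 \<noteq> 0" by blast
  obtain q A A0 A1 where q: "q \<noteq> 0"
    and den: "\<And>z. poly q z \<noteq> 0 \<Longrightarrow> poly q z * a z = poly A z \<and> poly q z * a0 z = poly A0 z \<and> poly q z * a1 z = poly A1 z"
    and A: "A = 0 \<longleftrightarrow> (\<forall>z. a z = 0)"
    using rational_function_common_denominator[OF assms(1,2,3)] by blast
  note eq = solves_equation_entire_identity[OF w z0 q assms(7) den]
  show ?thesis
  proof (intro conjI impI)
    assume "\<forall>z. a z = 0"
    then have A0: "A = 0" using A by simp
    show "growth_order w \<ge> 1"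
    proof (rule ccontr)
      assume "\<not> ?thesis"
      then have ord: "growth_order w < 1" by simp
      have wsh: "(\<lambda>z. w (z + 1)) holomorphic_on UNIV" "(\<lambda>z. w (z - 1)) holomorphic_on UNIV"
        by (rule holomorphic_on_compose_gen[OF _ w, unfolded o_def]; auto intro!: holomorphic_intros)+
      \<comment> \<open>With \<open>A = 0\<close> the identity is \<open>w\<close> times the
        difference equation, and \<open>w\<close> cancels.\<close>
      have "poly A1 z * w z + poly A0 z - poly q z * (w (z + 1) - w (z - 1)) = 0" for z
      proof (rule entire_mult_eq_0[OF w _ _ z0, where g = "\<lambda>z. poly A1 z * w z + poly A0 z - poly q z * (w (z + 1) - w (z - 1))"])
        show "(\<lambda>z. poly A1 z * w z + poly A0 z - poly q z * (w (z + 1) - w (z - 1))) holomorphic_on UNIV"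
          by (intro holomorphic_intros w wsh)
        show "w z * (poly A1 z * w z + poly A0 z - poly q z * (w (z + 1) - w (z - 1))) = 0" for z
          using eq[of z] by (simp add: A0)
      qed
      then have "poly q z * (w (z + 1) - w (z - 1)) = poly A1 z * w z + poly A0 z" for z by (metis eq_iff_diff_eq_0)
      then show False using slow_difference_equation_imp_False[OF w np _ q ord] by blast
    qed
  next
    assume "\<exists>z. a z \<noteq> 0"
    then have "A \<noteq> 0" using A by blast
    then obtain H d where H: "H \<noteq> 0" and d: "d \<noteq> 0" and wz: "\<And>z. w z = poly H z * exp (d * z)"
      and HH: "q * (smult (exp d) (pcompose H [:1, 1:]) - smult (1 / exp d) (pcompose H [:-1, 1:])) = A1 * H"
      using solution_form[OF w np q _ eq assms(6)] by blast
    \<comment> \<open>For polynomial \<open>a1\<close> the numerator \<open>A1\<close> is a multiple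
      of \<open>q\<close>, so \<open>q\<close> cancels from the identity.\<close>
    have red: "smult (exp d) (pcompose H [:1, 1:]) - smult (1 / exp d) (pcompose H [:-1, 1:]) = p * H"
      if "\<And>z. a1 z = poly p z" for p
    proof -
      have "A1 = q * p" by (rule poly_eq_off_roots[OF q]) (use den that in auto)
      then have "q * (smult (exp d) (pcompose H [:1, 1:]) - smult (1 / exp d) (pcompose H [:-1, 1:])) = q * (p * H)"
        using HH by (simp add: mult.assoc)
      then show ?thesis using q mult_left_cancel by blast
    qed
    show "\<exists>H d. H \<noteq> 0 \<and> d \<noteq> 0 \<and> (\<forall>z. w z = poly H z * exp (d * z)) \<and>
         ((\<exists>p. \<forall>z. a1 z = poly p z) \<and> (\<exists>z. a1 z \<noteq> 2 * \<i>) \<and> (\<exists>z. a1 z \<noteq> - 2 * \<i>) \<longrightarrow>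
            (\<exists>C. C \<noteq> 0 \<and> (\<forall>z. w z = C * exp (d * z))))"
    proof (rule exI[of _ H], rule exI[of _ d], intro conjI impI allI H d wz)
      assume "(\<exists>p. \<forall>z. a1 z = poly p z) \<and> (\<exists>z. a1 z \<noteq> 2 * \<i>) \<and> (\<exists>z. a1 z \<noteq> - 2 * \<i>)"
      then obtain p where p: "\<And>z. a1 z = poly p z" "\<exists>z. a1 z \<noteq> 2 * \<i>" "\<exists>z. a1 z \<noteq> - 2 * \<i>" by blast
      note pE = shift_combination_eq_mult[OF red[OF p(1)] H exp_not_eq_zero]
      have "degree H = 0"
      proof (rule ccontr)
        assume "degree H \<noteq> 0"
        then have "exp d = \<i> \<or> exp d = - \<i>" by (rule pE(2))
        \<comment> \<open>A nonconstant \<open>H\<close> would make \<open>a1\<close> one of the two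
          excluded constants.\<close>
        then have "exp d - 1 / exp d = 2 * \<i> \<or> exp d - 1 / exp d = - 2 * \<i>" by auto
        then show False using p(2,3) unfolding p(1) pE(1) by auto
      qed
      then obtain C where C: "H = [:C:]" by (metis degree_0_id)
      then show "\<exists>C. C \<noteq> 0 \<and> (\<forall>z. w z = C * exp (d * z))" using H wz by (intro exI[of _ C]) auto
    qed
    show "\<exists>(k :: int) C1 C0. cmod C1 + cmod C0 \<noteq> 0 \<and>
            (\<forall>z. w z = (C1 * z + C0) * exp ((2 * of_int k + 1 / 2) * of_real pi * \<i> * z))"
      if "\<forall>z. a1 z = 2 * \<i>"
      using shift_combination_critical[of 1, OF _ _ H wz] red[of "[:2 * \<i>:]"] that by simp
    show "\<exists>(k :: int) C1 C0. cmod C1 + cmod C0 \<noteq> 0 \<and>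
            (\<forall>z. w z = (C1 * z + C0) * exp ((2 * of_int k - 1 / 2) * of_real pi * \<i> * z))"
      if "\<forall>z. a1 z = - 2 * \<i>"
      using shift_combination_critical[of "- 1", OF _ _ H wz] red[of "[:- 2 * \<i>:]"] that by simp
  qed
qed

end
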